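(* For any moon polyomino $\mathcal M$, the Ehrhart function $k\mapsto\#(\mathbb Z^{\mathcal M}\cap k\,\mathrm{QSTAB}(\mathcal M))$ ($k\in\mathbb Z_{\ge0}$) is a polynomial in $k$. In other words, the number of fillings $x\in\mathbb Z_{\ge0}^{\mathcal M}$ in which the maximum weight of a weak northeast chain is at most $k$ is a polynomial in $k$. Moreover, this polynomial depends only on $\mathcal M$ up to equivalence: if $\mathcal M$ and $\mathcal N$ are equivalent moon polyominoes, the corresponding polynomials are equal.
   Context: A polyomino is a finite subset of $\mathbb Z\times\mathbb Z$. Its $i$th up-diagonal is the set of its boxes $(i,j)$ with $i$ fixed; its $j$th down-diagonal is the set of its boxes $(i,j)$ with $j$ fixed. It is convex if every up-diagonal and every down-diagonal is connected (the varying coordinate runs over an interval of integers), and intersection-free if for any $i_1,i_2$ the sets $\{j:(i_1,j)\in\mathcal M\}$ and $\{j:(i_2,j)\in\mathcal M\}$ are comparable under inclusion. A moon polyomino is a convex intersection-free polyomino. Two moon polyominoes are equivalent if one can be obtained from the other by permuting up-diagonals and down-diagonals (i.e. there are permutations $\sigma,\tau$ of $\mathbb Z$ with $\mathcal N=\{(\sigma(i),\tau(j)):(i,j)\in\mathcal M\}$). A filling of $\mathcal M$ is an element $x\in\mathbb Z_{\ge0}^{\mathcal M}$. A rectangle is a set $[i_1,i_2]\times[j_1,j_2]$ (integer intervals), viewed as a poset under the product order. A weak northeast chain of $x$ is a chain in some rectangle contained in $\mathcal M$; its weight is the sum of the labels of $x$ on it. $G_{\mathcal M}$ is the graph on the boxes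 of $\mathcal M$ in which distinct boxes $(u_1,v_1),(u_2,v_2)$ are adjacent if (after possibly swapping them) $u_1\le u_2$, $v_1\le v_2$ and $[u_1,u_2]\times[v_1,v_2]\subseteq\mathcal M$. $\mathrm{QSTAB}(\mathcal M)\subseteq\mathbb R^{\mathcal M}$ is the polytope defined by $x_v\ge0$ for all $v\in\mathcal M$ and $\sum_{v\in C}x_v\le1$ for all cliques $C$ of $G_{\mathcal M}$. (It need not be a lattice polytope.) *)

theory Defs
  imports
    Complex_Main
    "HOL-Library.FuncSet"
    "HOL-Library.Product_Order"
    "HOL-Library.Ramsey"
    "HOL-Computational_Algebra.Polynomial"
begin

type_synonym box = "int \<times> int"

definition int_connected :: "int set \<Rightarrow> bool" where
  "int_connected I \<longleftrightarrow> (\<forall>a\<in>I. \<forall>b\<in>I. {a..b} \<subseteq> I)"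

definition polyomino :: "box set \<Rightarrow> bool" where
  "polyomino M \<longleftrightarrow> finite M"

definition convex_polyomino :: "box set \<Rightarrow> bool" where
  "convex_polyomino M \<longleftrightarrow> polyomino M \<and>
     (\<forall>i. int_connected {j. (i, j) \<in> M}) \<and> (\<forall>j. int_connected {i. (i, j) \<in> M})"

definition intersection_free :: "box set \<Rightarrow> bool" where
  "intersection_free M \<longleftrightarrow>
     (\<forall>i1 i2. {j. (i1, j) \<in> M} \<subseteq> {j. (i2, j) \<in> M} \<or> {j. (i2, j) \<in> M} \<subseteq> {j. (i1, j) \<in> M})"

definition moon_polyomino :: "box set \<Rightarrow> bool" where
  "moon_polyomino M \<longleftrightarrow> convex_polyomino M \<and> intersection_free M"

definition moon_equiv :: "box set \<Rightarrow> box set \<Rightarrow> bool" where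
  "moon_equiv M N \<longleftrightarrow> (\<exists>\<sigma> \<tau>. bij \<sigma> \<and> bij \<tau> \<and> N = {(\<sigma> i, \<tau> j) | i j. (i, j) \<in> M})"

(* Elements of a function space indexed by M are represented by functions that
   are extensional on M, so that distinct functions are distinct elements. *)

definition fillings :: "box set \<Rightarrow> (box \<Rightarrow> nat) set" where
  "fillings M = M \<rightarrow>\<^sub>E UNIV"

(* The order on boxes is the product order. The empty set is a weak northeast
   chain (the rectangle may be empty), so the maximum below is over a nonempty set. *)

definition weak_ne_chain :: "box set \<Rightarrow> box set \<Rightarrow> bool" where
  "weak_ne_chain M C \<longleftrightarrow> (\<exists>i1 i2 j1 j2.
     {i1..i2} \<times> {j1..j2} \<subseteq> M \<and> C \<subseteq> {i1..i2} \<times> {j1..j2} \<and>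
     Complete_Partial_Order.chain (\<le>) C)"

definition max_chain_weight :: "box set \<Rightarrow> (box \<Rightarrow> nat) \<Rightarrow> nat" where
  "max_chain_weight M x = Max {\<Sum>v\<in>C. x v | C. weak_ne_chain M C}"

definition box_graph :: "box set \<Rightarrow> box set set" where
  "box_graph M = {{(u1, v1), (u2, v2)} | u1 v1 u2 v2.
     (u1, v1) \<in> M \<and> (u2, v2) \<in> M \<and> (u1, v1) \<noteq> (u2, v2) \<and>
     u1 \<le> u2 \<and> v1 \<le> v2 \<and> {u1..u2} \<times> {v1..v2} \<subseteq> M}"

definition QSTAB :: "box set \<Rightarrow> (box \<Rightarrow> real) set" where
  "QSTAB M = {x \<in> M \<rightarrow>\<^sub>E UNIV. (\<forall>v\<in>M. x v \<ge> 0) \<and>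
     (\<forall>C. C \<subseteq> M \<and> clique C (box_graph M) \<longrightarrow> (\<Sum>v\<in>C. x v) \<le> 1)}"

definition dilate :: "box set \<Rightarrow> real \<Rightarrow> (box \<Rightarrow> real) set \<Rightarrow> (box \<Rightarrow> real) set" where
  "dilate M c P = (\<lambda>x. \<lambda>v\<in>M. c * x v) ` P"

definition ehrhart_fun :: "box set \<Rightarrow> (box \<Rightarrow> real) set \<Rightarrow> nat \<Rightarrow> nat" where
  "ehrhart_fun M P k = card ((M \<rightarrow>\<^sub>E \<int>) \<inter> dilate M (real k) P)"

end

theory Submission
  imports Defs
begin

text \<open>The boxes of \<open>\<int> \<times> \<int>\<close> carry two commuting families of crystal operators on integer fillings: column
  operators, which move a unit between adjacent columns and preserve the maximal weight of a chain in
  every set of consecutive full rows, and row operators, with the roles exchanged. An element that is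
  highest for both families is determined by its row sums or by its column sums, so a filling of a
  rectangle is determined by its pair of highest elements, and every pair of equal shape occurs (this
  is the RSK correspondence). Combining it with the rotation by 180 degrees gives an injection
  that keeps all chain weights of row intervals and reverses the order of the column intervals.
  Applied to two nested rectangles it moves the first column of a rectangle past all others. Hence
  the columns of a moon polyomino, and likewise its rows, can be sorted without changing the number of
  fillings of bounded chain weight. For the resulting Ferrers shape every chain lies in a
  rectangle of the shape, so Stanley's transfer map identifies the count with an order polynomial.\<close>

subsection \<open>Chain weights\<close>

text \<open>The obstacle is that one map has to respect two kinds of rectangles at once. When column
  \<open>l\<close> of a moon polyomino is moved, a rectangle of the new shape either stays within
  the rows of that column, and then weights of row intervals over the full width of the block
  matter, or it leaves these rows; then it avoids the moved column, and weights of column intervals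
  over the full height matter. Column operators control the first kind, row operators the second.
  Since they commute, both kinds of data can be prescribed independently, subject only to equality
  of shapes; taking the first from \<open>x\<close> and the second from its rotation turns the order
  of the columns around. A column is moved past a whole block, rather than exchanged with its
  neighbour, so that every intermediate shape is again a moon polyomino. Only injections are built:
  after rotating the plane by 180 degrees the inverse move is a move of the same kind. Weights are
  compared through \<open>chain_bnd\<close> at every threshold, which avoids handling
  maxima.\<close>

definition chain_bnd :: "(box \<Rightarrow> int) \<Rightarrow> box set \<Rightarrow> int \<Rightarrow> bool" where
  "chain_bnd x R t \<longleftrightarrow>
     (\<forall>C. C \<subseteq> R \<and> finite C \<and> Complete_Partial_Order.chain (\<le>) C \<longrightarrow> (\<Sum>v\<in>C. x v) \<le> t)"

definition transp :: "(box \<Rightarrow> 'a) \<Rightarrow> box \<Rightarrow> 'a" where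
  "transp x = (\<lambda>(i, j). x (j, i))"

lemma transp_apply [simp]: "transp x (i, j) = x (j, i)"
  by (simp add: transp_def)

lemma transp_transp [simp]: "transp (transp x) = x"
  by (auto simp: transp_def)

text \<open>Only comparability has to be preserved, not its direction; this covers transposition,
  translations and the order-reversing rotation.\<close>

lemma chain_bnd_reindex:
  assumes "inj_on h R" and "\<And>u v. u \<in> R \<Longrightarrow> v \<in> R \<Longrightarrow> u \<le> v \<Longrightarrow> h u \<le> h v \<or> h v \<le> h u"
    and "chain_bnd x (h ` R) t"
  shows "chain_bnd (\<lambda>v. x (h v)) R t"
  unfolding chain_bnd_def
proof (intro allI impI)
  fix C assume C: "C \<subseteq> R \<and> finite C \<and> Complete_Partial_Order.chain (\<le>) C"
  then have "Complete_Partial_Order.chain (\<le>) (h ` C)"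
    using assms(2) unfolding Complete_Partial_Order.chain_def by blast
  then have "(\<Sum>v\<in>h ` C. x v) \<le> t"
    using assms(3) C unfolding chain_bnd_def by (meson finite_imageI image_mono)
  then show "(\<Sum>v\<in>C. x (h v)) \<le> t"
    using assms(1) C by (subst (asm) sum.reindex) (auto intro: inj_on_subset)
qed

lemma chain_bnd_subset: "chain_bnd x S t \<Longrightarrow> R \<subseteq> S \<Longrightarrow> chain_bnd x R t"
  unfolding chain_bnd_def by (meson order_trans)

lemma chain_bnd_transp: "chain_bnd (transp x) (J \<times> I) t \<longleftrightarrow> chain_bnd x (I \<times> J) t"
proof -
  have aux: "chain_bnd (transp y) (J \<times> I) t" if "chain_bnd y (I \<times> J) t" for y I J
  proof -
    have "chain_bnd (\<lambda>v. y (prod.swap v)) (J \<times> I) t"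
      by (rule chain_bnd_reindex[of prod.swap _ y])
        (use that in \<open>auto simp: less_eq_prod_def product_swap\<close>)
    then show ?thesis by (simp add: transp_def case_prod_unfold prod.swap_def)
  qed
  show ?thesis using aux[of x I J] aux[of "transp x" J I] by auto
qed

lemma chain_bnd_cong:
  assumes "\<And>v. v \<in> R \<Longrightarrow> x v = y v"
  shows "chain_bnd x R t \<longleftrightarrow> chain_bnd y R t"
proof -
  have "(\<Sum>v\<in>C. x v) = (\<Sum>v\<in>C. y v)" if "C \<subseteq> R" for C
    using that assms by (intro sum.cong) auto
  then show ?thesis unfolding chain_bnd_def by metis
qed

text \<open>A chain meeting the block of columns \<open>{p..q}\<close> can be rerouted inside the block, as long as it
  enters and leaves the block in the same rows.\<close>

lemma chain_bnd_exchange: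
  fixes x y :: "box \<Rightarrow> int"
  assumes off: "\<And>i j. i \<in> {P..Q} \<Longrightarrow> j \<in> {a0..b0} \<Longrightarrow> i \<notin> {p..q} \<Longrightarrow> y (i, j) \<le> x (i, j)"
    and sub: "P \<le> p" "q \<le> Q"
    and block: "\<And>a b t. a0 \<le> a \<Longrightarrow> b \<le> b0 \<Longrightarrow>
      chain_bnd x ({p..q} \<times> {a..b}) t \<Longrightarrow> chain_bnd y ({p..q} \<times> {a..b}) t"
    and bnd: "chain_bnd x ({P..Q} \<times> {a0..b0}) t"
  shows "chain_bnd y ({P..Q} \<times> {a0..b0}) t"
  unfolding chain_bnd_def
proof (intro allI impI)
  fix C assume "C \<subseteq> {P..Q} \<times> {a0..b0} \<and> finite C \<and> Complete_Partial_Order.chain (\<le>) C"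
  then have CR: "C \<subseteq> {P..Q} \<times> {a0..b0}" and finC: "finite C"
    and chC: "Complete_Partial_Order.chain (\<le>) C" by auto
  define C2 where "C2 = C \<inter> {p..q} \<times> UNIV"
  define C1 where "C1 = C - C2"
  have fin: "finite C1" "finite C2" using finC by (auto simp: C1_def C2_def)
  have splitC: "(\<Sum>v\<in>C. z v) = (\<Sum>v\<in>C1. z v) + (\<Sum>v\<in>C2. z v)" for z :: "box \<Rightarrow> int"
    using sum.subset_diff[of C2 C z] finC by (simp add: C1_def C2_def)
  have C1le: "(\<Sum>v\<in>C1. y v) \<le> (\<Sum>v\<in>C1. x v)"
  proof (rule sum_mono)
    fix v assume "v \<in> C1"
    then have "v \<in> C" "fst v \<notin> {p..q}" by (auto simp: C1_def C2_def mem_Times_iff)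
    then show "y v \<le> x v" using off[of "fst v" "snd v"] CR by (auto simp: mem_Times_iff)
  qed
  have "\<exists>C'. C' \<subseteq> {P..Q} \<times> {a0..b0} \<and> finite C' \<and> Complete_Partial_Order.chain (\<le>) C' \<and>
     (\<Sum>v\<in>C. y v) \<le> (\<Sum>v\<in>C'. x v)"
  proof (cases "C2 = {}")
    case True
    then show ?thesis using C1le splitC CR finC chC by (intro exI[of _ C]) auto
  next
    case False
    \<comment> \<open>\<open>a\<close> and \<open>b\<close> are the rows in which \<open>C\<close>
      enters and leaves the block. Boxes of \<open>C\<close> left of the block lie in rows up to
      \<open>a\<close>, those right of it in rows from \<open>b\<close> on, so any chain of the
      block within \<open>{a..b}\<close> fits between them.\<close>
    define a where "a = Min (snd ` C2)"
    define b where "b = Max (snd ` C2)"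
    have ab: "a \<le> snd v" "snd v \<le> b" if "v \<in> C2" for v
      using that fin by (auto simp: a_def b_def)
    have "a \<in> snd ` C2" "b \<in> snd ` C2"
      unfolding a_def b_def using False fin by (auto intro!: Min_in Max_in)
    then have ab0: "a0 \<le> a" "b \<le> b0" using CR by (auto simp: C2_def)
    have C2R: "C2 \<subseteq> {p..q} \<times> {a..b}" using ab by (force simp: C2_def)
    have chC2: "Complete_Partial_Order.chain (\<le>) C2"
      using chC unfolding C2_def Complete_Partial_Order.chain_def by blast
    \<comment> \<open>Weights are integers: violating the bound one below the weight of
      \<open>C2\<close> means that some chain is at least as heavy as \<open>C2\<close>. The
      contrapositive of \<open>block\<close> thus produces a chain for \<open>x\<close>.\<close>
    have "\<not> chain_bnd y ({p..q} \<times> {a..b}) ((\<Sum>v\<in>C2. y v) - 1)"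
    proof
      assume "chain_bnd y ({p..q} \<times> {a..b}) ((\<Sum>v\<in>C2. y v) - 1)"
      then have "(\<Sum>v\<in>C2. y v) \<le> (\<Sum>v\<in>C2. y v) - 1"
        using C2R chC2 fin unfolding chain_bnd_def by blast
      then show False by simp
    qed
    then have "\<not> chain_bnd x ({p..q} \<times> {a..b}) ((\<Sum>v\<in>C2. y v) - 1)"
      using block ab0 by blast
    then obtain D where D: "D \<subseteq> {p..q} \<times> {a..b}" "finite D" "Complete_Partial_Order.chain (\<le>) D"
      "(\<Sum>v\<in>C2. y v) \<le> (\<Sum>v\<in>D. x v)"
      unfolding chain_bnd_def by (auto simp: not_le)
    have cmp: "u \<le> v \<or> v \<le> u" if u: "u \<in> C1" and v: "v \<in> D" for u v
    proof -
      have uC: "u \<in> C" "fst u \<notin> {p..q}" using u by (auto simp: C1_def C2_def mem_Times_iff)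
      have comp: "u \<le> c \<or> c \<le> u" if "c \<in> C2" for c
        using chC uC that unfolding Complete_Partial_Order.chain_def C2_def by blast
      have fv: "p \<le> fst v" "fst v \<le> q" "a \<le> snd v" "snd v \<le> b" using v D by auto
      have fc: "p \<le> fst c" "fst c \<le> q" if "c \<in> C2" for c using that by (auto simp: C2_def)
      show ?thesis
      proof (cases "fst u < p")
        case True
        have "snd u \<le> snd c" if "c \<in> C2" for c
          using comp[OF that] fc[OF that] True by (auto simp: less_eq_prod_def)
        then have "snd u \<le> a" using \<open>a \<in> snd ` C2\<close> by auto
        then show ?thesis using True fv by (auto simp: less_eq_prod_def)
      next
        case False
        then have "q < fst u" using uC by auto
        then have "snd c \<le> snd u" if "c \<in> C2" for c
          using comp[OF that] fc[OF that] by (auto simp: less_eq_prod_def)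
        then have "b \<le> snd u" using \<open>b \<in> snd ` C2\<close> by auto
        then show ?thesis using \<open>q < fst u\<close> fv by (auto simp: less_eq_prod_def)
      qed
    qed
    have chC1: "u \<le> v \<or> v \<le> u" if "u \<in> C1" "v \<in> C1" for u v
      using chC that unfolding C1_def Complete_Partial_Order.chain_def by blast
    have chD: "u \<le> v \<or> v \<le> u" if "u \<in> D" "v \<in> D" for u v
      using D(3) that unfolding Complete_Partial_Order.chain_def by blast
    have "Complete_Partial_Order.chain (\<le>) (C1 \<union> D)"
      unfolding Complete_Partial_Order.chain_def using cmp chC1 chD by blast
    moreover have "C1 \<union> D \<subseteq> {P..Q} \<times> {a0..b0}"
    proof -
      have "{p..q} \<times> {a..b} \<subseteq> {P..Q} \<times> {a0..b0}" using sub ab0 by auto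
      then show ?thesis using CR D(1) by (auto simp: C1_def)
    qed
    moreover have "C1 \<inter> D = {}" using D(1) by (auto simp: C1_def C2_def)
    then have "(\<Sum>v\<in>C1 \<union> D. x v) = (\<Sum>v\<in>C1. x v) + (\<Sum>v\<in>D. x v)"
      using fin D by (intro sum.union_disjoint) auto
    then have "(\<Sum>v\<in>C. y v) \<le> (\<Sum>v\<in>C1 \<union> D. x v)"
      using splitC[of y] C1le D(4) by linarith
    ultimately show ?thesis using fin D by (intro exI[of _ "C1 \<union> D"]) auto
  qed
  then show "(\<Sum>v\<in>C. y v) \<le> t"
    using bnd unfolding chain_bnd_def by (meson order_trans)
qed

text \<open>For nonnegative entries only maximal chains matter, and in two adjacent columns these
  climb column \<open>p\<close> and cross over in some row \<open>k\<close>. The condition on the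
  sign of \<open>t\<close> accounts for the empty block.\<close>

lemma chain_bnd_two_columns:
  assumes nonneg: "\<And>v. 0 \<le> x v"
  shows "chain_bnd x ({p..p+1} \<times> {a..b}) t \<longleftrightarrow>
    0 \<le> t \<and> (\<forall>k\<in>{a..b}. (\<Sum>j\<in>{a..k}. x (p, j)) + (\<Sum>j\<in>{k..b}. x (p + 1, j)) \<le> t)"
    (is "?L \<longleftrightarrow> ?R")
proof -
  define S where "S k = {p} \<times> {a..k} \<union> {p+1} \<times> {k..b}" for k
  have sumS: "(\<Sum>v\<in>S k. x v) = (\<Sum>j\<in>{a..k}. x (p, j)) + (\<Sum>j\<in>{k..b}. x (p + 1, j))" for k
  proof -
    have "(\<Sum>v\<in>S k. x v) = (\<Sum>v\<in>{p} \<times> {a..k}. x v) + (\<Sum>v\<in>{p+1} \<times> {k..b}. x v)"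
      unfolding S_def by (intro sum.union_disjoint) auto
    moreover have "(\<Sum>v\<in>{q} \<times> J. x v) = (\<Sum>j\<in>J. x (q, j))" for q :: int and J :: "int set"
      by (rule sum.reindex_bij_witness[of _ "\<lambda>j. (q, j)" snd]) auto
    ultimately show ?thesis by simp
  qed
  show ?thesis
  proof
    assume L: ?L
    have "0 \<le> t" using L[unfolded chain_bnd_def, rule_format, of "{}"]
      by (simp add: Complete_Partial_Order.chain_def)
    moreover have "(\<Sum>v\<in>S k. x v) \<le> t" if "k \<in> {a..b}" for k
    proof -
      have "S k \<subseteq> {p..p+1} \<times> {a..b}" "finite (S k)" using that by (auto simp: S_def)
      moreover have "Complete_Partial_Order.chain (\<le>) (S k)"
        unfolding Complete_Partial_Order.chain_def S_def by (auto simp: less_eq_prod_def)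
      ultimately show ?thesis using L unfolding chain_bnd_def by blast
    qed
    ultimately show ?R using sumS by auto
  next
    assume R: ?R
    show ?L unfolding chain_bnd_def
    proof (intro allI impI)
      fix C assume C: "C \<subseteq> {p..p+1} \<times> {a..b} \<and> finite C \<and> Complete_Partial_Order.chain (\<le>) C"
      show "(\<Sum>v\<in>C. x v) \<le> t"
      proof (cases "C = {}")
        case True
        then show ?thesis using R by simp
      next
        case False
        define D where "D = {j. (p, j) \<in> C}"
        have finD: "finite D"
          by (rule finite_subset[of _ "snd ` C"]) (use C in \<open>force simp: D_def\<close>)+
        define k where "k = (if D = {} then a else Max D)"
        have kD: "j \<le> k" if "j \<in> D" for j using that finD by (auto simp: k_def)
        have kin: "k \<in> {a..b}"
        proof (cases "D = {}")
          case True then show ?thesis using False C by (auto simp: k_def)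
        next
          case False
          then have "k \<in> D" using finD by (simp add: k_def)
          then show ?thesis using C by (auto simp: D_def)
        qed
        have up: "k \<le> j" if "(p + 1, j) \<in> C" for j
        proof (cases "D = {}")
          case True then show ?thesis using that C by (auto simp: k_def)
        next
          case False
          then have "k \<in> D" using finD by (simp add: k_def)
          then have "(p, k) \<le> (p + 1, j) \<or> (p + 1, j) \<le> (p, k)"
            using that C unfolding D_def Complete_Partial_Order.chain_def by blast
          then show ?thesis by (simp add: less_eq_prod_def)
        qed
        have "C \<subseteq> S k"
        proof
          fix v assume "v \<in> C"
          obtain i j where v: "v = (i, j)" by fastforce
          have "i = p \<or> i = p + 1" "j \<in> {a..b}" using \<open>v \<in> C\<close> C v by auto
          then show "v \<in> S k" using \<open>v \<in> C\<close> v kD[of j] up[of j] by (auto simp: S_def D_def)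
        qed
        then have "(\<Sum>v\<in>C. x v) \<le> (\<Sum>v\<in>S k. x v)"
          using nonneg by (intro sum_mono2) (auto simp: S_def)
        also have "\<dots> \<le> t" using R kin sumS by auto
        finally show ?thesis .
      qed
    qed
  qed
qed

subsection \<open>Crystal operators\<close>

text \<open>The argument ranges over all integers: a maximum attained arbitrarily far to the right
  has no last position, which encodes that the operator is undefined there.\<close>

definition last_max :: "(int \<Rightarrow> int) \<Rightarrow> int \<Rightarrow> bool" where
  "last_max f k \<longleftrightarrow> (\<forall>k'<k. f k' \<le> f k) \<and> (\<forall>k'>k. f k' < f k)"

definition first_max :: "(int \<Rightarrow> int) \<Rightarrow> int \<Rightarrow> bool" where
  "first_max f k \<longleftrightarrow> (\<forall>k'<k. f k' < f k) \<and> (\<forall>k'>k. f k' \<le> f k)"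

lemma last_max_unique: "last_max f k \<Longrightarrow> last_max f l \<Longrightarrow> k = l"
  unfolding last_max_def by (metis linorder_neqE not_le)

lemma first_max_unique: "first_max f k \<Longrightarrow> first_max f l \<Longrightarrow> k = l"
  unfolding first_max_def by (metis linorder_neqE not_le)

lemma last_max_ge: "last_max f k \<Longrightarrow> f l \<le> f k"
  unfolding last_max_def by (metis linorder_neqE order.refl less_imp_le)

definition col_move :: "int \<Rightarrow> int \<Rightarrow> (box \<Rightarrow> int) \<Rightarrow> box \<Rightarrow> int" where
  "col_move p k x = (\<lambda>v. x v + of_bool (v = (p, k)) - of_bool (v = (p + 1, k)))"

definition row_move :: "int \<Rightarrow> int \<Rightarrow> (box \<Rightarrow> int) \<Rightarrow> box \<Rightarrow> int" where
  "row_move q l x = (\<lambda>v. x v + of_bool (v = (l, q)) - of_bool (v = (l, q + 1)))"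

lemma transp_row_move: "transp (row_move q l x) = col_move q l (transp x)"
  by (auto simp: transp_def row_move_def col_move_def fun_eq_iff)

lemma transp_col_move: "transp (col_move q l x) = row_move q l (transp x)"
  by (auto simp: transp_def row_move_def col_move_def fun_eq_iff)

lemma sum_atLeastAtMost_add1:
  fixes f :: "int \<Rightarrow> int"
  shows "(\<Sum>j\<in>{a..k+1}. f j) = (\<Sum>j\<in>{a..k}. f j) + (if a \<le> k + 1 then f (k + 1) else 0)"
proof (cases "a \<le> k + 1")
  case True
  then have "{a..k+1} = insert (k+1) {a..k}" by auto
  then show ?thesis using True by simp
qed auto

lemma sum_atLeastAtMost_lower:
  fixes f :: "int \<Rightarrow> int"
  shows "(\<Sum>j\<in>{k..b}. f j) = (\<Sum>j\<in>{k+1..b}. f j) + (if k \<le> b then f k else 0)"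
proof (cases "k \<le> b")
  case True
  then have "{k..b} = insert k {k+1..b}" by auto
  then show ?thesis using True by simp
qed auto

lemma sum_of_bool_eq_interval:
  fixes c :: int
  shows "(\<Sum>j\<in>{a..b}. of_bool (P \<and> j = c) :: int) = of_bool (P \<and> a \<le> c \<and> c \<le> b)"
proof -
  have "(\<Sum>j\<in>{a..b}. of_bool (P \<and> j = c) :: int) = (\<Sum>j\<in>{a..b}. if j = c then of_bool P else 0)"
    by (intro sum.cong) auto
  then show ?thesis by (subst (asm) sum.delta) auto
qed

text \<open>The locale is interpreted in itself with its two intervals exchanged; through
  \<open>transp\<close>, each result about columns becomes a result about rows with prefix
  \<open>T\<close>.\<close>

locale window =
  fixes i1 i2 j1 j2 :: int
begin

sublocale T: window j1 j2 i1 i2 .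

text \<open>Extension by zero keeps the recurrence \<open>asc_Suc\<close> valid for all
  \<open>p\<close> and \<open>k\<close>, also across the border of the window.\<close>

definition X :: "(box \<Rightarrow> int) set" where
  "X = {x. (\<forall>v. 0 \<le> x v) \<and> (\<forall>v. v \<notin> {i1..i2} \<times> {j1..j2} \<longrightarrow> x v = 0)}"

definition asc :: "int \<Rightarrow> (box \<Rightarrow> int) \<Rightarrow> int \<Rightarrow> int" where
  "asc p x k = (\<Sum>j\<in>{j1..k}. x (p, j)) + (\<Sum>j\<in>{k..j2}. x (p + 1, j))"

text \<open>A chain running up column \<open>p\<close> and switching to column \<open>p + 1\<close> in row \<open>k\<close> has maximal weight
  \<open>asc p x k\<close>. Moving a unit in the last row where this is maximal keeps the maximum unchanged.\<close>

definition cstep :: "int \<Rightarrow> (box \<Rightarrow> int) \<Rightarrow> (box \<Rightarrow> int) \<Rightarrow> bool" where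
  "cstep p x y \<longleftrightarrow> x \<in> X \<and> i1 \<le> p \<and> p < i2 \<and> (\<exists>k. last_max (asc p x) k \<and> y = col_move p k x)"

definition rot :: "(box \<Rightarrow> int) \<Rightarrow> box \<Rightarrow> int" where
  "rot x = (\<lambda>(i, j). x (i1 + i2 - i, j1 + j2 - j))"

end

context window begin

definition rstep :: "int \<Rightarrow> (box \<Rightarrow> int) \<Rightarrow> (box \<Rightarrow> int) \<Rightarrow> bool" where
  "rstep q x y \<longleftrightarrow> T.cstep q (transp x) (transp y)"

lemma X_nonneg: "x \<in> X \<Longrightarrow> 0 \<le> x v"
  unfolding X_def by blast

lemma X_outside: "x \<in> X \<Longrightarrow> \<not> (i1 \<le> i \<and> i \<le> i2 \<and> j1 \<le> j \<and> j \<le> j2) \<Longrightarrow> x (i, j) = 0"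
  by (simp_all add: X_def)

lemma transp_in_X: "transp x \<in> T.X \<longleftrightarrow> x \<in> X"
  by (auto simp: X_def T.X_def transp_def)

lemma asc_Suc: "x \<in> X \<Longrightarrow> asc p x (k + 1) = asc p x k + x (p, k + 1) - x (p + 1, k)"
  using X_outside[of x p "k+1"] X_outside[of x "p+1" k]
  by (auto simp: asc_def sum_atLeastAtMost_add1 sum_atLeastAtMost_lower[of _ k])

lemma asc_col_move:
  assumes "j1 \<le> k" "k \<le> j2"
  shows "asc p (col_move p k x) k' = asc p x k' + of_bool (k \<le> k') - of_bool (k' \<le> k)"
  using assms sum_of_bool_eq_interval[of True]
  by (simp add: asc_def col_move_def sum.distrib sum_subtractf)

text \<open>A unit moved between rows \<open>q\<close> and \<open>q + 1\<close> of one column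
  changes a partial sum over that column only if the cut separates these two rows.\<close>

lemma asc_row_move:
  assumes "j1 \<le> q" "q < j2"
  shows "asc p (row_move q l x) k =
    asc p x k + of_bool (l = p \<and> k = q) - of_bool (l = p + 1 \<and> k = q + 1)"
proof -
  have "asc p (row_move q l x) k = asc p x k
     + (\<Sum>j\<in>{j1..k}. of_bool (l = p \<and> j = q)) - (\<Sum>j\<in>{j1..k}. of_bool (l = p \<and> j = q + 1))
     + (\<Sum>j\<in>{k..j2}. of_bool (l = p + 1 \<and> j = q)) - (\<Sum>j\<in>{k..j2}. of_bool (l = p + 1 \<and> j = q + 1))"
    by (simp add: asc_def row_move_def sum.distrib sum_subtractf eq_commute)
  then show ?thesis using assms unfolding sum_of_bool_eq_interval by auto
qed

text \<open>The strict drop of \<open>asc\<close> after \<open>k\<close> forces a positive entry at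
  \<open>(p + 1, k)\<close>, so the box that loses a unit lies in the window and can afford
  it.\<close>

lemma last_max_asc:
  assumes "x \<in> X" "last_max (asc p x) k"
  shows "j1 \<le> k" "k \<le> j2" "i1 \<le> p + 1" "p + 1 \<le> i2" "0 < x (p + 1, k)"
proof -
  have "asc p x (k + 1) < asc p x k" using assms(2) by (simp add: last_max_def)
  then show pos: "0 < x (p + 1, k)"
    using asc_Suc[OF assms(1), of p k] X_nonneg[OF assms(1), of "(p, k + 1)"] by linarith
  then show "j1 \<le> k" "k \<le> j2" "i1 \<le> p + 1" "p + 1 \<le> i2"
    using X_outside[OF assms(1), of "p + 1" k] by (metis less_irrefl)+
qed

lemma cstepE:
  assumes "cstep p x y"
  obtains k where "x \<in> X" "i1 \<le> p" "p < i2" "last_max (asc p x) k" "y = col_move p k x"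
    "j1 \<le> k" "k \<le> j2" "0 < x (p + 1, k)"
  using assms last_max_asc unfolding cstep_def by blast

lemma cstep_in_X: "cstep p x y \<Longrightarrow> x \<in> X" "cstep p x y \<Longrightarrow> y \<in> X"
proof -
  assume "cstep p x y"
  then show "y \<in> X"
  proof (rule cstepE)
    fix k assume k: "x \<in> X" "i1 \<le> p" "p < i2" "y = col_move p k x"
      "j1 \<le> k" "k \<le> j2" "0 < x (p + 1, k)"
    have "0 \<le> y v" for v
      using X_nonneg[OF k(1), of v] k by (auto simp: col_move_def)
    moreover have "y v = 0" if "v \<notin> {i1..i2} \<times> {j1..j2}" for v
      using that k X_outside[OF k(1), of "fst v" "snd v"] by (auto simp: col_move_def mem_Times_iff)
    ultimately show ?thesis by (auto simp: X_def)
  qed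
qed (simp add: cstep_def)

lemma cstep_det: "cstep p x y \<Longrightarrow> cstep p x y' \<Longrightarrow> y = y'"
  unfolding cstep_def using last_max_unique by blast

text \<open>Values after \<open>k\<close> were strictly smaller and gain one, values before
  \<open>k\<close> lose one. So \<open>k\<close> can be read off from the result as its first
  maximum, which makes steps injective.\<close>

lemma first_max_col_move:
  assumes "x \<in> X" "last_max (asc p x) k"
  shows "first_max (asc p (col_move p k x)) k"
  using assms last_max_asc[OF assms] unfolding first_max_def last_max_def
  by (auto simp: asc_col_move)

lemma col_move_inj: "col_move p k x = col_move p k y \<Longrightarrow> x = y"
  by (auto simp: col_move_def fun_eq_iff)

lemma cstep_inj:
  assumes "cstep p x y" "cstep p x' y"
  shows "x = x'"
proof -
  obtain k where k: "x \<in> X" "last_max (asc p x) k" "y = col_move p k x" using assms(1) by (rule cstepE)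
  obtain k' where k': "x' \<in> X" "last_max (asc p x') k'" "y = col_move p k' x'" using assms(2) by (rule cstepE)
  have "k = k'"
    using first_max_col_move[OF k(1,2)] first_max_col_move[OF k'(1,2)] k(3) k'(3) first_max_unique
    by metis
  then show ?thesis using k(3) k'(3) col_move_inj by metis
qed

text \<open>The right tail is the weight of column \<open>p\<close>: for \<open>p\<close> in range a
  step exists exactly when \<open>asc\<close> exceeds it somewhere. The left tail, the weight of
  column \<open>p + 1\<close>, shows that this happens whenever column \<open>p + 1\<close> is the
  heavier one.\<close>

lemma asc_const:
  assumes "x \<in> X"
  shows "k < j1 \<Longrightarrow> asc p x k = (\<Sum>j\<in>{j1..j2}. x (p + 1, j))"
    and "j2 < k \<Longrightarrow> asc p x k = (\<Sum>j\<in>{j1..j2}. x (p, j))"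
proof -
  assume "k < j1"
  then show "asc p x k = (\<Sum>j\<in>{j1..j2}. x (p + 1, j))"
    using X_outside[OF assms] unfolding asc_def by (auto intro!: sum.mono_neutral_right)
next
  assume "j2 < k"
  then show "asc p x k = (\<Sum>j\<in>{j1..j2}. x (p, j))"
    using X_outside[OF assms] unfolding asc_def by (auto intro!: sum.mono_neutral_right)
qed

lemma cstep_exists:
  assumes x: "x \<in> X" and p: "i1 \<le> p" "p < i2" and k: "(\<Sum>j\<in>{j1..j2}. x (p, j)) < asc p x k"
  shows "\<exists>y. cstep p x y"
proof -
  define f where "f = asc p x"
  \<comment> \<open>\<open>K\<close> contains \<open>k\<close>, and outside \<open>K\<close> the
    function is in one of its constant tails. The row \<open>j1 - 1\<close> belongs to
    \<open>K\<close> as representative of the left tail; the right tail lies below the value at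
    \<open>k\<close> by assumption.\<close>
  define K where "K = {min k (j1 - 1)..max (max k (j2 + 1)) (j1 - 1)}"
  have fin: "finite K" "K \<noteq> {}" by (auto simp: K_def)
  define m where "m = Max (f ` K)"
  define k0 where "k0 = Max {l\<in>K. f l = m}"
  have "m \<in> f ` K" unfolding m_def using fin by (intro Max_in) auto
  then have "{l\<in>K. f l = m} \<noteq> {}" by auto
  then have k0: "k0 \<in> K" "f k0 = m" and k0max: "\<And>l. l \<in> K \<Longrightarrow> f l = m \<Longrightarrow> l \<le> k0"
    using Max_in[of "{l\<in>K. f l = m}"] fin by (auto simp: k0_def)
  have le: "f l \<le> m" if "l \<in> K" for l using that fin by (simp add: m_def)
  have "f k \<le> m" by (rule le) (auto simp: K_def)
  have "last_max f k0" unfolding last_max_def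
  proof (intro conjI allI impI)
    fix l assume "l < k0"
    show "f l \<le> f k0"
    proof (cases "l \<in> K")
      case True then show ?thesis using le k0 by simp
    next
      case False
      then have "l < j1" using \<open>l < k0\<close> k0 by (auto simp: K_def)
      then have "f l = f (j1 - 1)" using asc_const(1)[OF x] by (simp add: f_def)
      moreover have "f (j1 - 1) \<le> m" by (rule le) (auto simp: K_def)
      ultimately show ?thesis using k0 by simp
    qed
  next
    fix l assume "l > k0"
    show "f l < f k0"
    proof (cases "l \<in> K")
      case True then show ?thesis using le[of l] k0max[of l] k0 \<open>l > k0\<close> by fastforce
    next
      case False
      then have "j2 < l" using \<open>l > k0\<close> k0 by (auto simp: K_def)
      then have "f l = (\<Sum>j\<in>{j1..j2}. x (p, j))" using asc_const(2)[OF x] by (simp add: f_def)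
      then show ?thesis using k \<open>f k \<le> m\<close> k0 by (simp add: f_def)
    qed
  qed
  then show ?thesis using x p unfolding cstep_def f_def by blast
qed

end

section \<open>Commutation of column steps and row steps\<close>

context window begin

text \<open>The increments of the column and row functionals at the crossing of columns \<open>p\<close>, \<open>p + 1\<close>
  with rows \<open>q\<close>, \<open>q + 1\<close> are opposite; this is what makes the two kinds of steps commute.\<close>

lemma asc_cross:
  assumes "x \<in> X"
  shows "asc p x (q + 1) - asc p x q = - (T.asc q (transp x) (p + 1) - T.asc q (transp x) p)"
  using asc_Suc[OF assms, of p q] T.asc_Suc[of "transp x" q p] assms by (simp add: transp_in_X)

lemma T_asc_col_move:
  assumes "i1 \<le> p" "p < i2"
  shows "T.asc q (transp (col_move p k x)) l =
    T.asc q (transp x) l + of_bool (k = q \<and> l = p) - of_bool (k = q + 1 \<and> l = p + 1)"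
  using T.asc_row_move[OF assms] by (simp add: transp_col_move)

text \<open>The column move touches the row functional \<open>f\<close> only if \<open>k\<close> is
  \<open>q\<close> or \<open>q + 1\<close>. For \<open>k = q\<close> it raises \<open>f p\<close>,
  but \<open>asc_cross\<close> gives \<open>f p < f (p + 1)\<close>, so the last maximum stays. For
  \<open>k = q + 1\<close> it lowers \<open>f (p + 1)\<close>, which is at most \<open>f p\<close>;
  if the last maximum was there, the two values were equal and it retreats to
  \<open>p\<close>.\<close>

lemma last_max_after_cstep:
  assumes x: "x \<in> X" and p: "i1 \<le> p" "p < i2"
    and k: "last_max (asc p x) k" and l: "last_max (T.asc q (transp x)) l"
  shows "last_max (T.asc q (transp (col_move p k x))) (if k = q + 1 \<and> l = p + 1 then p else l)"
proof -
  define f where "f = T.asc q (transp x)"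
  define g where "g = T.asc q (transp (col_move p k x))"
  have g: "g m = f m + of_bool (k = q \<and> m = p) - of_bool (k = q + 1 \<and> m = p + 1)" for m
    unfolding f_def g_def by (rule T_asc_col_move[OF p])
  have cross: "asc p x (q + 1) - asc p x q = f p - f (p + 1)"
    using asc_cross[OF x, of p q] by (simp add: f_def)
  have lf: "\<And>m. m < l \<Longrightarrow> f m \<le> f l" "\<And>m. m > l \<Longrightarrow> f m < f l"
    using l by (auto simp: last_max_def f_def)
  have "last_max g (if k = q + 1 \<and> l = p + 1 then p else l)"
  proof (cases "k = q")
    case True
    then have "asc p x (q + 1) < asc p x q" using k by (auto simp: last_max_def)
    then have "f p < f (p + 1)" using cross by linarith
    have gm: "g m = f m + of_bool (m = p)" for m using True by (simp add: g)
    have "f (p + 1) \<le> f l" using last_max_ge[OF l] by (simp add: f_def)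
    then have gl: "g l = f l" using \<open>f p < f (p + 1)\<close> gm by auto
    have "last_max g l"
      unfolding last_max_def gl
    proof (intro conjI allI impI)
      fix m assume "m < l"
      then show "g m \<le> f l"
        using gm[of m] lf(1)[of m] \<open>f p < f (p + 1)\<close> \<open>f (p + 1) \<le> f l\<close> by (cases "m = p") auto
    next
      fix m assume "m > l"
      then show "g m < f l"
        using gm[of m] lf(2)[of m] \<open>f p < f (p + 1)\<close> lf(2)[of "p + 1"] by (cases "m = p") auto
    qed
    then show ?thesis using True by simp
  next
    case F: False
    show ?thesis
    proof (cases "k = q + 1")
      case True
      then have "asc p x q \<le> asc p x (q + 1)" using k by (auto simp: last_max_def)
      then have "f (p + 1) \<le> f p" using cross by linarith
      have gm: "g m = f m - of_bool (m = p + 1)" for m using True by (simp add: g)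
      show ?thesis
      proof (cases "l = p + 1")
        case l: True
        have "f p = f l" using \<open>f (p + 1) \<le> f p\<close> lf(1)[of p] l by simp
        have "last_max g p" unfolding last_max_def
        proof (intro conjI allI impI)
          fix m assume "m < p"
          then show "g m \<le> g p" using gm lf(1)[of m] l \<open>f p = f l\<close> by simp
        next
          fix m assume "m > p"
          then show "g m < g p" using gm lf(2)[of m] l \<open>f p = f l\<close> by (cases "m = p + 1") auto
        qed
        then show ?thesis using True l by simp
      next
        case False
        then have gl: "g l = f l" by (simp add: gm)
        have "g m \<le> f m" for m by (simp add: gm)
        then have "last_max g l" unfolding last_max_def gl using lf by (meson le_less_trans order_trans)
        then show ?thesis using False by simp
      qed
    next
      case False
      then show ?thesis using F lf by (simp add: last_max_def g)
    qed
  qed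
  then show ?thesis by (simp add: g_def)
qed

end

context window begin

lemma last_max_after_rstep:
  assumes x: "x \<in> X" and q: "j1 \<le> q" "q < j2"
    and k: "last_max (asc p x) k" and l: "last_max (T.asc q (transp x)) l"
  shows "last_max (asc p (row_move q l x)) (if l = p + 1 \<and> k = q + 1 then q else k)"
  using T.last_max_after_cstep[of "transp x" q l p k] assms
  by (simp add: transp_in_X transp_col_move)

lemma rstepE:
  assumes "rstep q x y"
  obtains l where "x \<in> X" "j1 \<le> q" "q < j2" "last_max (T.asc q (transp x)) l" "y = row_move q l x"
    "i1 \<le> l" "l \<le> i2"
proof -
  obtain l where l: "transp x \<in> T.X" "j1 \<le> q" "q < j2" "last_max (T.asc q (transp x)) l"
    "transp y = col_move q l (transp x)" "i1 \<le> l" "l \<le> i2"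
    using assms unfolding rstep_def by (rule T.cstepE)
  moreover have "y = row_move q l x"
    using arg_cong[OF l(5), of transp] by (simp add: transp_col_move)
  ultimately show ?thesis using that by (auto simp: transp_in_X)
qed

lemma rstepI:
  assumes "x \<in> X" "j1 \<le> q" "q < j2" "last_max (T.asc q (transp x)) l"
  shows "rstep q x (row_move q l x)"
  using assms unfolding rstep_def T.cstep_def by (auto simp: transp_in_X transp_row_move)

lemma cstepI:
  assumes "x \<in> X" "i1 \<le> p" "p < i2" "last_max (asc p x) k"
  shows "cstep p x (col_move p k x)"
  using assms unfolding cstep_def by auto

lemma rstep_in_X: "rstep q x y \<Longrightarrow> x \<in> X" "rstep q x y \<Longrightarrow> y \<in> X"
  using T.cstep_in_X[of q "transp x" "transp y"] by (auto simp: rstep_def transp_in_X)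

text \<open>In the exceptional case both steps take their unit from \<open>(p + 1, q + 1)\<close>;
  each then shifts the other, and either order carries that unit to \<open>(p, q)\<close>.\<close>

lemma step_diamond:
  assumes "cstep p x y" "rstep q x z"
  shows "\<exists>w. rstep q y w \<and> cstep p z w"
proof -
  obtain k where k: "x \<in> X" "i1 \<le> p" "p < i2" "last_max (asc p x) k" "y = col_move p k x"
    using assms(1) by (rule cstepE)
  obtain l where l: "j1 \<le> q" "q < j2" "last_max (T.asc q (transp x)) l" "z = row_move q l x"
    using assms(2) by (rule rstepE)
  define k' where "k' = (if l = p + 1 \<and> k = q + 1 then q else k)"
  define l' where "l' = (if k = q + 1 \<and> l = p + 1 then p else l)"
  have "rstep q y (row_move q l' y)"
    using last_max_after_cstep[OF k(1-4) l(3)] l cstep_in_X[OF assms(1)] k(5)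
    by (intro rstepI) (auto simp: l'_def)
  moreover have "cstep p z (col_move p k' z)"
    using last_max_after_rstep[OF k(1) l(1,2) k(4) l(3)] k rstep_in_X[OF assms(2)] l(4)
    by (intro cstepI) (auto simp: k'_def)
  moreover have "row_move q l' y = col_move p k' z"
    unfolding k(5) l(4) k'_def l'_def by (auto simp: row_move_def col_move_def fun_eq_iff)
  ultimately show ?thesis by auto
qed

lemma sum_row_col_move:
  assumes "i1 \<le> p" "p < i2"
  shows "(\<Sum>i\<in>{i1..i2}. col_move p k x (i, q)) = (\<Sum>i\<in>{i1..i2}. x (i, q))"
proof -
  have "col_move p k x (i, q) = x (i, q) + of_bool (q = k \<and> i = p) - of_bool (q = k \<and> i = p + 1)" for i
    by (auto simp: col_move_def)
  then show ?thesis
    using assms unfolding sum.distrib sum_subtractf sum_of_bool_eq_interval by (simp add: sum.distrib sum_subtractf sum_of_bool_eq_interval)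
qed

text \<open>The row step must already be possible at \<open>x\<close>: the column step keeps the
  weight of row \<open>q\<close>, which is the threshold for existence, and does not raise the
  maximum of the row functional. \<open>step_diamond\<close> and determinism then close the
  square.\<close>

lemma step_mixed:
  assumes "cstep p x y" "rstep q y w"
  shows "\<exists>z. rstep q x z \<and> cstep p z w"
proof -
  obtain k where k: "x \<in> X" "i1 \<le> p" "p < i2" "last_max (asc p x) k" "y = col_move p k x"
    using assms(1) by (rule cstepE)
  obtain l where l: "y \<in> X" "j1 \<le> q" "q < j2" "last_max (T.asc q (transp y)) l" "w = row_move q l y"
    using assms(2) by (rule rstepE)
  define f where "f = T.asc q (transp x)"
  have g: "T.asc q (transp y) m = f m + of_bool (k = q \<and> m = p) - of_bool (k = q + 1 \<and> m = p + 1)" for m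
    unfolding f_def k(5) by (rule T_asc_col_move[OF k(2,3)])
  have cross: "asc p x (q + 1) - asc p x q = f p - f (p + 1)"
    using asc_cross[OF k(1), of p q] by (simp add: f_def)
  have "(\<Sum>i\<in>{i1..i2}. y (i, q)) < T.asc q (transp y) l"
  proof -
    have "T.asc q (transp y) (max l i2 + 1) < T.asc q (transp y) l"
      using l(4) unfolding last_max_def by (simp add: less_max_iff_disj)
    then show ?thesis
      using T.asc_const(2)[of "transp y" "max l i2 + 1" q] l(1) by (simp add: transp_in_X)
  qed
  then have lt: "(\<Sum>i\<in>{i1..i2}. x (i, q)) < T.asc q (transp y) l"
    using sum_row_col_move[OF k(2,3), of k x q] unfolding k(5) by simp
  \<comment> \<open>Only at \<open>p\<close>, and only for \<open>k = q\<close>, does the column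
    move raise the row functional; there the old value at \<open>p + 1\<close> was already larger by
    \<open>cross\<close>.\<close>
  have "\<exists>m. T.asc q (transp y) l \<le> f m"
  proof (cases "k = q \<and> l = p")
    case True
    then have "asc p x (q + 1) < asc p x q" using k(4) by (auto simp: last_max_def)
    then show ?thesis using cross True by (intro exI[of _ "p + 1"]) (simp add: g)
  next
    case False
    then show ?thesis by (intro exI[of _ l]) (auto simp: g)
  qed
  then obtain m where "(\<Sum>i\<in>{i1..i2}. x (i, q)) < f m" using lt less_le_trans by blast
  then obtain z' where z': "T.cstep q (transp x) z'"
    using T.cstep_exists[of "transp x" q m] k l by (auto simp: transp_in_X f_def)
  then have z: "rstep q x (transp z')" by (simp add: rstep_def)
  obtain w' where w': "rstep q y w'" "cstep p (transp z') w'"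
    using step_diamond[OF assms(1) z] by blast
  have "transp w' = transp w" using w' assms(2) T.cstep_det unfolding rstep_def by blast
  then have "w' = w" by (metis transp_transp)
  then show ?thesis using z w' by blast
qed

lemma rot_rot [simp]: "rot (rot x) = x"
  by (auto simp: rot_def)

lemma rot_in_X: "rot x \<in> X \<longleftrightarrow> x \<in> X"
proof -
  have "rot y \<in> X" if "y \<in> X" for y
    using that X_outside[OF that] X_nonneg[OF that] by (auto simp: X_def rot_def)
  then show ?thesis using rot_rot by metis
qed

lemma T_rot_transp: "T.rot (transp x) = transp (rot x)"
  by (auto simp: rot_def T.rot_def)

lemma asc_rot: "asc (i1 + i2 - 1 - p) (rot x) k = asc p x (j1 + j2 - k)"
proof -
  have "(\<Sum>j\<in>{a..b}. x (c, j1 + j2 - j)) = (\<Sum>j\<in>{j1+j2-b..j1+j2-a}. x (c, j))" for a b c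
    by (rule sum.reindex_bij_witness[of _ "\<lambda>j. j1 + j2 - j" "\<lambda>j. j1 + j2 - j"]) auto
  then show ?thesis by (simp add: asc_def rot_def add.commute)
qed

text \<open>Rotation exchanges first and last maxima and therefore turns a step into a reversed
  step, between the mirrored pair of columns.\<close>

lemma cstep_rot:
  assumes "cstep p x y"
  shows "cstep (i1 + i2 - 1 - p) (rot y) (rot x)"
proof -
  obtain k where k: "x \<in> X" "i1 \<le> p" "p < i2" "last_max (asc p x) k" "y = col_move p k x"
    using assms by (rule cstepE)
  have fm: "first_max (asc p y) k" using first_max_col_move k by simp
  have "last_max (asc (i1 + i2 - 1 - p) (rot y)) (j1 + j2 - k)"
    using fm unfolding last_max_def first_max_def asc_rot by auto
  moreover have "rot x = col_move (i1 + i2 - 1 - p) (j1 + j2 - k) (rot y)"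
    unfolding k(5) by (auto simp: rot_def col_move_def fun_eq_iff)
  ultimately show ?thesis
    using k cstep_in_X[OF assms] unfolding cstep_def by (auto simp: rot_in_X)
qed

end

context window begin

lemma rstep_rot:
  assumes "rstep q x y"
  shows "rstep (j1 + j2 - 1 - q) (rot y) (rot x)"
  using T.cstep_rot[of q "transp x" "transp y"] assms by (simp add: rstep_def T_rot_transp)

text \<open>The rotated steps have a common source, so \<open>step_diamond\<close> applies to them;
  rotating back completes the square.\<close>

lemma step_codiamond:
  assumes "rstep q a d" "cstep p b d"
  shows "\<exists>x. rstep q x b \<and> cstep p x a"
proof -
  obtain w where "rstep (j1 + j2 - 1 - q) (rot b) w" "cstep (i1 + i2 - 1 - p) (rot a) w"
    using step_diamond[OF cstep_rot[OF assms(2)] rstep_rot[OF assms(1)]] by blast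
  then have "rstep q (rot w) b" "cstep p (rot w) a"
    using rstep_rot[of "j1 + j2 - 1 - q" "rot b" w] cstep_rot[of "i1 + i2 - 1 - p" "rot a" w] by auto
  then show ?thesis by blast
qed

end

subsection \<open>Highest elements\<close>

text \<open>The word of labels is recorded because the same word has to be replayed from other
  elements.\<close>

primrec path :: "('l \<Rightarrow> 'a \<Rightarrow> 'a \<Rightarrow> bool) \<Rightarrow> 'l list \<Rightarrow> 'a \<Rightarrow> 'a \<Rightarrow> bool" where
  "path S [] x y \<longleftrightarrow> x = y"
| "path S (l # ls) x y \<longleftrightarrow> (\<exists>z. S l x z \<and> path S ls z y)"

lemma path_append: "path S (ks @ ls) x y \<longleftrightarrow> (\<exists>z. path S ks x z \<and> path S ls z y)"
  by (induction ks arbitrary: x) auto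

lemma path_inj:
  assumes "\<And>l x x' y. S l x y \<Longrightarrow> S l x' y \<Longrightarrow> x = x'"
  shows "path S ls x y \<Longrightarrow> path S ls x' y \<Longrightarrow> x = x'"
proof (induction ls arbitrary: x x')
  case (Cons l ls)
  then show ?case using assms by (metis path.simps(2))
qed simp

text \<open>The grid spanned by the two words is tiled by unit squares, one strip at a time
  (\<open>one\<close>). \<open>path_mixed\<close> and \<open>path_codiamond\<close> fill the same
  grid starting from other corners.\<close>

lemma path_diamond:
  assumes sq: "\<And>k l x y z. S k x y \<Longrightarrow> R l x z \<Longrightarrow> \<exists>w. R l y w \<and> S k z w"
  assumes "path S ks x y" "path R ls x z"
  shows "\<exists>w. path R ls y w \<and> path S ks z w"
proof -
  have one: "\<exists>w. path R ls y w \<and> S k z w" if "S k x y" "path R ls x z" for k x y z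
    using that
  proof (induction ls arbitrary: x y)
    case (Cons l ls)
    then obtain x' where "R l x x'" "path R ls x' z" by auto
    then show ?case using sq[OF Cons.prems(1)] Cons.IH by (metis path.simps(2))
  qed auto
  show ?thesis using assms(2,3)
  proof (induction ks arbitrary: x z)
    case (Cons k ks)
    then obtain x' where "S k x x'" "path S ks x' y" by auto
    then show ?case using one Cons.IH Cons.prems(2) by (metis path.simps(2))
  qed auto
qed

lemma path_mixed:
  assumes sq: "\<And>k l x y w. S k x y \<Longrightarrow> R l y w \<Longrightarrow> \<exists>z. R l x z \<and> S k z w"
  assumes "path S ks x y" "path R ls y w"
  shows "\<exists>z. path R ls x z \<and> path S ks z w"
proof -
  have one: "\<exists>z. path R ls x z \<and> S k z w" if "S k x y" "path R ls y w" for k x y w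
    using that
  proof (induction ls arbitrary: x y)
    case (Cons l ls)
    then obtain y' where "R l y y'" "path R ls y' w" by auto
    then show ?case using sq[OF Cons.prems(1)] Cons.IH by (metis path.simps(2))
  qed auto
  show ?thesis using assms(2,3)
  proof (induction ks arbitrary: x)
    case (Cons k ks)
    then obtain x' where "S k x x'" "path S ks x' y" by auto
    then show ?case using one Cons.IH Cons.prems(2) by (metis path.simps(2))
  qed auto
qed

lemma path_codiamond:
  assumes sq: "\<And>k l a b d. R l a d \<Longrightarrow> S k b d \<Longrightarrow> \<exists>x. R l x b \<and> S k x a"
  assumes "path R ls a d" "path S ks b d"
  shows "\<exists>x. path R ls x b \<and> path S ks x a"
proof -
  have one: "\<exists>x. path R ls x b \<and> S k x a" if "path R ls a d" "S k b d" for k a b d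
    using that
  proof (induction ls arbitrary: a)
    case (Cons l ls)
    then obtain a' where "R l a a'" "path R ls a' d" by auto
    then show ?case using sq Cons.IH[of a'] Cons.prems(2) by (metis path.simps(2))
  qed auto
  show ?thesis using assms(2,3)
  proof (induction ks arbitrary: b)
    case (Cons k ks)
    then obtain b' where b': "S k b b'" "path S ks b' d" by auto
    then obtain x' where "path R ls x' b'" "path S ks x' a" using Cons.IH Cons.prems(1) by blast
    then show ?case using one[of x' b' k b] b' by (metis path.simps(2))
  qed auto
qed

section \<open>Invariance of chain weights, and the inequalities satisfied by highest
  elements\<close>

context window begin

text \<open>On a subinterval of rows the two functionals differ by a constant, so a last maximum of
  the large one lying in the subinterval is also one of the small one.\<close>

lemma asc_subinterval:
  assumes "j1 \<le> a" "b \<le> j2" "k \<in> {a..b}"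
  shows "asc p x k = window.asc a b p x k + ((\<Sum>j\<in>{j1..a-1}. x (p, j)) + (\<Sum>j\<in>{b+1..j2}. x (p + 1, j)))"
proof -
  have "{j1..k} = {j1..a-1} \<union> {a..k}" "{k..j2} = {k..b} \<union> {b+1..j2}" using assms by auto
  then have "(\<Sum>j\<in>{j1..k}. x (p, j)) = (\<Sum>j\<in>{j1..a-1}. x (p, j)) + (\<Sum>j\<in>{a..k}. x (p, j))"
    "(\<Sum>j\<in>{k..j2}. x (p + 1, j)) = (\<Sum>j\<in>{k..b}. x (p + 1, j)) + (\<Sum>j\<in>{b+1..j2}. x (p + 1, j))"
    by (simp_all add: sum.union_disjoint)
  then show ?thesis by (simp add: asc_def window.asc_def)
qed

text \<open>If row \<open>k\<close> is outside the interval the block does not change. Otherwise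
  \<open>k\<close> is a maximum both before and after the step, with the same value.\<close>

lemma cstep_chain_bnd_block:
  assumes st: "cstep p x y" and ab: "j1 \<le> a" "b \<le> j2"
  shows "chain_bnd x ({p..p+1} \<times> {a..b}) t \<longleftrightarrow> chain_bnd y ({p..p+1} \<times> {a..b}) t"
proof -
  obtain k where k: "x \<in> X" "i1 \<le> p" "p < i2" "last_max (asc p x) k" "y = col_move p k x"
    using st by (rule cstepE)
  show ?thesis
  proof (cases "k \<in> {a..b}")
    case False
    then show ?thesis by (intro chain_bnd_cong) (auto simp: k(5) col_move_def)
  next
    case True
    define g where "g = window.asc a b p"
    have gy: "g y l = g x l + of_bool (k \<le> l) - of_bool (l \<le> k)" for l
      unfolding g_def k(5) by (rule window.asc_col_move) (use True in auto)
    have gx: "g x l \<le> g x k" "k < l \<Longrightarrow> g x l < g x k" if "l \<in> {a..b}" for l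
      using asc_subinterval[OF ab that, of p x] asc_subinterval[OF ab True, of p x]
        last_max_ge[OF k(4), of l] k(4) by (auto simp: g_def last_max_def)
    have le: "g y l \<le> g x k" "g x l \<le> g y k" if "l \<in> {a..b}" for l
      using gx[OF that] gy[of l] gy[of k] by (cases l k rule: linorder_cases; simp)+
    have "chain_bnd z ({p..p+1} \<times> {a..b}) t \<longleftrightarrow> 0 \<le> t \<and> (\<forall>l\<in>{a..b}. g z l \<le> t)" if "z \<in> X" for z
      using chain_bnd_two_columns[of z p a b t] X_nonneg[OF that] by (simp add: g_def window.asc_def)
    then show ?thesis using cstep_in_X[OF st] le True by (meson order_trans)
  qed
qed

lemma cstep_chain_bnd:
  assumes st: "cstep p x y" and ab: "j1 \<le> a" "b \<le> j2"
  shows "chain_bnd x ({i1..i2} \<times> {a..b}) t \<longleftrightarrow> chain_bnd y ({i1..i2} \<times> {a..b}) t"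
proof -
  obtain k where k: "i1 \<le> p" "p < i2" "y = col_move p k x"
    using st by (rule cstepE)
  have eq: "y (i, j) = x (i, j)" if "i \<notin> {p..p+1}" for i j
    using that by (auto simp: k(3) col_move_def)
  have block: "chain_bnd x ({p..p+1} \<times> {a'..b'}) t \<longleftrightarrow> chain_bnd y ({p..p+1} \<times> {a'..b'}) t"
    if "a \<le> a'" "b' \<le> b" for a' b' t
    using cstep_chain_bnd_block[OF st] that ab by auto
  have "chain_bnd x ({i1..i2} \<times> {a..b}) t \<Longrightarrow> chain_bnd y ({i1..i2} \<times> {a..b}) t"
    by (rule chain_bnd_exchange[of i1 i2 a b p "p + 1" y x]) (use eq block k in auto)
  moreover have "chain_bnd y ({i1..i2} \<times> {a..b}) t \<Longrightarrow> chain_bnd x ({i1..i2} \<times> {a..b}) t"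
    by (rule chain_bnd_exchange[of i1 i2 a b p "p + 1" x y]) (use eq block k in auto)
  ultimately show ?thesis by blast
qed

definition cto :: "(box \<Rightarrow> int) \<Rightarrow> (box \<Rightarrow> int) \<Rightarrow> bool" where
  "cto x y \<longleftrightarrow> (\<exists>ps. path cstep ps x y)"

definition chigh :: "(box \<Rightarrow> int) \<Rightarrow> bool" where
  "chigh x \<longleftrightarrow> x \<in> X \<and> (\<forall>p y. \<not> cstep p x y)"

definition colsum :: "(box \<Rightarrow> int) \<Rightarrow> int \<Rightarrow> int" where
  "colsum x p = (\<Sum>j\<in>{j1..j2}. x (p, j))"

text \<open>Inside the window each entry is an alternating sum of four quadrant sums
  (\<open>quad_corner\<close>), so these determine the filling.\<close>

definition quad :: "(box \<Rightarrow> int) \<Rightarrow> int \<Rightarrow> int \<Rightarrow> int" where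
  "quad x k l = (\<Sum>p\<in>{k..i2}. \<Sum>j\<in>{l..j2}. x (p, j))"

end

context window begin

definition rto :: "(box \<Rightarrow> int) \<Rightarrow> (box \<Rightarrow> int) \<Rightarrow> bool" where
  "rto x y \<longleftrightarrow> T.cto (transp x) (transp y)"

definition rhigh :: "(box \<Rightarrow> int) \<Rightarrow> bool" where
  "rhigh x \<longleftrightarrow> T.chigh (transp x)"

definition rowsum :: "(box \<Rightarrow> int) \<Rightarrow> int \<Rightarrow> int" where
  "rowsum x = T.colsum (transp x)"

lemma path_transp: "path T.cstep ls (transp x) (transp y) \<longleftrightarrow> path rstep ls x y"
proof (induction ls arbitrary: x)
  case Nil
  then show ?case by simp (metis transp_transp)
next
  case (Cons l ls)
  have "(\<exists>z. T.cstep l (transp x) z \<and> path T.cstep ls z (transp y)) \<longleftrightarrow>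
    (\<exists>z. T.cstep l (transp x) (transp z) \<and> path T.cstep ls (transp z) (transp y))"
    by (metis transp_transp)
  then show ?case using Cons by (simp add: rstep_def)
qed

lemma rto_iff: "rto x y \<longleftrightarrow> (\<exists>ps. path rstep ps x y)"
  by (simp add: rto_def T.cto_def path_transp)

lemma rowsum_eq: "rowsum x q = (\<Sum>i\<in>{i1..i2}. x (i, q))"
  by (simp add: rowsum_def T.colsum_def)

lemma quad_transp: "T.quad (transp x) l k = quad x k l"
  unfolding quad_def T.quad_def by (simp, rule sum.swap)

lemma cto_refl: "cto x x"
  unfolding cto_def by (rule exI[of _ "[]"]) simp

lemma cto_step: "cstep p x y \<Longrightarrow> cto y z \<Longrightarrow> cto x z"
  unfolding cto_def by (metis path.simps(2))

lemma cto_trans: "cto x y \<Longrightarrow> cto y z \<Longrightarrow> cto x z"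
  unfolding cto_def by (metis path_append)

lemma cto_induct [consumes 1, case_names refl step]:
  assumes "cto x y" "P y" "\<And>p x z. cstep p x z \<Longrightarrow> cto z y \<Longrightarrow> P z \<Longrightarrow> P x"
  shows "P x"
proof -
  obtain ps where "path cstep ps x y" using assms(1) by (auto simp: cto_def)
  then show ?thesis
  proof (induction ps arbitrary: x)
    case Nil
    then show ?case using assms(2) by simp
  next
    case (Cons p ps)
    then show ?case using assms(3) unfolding cto_def by (metis path.simps(2))
  qed
qed

lemma cto_in_X: "cto x y \<Longrightarrow> y \<in> X \<Longrightarrow> x \<in> X"
  by (induction rule: cto_induct) (auto dest: cstep_in_X)

lemma cto_in_X': "cto x y \<Longrightarrow> x \<in> X \<Longrightarrow> y \<in> X"
  by (induction rule: cto_induct) (auto dest: cstep_in_X)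

lemma cto_rot: "cto x y \<Longrightarrow> cto (rot y) (rot x)"
proof (induction rule: cto_induct)
  case refl
  then show ?case by (rule cto_refl)
next
  case (step p x z)
  have "cto (rot z) (rot x)" using cto_step[OF cstep_rot[OF step(1)] cto_refl] .
  then show ?case using step cto_trans by blast
qed

lemma cto_chain_bnd:
  assumes "cto x y" "j1 \<le> a" "b \<le> j2"
  shows "chain_bnd x ({i1..i2} \<times> {a..b}) t \<longleftrightarrow> chain_bnd y ({i1..i2} \<times> {a..b}) t"
  using assms(1) by (induction rule: cto_induct) (use cstep_chain_bnd assms(2,3) in blast)+

lemma cstep_rowsum: "cstep p x y \<Longrightarrow> rowsum y = rowsum x"
  by (erule cstepE) (simp add: fun_eq_iff rowsum_eq sum_row_col_move)

lemma cto_rowsum: "cto x y \<Longrightarrow> rowsum y = rowsum x"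
  by (induction rule: cto_induct) (auto dest: cstep_rowsum)

lemma colsum_col_move:
  assumes "j1 \<le> k" "k \<le> j2"
  shows "colsum (col_move p k x) i = colsum x i + of_bool (i = p) - of_bool (i = p + 1)"
proof -
  have "col_move p k x (i, j) = x (i, j) + of_bool (i = p \<and> j = k) - of_bool (i = p + 1 \<and> j = k)" for j
    by (auto simp: col_move_def)
  then show ?thesis
    using assms by (simp add: colsum_def sum.distrib sum_subtractf sum_of_bool_eq_interval)
qed

lemma exists_chigh:
  assumes "x \<in> X"
  shows "\<exists>y. cto x y \<and> chigh y"
proof -
  \<comment> \<open>Each unit is weighted by the distance of its column from \<open>i1\<close>. A
    step moves one unit one column to the left, so the nonnegative potential drops by one and
    raising terminates.\<close>
  define pot where "pot z = (\<Sum>i\<in>{i1..i2}. (i - i1) * colsum z i)" for z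
  have nonneg: "0 \<le> pot z" if "z \<in> X" for z
    unfolding pot_def colsum_def using X_nonneg[OF that]
    by (intro sum_nonneg mult_nonneg_nonneg) auto
  have decr: "pot z < pot y" if "cstep p y z" for p y z
  proof -
    obtain k where k: "i1 \<le> p" "p < i2" "z = col_move p k y" "j1 \<le> k" "k \<le> j2"
      using \<open>cstep p y z\<close> by (rule cstepE)
    have "(i - i1) * colsum z i = (i - i1) * colsum y i + (if i = p then i - i1 else 0)
      - (if i = p + 1 then i - i1 else 0)" for i
      unfolding k(3) by (simp add: colsum_col_move[OF k(4,5)] algebra_simps)
    then have "pot z = pot y + (p - i1) - (p + 1 - i1)"
      using k by (simp add: pot_def sum.distrib sum_subtractf)
    then show ?thesis by simp
  qed
  show ?thesis using assms
  proof (induction "nat (pot x)" arbitrary: x rule: less_induct)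
    case less
    show ?case
    proof (cases "chigh x")
      case True
      then show ?thesis using cto_refl by blast
    next
      case False
      then obtain p y where y: "cstep p x y" using less.prems by (auto simp: chigh_def)
      then have "nat (pot y) < nat (pot x)"
        using decr[OF y] nonneg[of y] nonneg[of x] cstep_in_X[OF y] by simp
      then show ?thesis using less.hyps cstep_in_X[OF y] cto_step[OF y] by blast
    qed
  qed
qed

lemma chigh_in_X: "chigh x \<Longrightarrow> x \<in> X"
  by (simp add: chigh_def)

text \<open>Since no step exists, \<open>asc\<close> never exceeds the weight of column
  \<open>p\<close>; cancelling the rows up to \<open>l\<close> leaves the lattice-word condition for
  adjacent columns.\<close>

lemma chigh_tail:
  assumes hi: "chigh x" and p: "i1 \<le> p" and l: "j1 \<le> l"
  shows "(\<Sum>j\<in>{l..j2}. x (p + 1, j)) \<le> (\<Sum>j\<in>{l+1..j2}. x (p, j))"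
proof (cases "p < i2 \<and> l \<le> j2")
  case True
  have "asc p x l \<le> (\<Sum>j\<in>{j1..j2}. x (p, j))"
    using cstep_exists[OF chigh_in_X[OF hi] p] hi True unfolding chigh_def by (meson not_le)
  moreover have "{j1..j2} = {j1..l} \<union> {l+1..j2}" using True l by auto
  then have "(\<Sum>j\<in>{j1..j2}. x (p, j)) = (\<Sum>j\<in>{j1..l}. x (p, j)) + (\<Sum>j\<in>{l+1..j2}. x (p, j))"
    by (simp add: sum.union_disjoint)
  ultimately show ?thesis by (simp add: asc_def)
next
  case False
  then have "(\<Sum>j\<in>{l..j2}. x (p + 1, j)) = 0"
    using X_outside[OF chigh_in_X[OF hi]] by (intro sum.neutral) auto
  then show ?thesis using X_nonneg[OF chigh_in_X[OF hi]] by (simp add: sum_nonneg)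
qed

lemma chigh_quad:
  assumes hi: "chigh x" and kl: "i1 \<le> k" "j1 \<le> l"
  shows "quad x (k + 1) l \<le> quad x k (l + 1)"
proof -
  have "quad x (k + 1) l = (\<Sum>p\<in>{k..i2-1}. \<Sum>j\<in>{l..j2}. x (p + 1, j))"
    unfolding quad_def
    by (rule sum.reindex_bij_witness[of _ "\<lambda>p. p + 1" "\<lambda>p. p - 1"]) auto
  also have "\<dots> \<le> (\<Sum>p\<in>{k..i2-1}. \<Sum>j\<in>{l+1..j2}. x (p, j))"
    using chigh_tail[OF hi] kl by (intro sum_mono) auto
  also have "\<dots> \<le> quad x k (l + 1)"
    unfolding quad_def using X_nonneg[OF chigh_in_X[OF hi]] by (intro sum_mono2 sum_nonneg) auto
  finally show ?thesis .
qed

lemma quad_corner: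
  assumes "k \<le> i2" "l \<le> j2"
  shows "x (k, l) = quad x k l - quad x (k + 1) l - quad x k (l + 1) + quad x (k + 1) (l + 1)"
proof -
  have "quad x k m = quad x (k + 1) m + (\<Sum>j\<in>{m..j2}. x (k, j))" for m
    unfolding quad_def using assms by (simp add: sum_atLeastAtMost_lower[of _ k])
  moreover have "(\<Sum>j\<in>{l..j2}. x (k, j)) = (\<Sum>j\<in>{l+1..j2}. x (k, j)) + x (k, l)"
    using assms by (simp add: sum_atLeastAtMost_lower[of _ l])
  ultimately show ?thesis by simp
qed

end

section \<open>Uniqueness of highest elements and the RSK pair\<close>

context window begin

text \<open>For an element that is highest in both directions the quadrant sum \<open>quad x k l\<close> depends only
  on \<open>k + l\<close>.\<close>

lemma both_high_eq:
  assumes hi: "chigh x" "rhigh x" "chigh y" "rhigh y" and eq: "colsum x = colsum y"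
  shows "x = y"
proof -
  have shift: "quad z (k + 1) l = quad z k (l + 1)"
    if "chigh z" "rhigh z" "i1 \<le> k" "j1 \<le> l" for z k l
  proof (rule antisym)
    show "quad z (k + 1) l \<le> quad z k (l + 1)" using chigh_quad that by blast
    show "quad z k (l + 1) \<le> quad z (k + 1) l"
      using T.chigh_quad[of "transp z" l k] that by (simp add: rhigh_def quad_transp)
  qed
  \<comment> \<open>On the bottom row the quadrant sums are tail sums of the column weights;
    \<open>shift\<close> carries the agreement upwards row by row.\<close>
  have quad0: "quad x k j1 = quad y k j1" for k
    using eq by (simp add: quad_def fun_eq_iff colsum_def)
  have "\<forall>k\<ge>i1. quad x k (j1 + int n) = quad y k (j1 + int n)" for n
  proof (induction n)
    case 0
    then show ?case using quad0 by simp
  next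
    case (Suc n)
    have "quad x k (j1 + int n + 1) = quad y k (j1 + int n + 1)" if "i1 \<le> k" for k
      using shift[of x k "j1 + int n"] shift[of y k "j1 + int n"] hi Suc that by simp
    then show ?case by (simp add: ac_simps)
  qed
  then have quad: "quad x k l = quad y k l" if "i1 \<le> k" "j1 \<le> l" for k l
    using that by (metis zle_iff_zadd)
  have "x (k, l) = y (k, l)" for k l
  proof (cases "i1 \<le> k \<and> k \<le> i2 \<and> j1 \<le> l \<and> l \<le> j2")
    case True
    then show ?thesis using quad_corner[of k l x] quad_corner[of k l y] quad by simp
  next
    case False
    then show ?thesis using X_outside chigh_in_X hi by metis
  qed
  then show ?thesis by auto
qed

text \<open>By the transposed \<open>step_mixed\<close>, a column step possible after the row step
  would have been possible before it.\<close>

lemma rstep_chigh: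
  assumes "rstep q x y" "chigh x"
  shows "chigh y"
proof -
  have "\<not> cstep p y w" for p w
  proof
    assume "cstep p y w"
    then have "T.rstep p (transp y) (transp w)" by (simp add: T.rstep_def)
    then obtain z where "T.rstep p (transp x) z"
      using T.step_mixed assms(1) unfolding rstep_def by blast
    then show False using assms(2) by (simp add: T.rstep_def chigh_def)
  qed
  then show ?thesis using rstep_in_X[OF assms(1)] by (simp add: chigh_def)
qed

lemma rpath_chigh: "path rstep ls x y \<Longrightarrow> chigh x \<Longrightarrow> chigh y"
  by (induction ls arbitrary: x) (auto dest: rstep_chigh)

end

context window begin

lemma cpath_rhigh: "path cstep ls x y \<Longrightarrow> rhigh x \<Longrightarrow> rhigh y"
  using T.rpath_chigh[of ls "transp x" "transp y"] T.path_transp[of ls "transp x" "transp y"]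
  by (simp add: rhigh_def T.rstep_def[abs_def])

lemma rto_colsum: "rto x y \<Longrightarrow> colsum y = colsum x"
  using T.cto_rowsum[of "transp x" "transp y"] by (simp add: rto_def T.rowsum_def)

lemma both_high_eq_rowsum:
  assumes "chigh x" "rhigh x" "chigh y" "rhigh y" "rowsum x = rowsum y"
  shows "x = y"
  using T.both_high_eq[of "transp x" "transp y"] assms
  by (simp add: rhigh_def T.rhigh_def rowsum_def) (metis transp_transp)

lemma exists_rhigh:
  assumes "x \<in> X"
  shows "\<exists>y. rto x y \<and> rhigh y"
  using T.exists_chigh[of "transp x"] assms unfolding transp_in_X rto_def rhigh_def
  by (metis transp_transp)

lemma rstep_inj: "rstep q x y \<Longrightarrow> rstep q x' y \<Longrightarrow> x = x'"
  unfolding rstep_def by (metis T.cstep_inj transp_transp)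

lemma cpath_inj: "path cstep ls x y \<Longrightarrow> path cstep ls x' y \<Longrightarrow> x = x'"
  by (rule path_inj[of cstep]) (rule cstep_inj)

lemma rpath_inj: "path rstep ls x y \<Longrightarrow> path rstep ls x' y \<Longrightarrow> x = x'"
  by (rule path_inj[of rstep]) (rule rstep_inj)

text \<open>The element \<open>d\<close> that is highest in both directions plays the role of the
  common shape: row steps keep column sums and column steps keep row sums, so \<open>d\<close> is
  fixed by \<open>p\<close> alone and also by \<open>q\<close> alone.\<close>

lemma highs_meet:
  assumes "path cstep ps x p" "chigh p" "path rstep qs x q" "rhigh q"
  shows "\<exists>d. path rstep qs p d \<and> path cstep ps q d \<and> chigh d \<and> rhigh d \<and>
    colsum d = colsum p \<and> rowsum d = rowsum q"
proof -
  obtain d where d: "path rstep qs p d" "path cstep ps q d"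
    using path_diamond[of cstep rstep ps x p qs q] step_diamond assms(1,3) by blast
  then have "chigh d" "rhigh d" using rpath_chigh cpath_rhigh assms by blast+
  moreover have "colsum d = colsum p" using rto_colsum d(1) rto_iff by blast
  moreover have "rowsum d = rowsum q" using cto_rowsum d(2) cto_def by blast
  ultimately show ?thesis using d by blast
qed

text \<open>One word of row steps carries both candidates to doubly highest elements with the same
  row sums. These coincide, and the word can be undone by injectivity.\<close>

lemma chigh_unique:
  assumes "cto x p" "chigh p" "cto x p'" "chigh p'"
  shows "p = p'"
proof -
  obtain ps ps' where ps: "path cstep ps x p" "path cstep ps' x p'" using assms by (auto simp: cto_def)
  have "x \<in> X" using cto_in_X assms chigh_in_X by blast
  then obtain q qs where q: "path rstep qs x q" "rhigh q" using exists_rhigh rto_iff by blast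
  obtain d where d: "path rstep qs p d" "chigh d" "rhigh d" "rowsum d = rowsum q"
    using highs_meet[OF ps(1) assms(2) q] by blast
  obtain d' where d': "path rstep qs p' d'" "chigh d'" "rhigh d'" "rowsum d' = rowsum q"
    using highs_meet[OF ps(2) assms(4) q] by blast
  have "d = d'" using both_high_eq_rowsum d d' by simp
  then show ?thesis using rpath_inj d(1) d'(1) by blast
qed

text \<open>Together the two highest elements determine \<open>x\<close>: they play the roles of the two tableaux in the
  RSK correspondence.\<close>

lemma highs_determine:
  assumes "cto x p" "cto y p" "chigh p" "rto x q" "rto y q" "rhigh q"
  shows "x = y"
proof -
  obtain v v' w w' where paths: "path cstep v x p" "path cstep v' y p" "path rstep w x q" "path rstep w' y q"
    using assms by (auto simp: cto_def rto_iff)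
  obtain d where d: "path rstep w p d" "path cstep v q d" "chigh d" "rhigh d" "colsum d = colsum p"
    using highs_meet[OF paths(1) assms(3) paths(3) assms(6)] by blast
  obtain d' where d': "path cstep v' q d'" "chigh d'" "rhigh d'" "colsum d' = colsum p"
    using highs_meet[OF paths(2) assms(3) paths(4) assms(6)] by blast
  have "d = d'" using both_high_eq d d' by simp
  obtain z where z: "path rstep w y z" "path cstep v' z d"
    using path_mixed[of cstep rstep v' y p w d] step_mixed paths(2) d(1) by blast
  then have "z = q" using cpath_inj d'(1) \<open>d = d'\<close> by blast
  then show ?thesis using rpath_inj z(1) paths(3) by blast
qed

text \<open>This is the surjective half of RSK. Equal row sums put \<open>p\<close> and
  \<open>q\<close> below the same doubly highest element, and filling the grid backwards from it
  gives the common source \<open>y\<close>.\<close>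

lemma highs_realize:
  assumes "x \<in> X" "z \<in> X" "cto x p" "chigh p" "rto x r" "rhigh r" "rto z q" "rhigh q"
    and "rowsum r = rowsum q"
  shows "\<exists>y. cto y p \<and> rto y q"
proof -
  obtain ps rs where x: "path cstep ps x p" "path rstep rs x r" using assms by (auto simp: cto_def rto_iff)
  obtain d where d: "path rstep rs p d" "chigh d" "rhigh d" "rowsum d = rowsum r"
    using highs_meet[OF x(1) assms(4) x(2) assms(6)] by blast
  obtain qs where qs: "path rstep qs z q" using assms by (auto simp: rto_iff)
  obtain s ss where s: "path cstep ss z s" "chigh s" using exists_chigh[OF assms(2)] by (auto simp: cto_def)
  obtain d' where d': "path cstep ss q d'" "chigh d'" "rhigh d'" "rowsum d' = rowsum q"
    using highs_meet[OF s qs assms(8)] by blast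
  have "d = d'" using both_high_eq_rowsum d d' assms(9) by simp
  then have "\<exists>y. path rstep rs y q \<and> path cstep ss y p"
    using path_codiamond[of rstep cstep rs p d ss q] step_codiamond d(1) d'(1) by blast
  then show ?thesis using rto_iff cto_def by blast
qed

end

subsection \<open>Reversing the columns of a rectangle\<close>

context window begin

lemma chain_bnd_rot:
  "chain_bnd (rot x) ({a..b} \<times> {c..d}) t \<longleftrightarrow>
   chain_bnd x ({i1+i2-b..i1+i2-a} \<times> {j1+j2-d..j1+j2-c}) t"
proof -
  define h :: "box \<Rightarrow> box" where "h = (\<lambda>(i, j). (i1 + i2 - i, j1 + j2 - j))"
  have aux: "chain_bnd (rot y) ({a..b} \<times> {c..d}) t"
    if "chain_bnd y ({i1+i2-b..i1+i2-a} \<times> {j1+j2-d..j1+j2-c}) t" for y a b c d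
  proof -
    have "h ` ({a..b} \<times> {c..d}) \<subseteq> {i1+i2-b..i1+i2-a} \<times> {j1+j2-d..j1+j2-c}"
      by (auto simp: h_def)
    then have "chain_bnd y (h ` ({a..b} \<times> {c..d})) t"
      using that by (rule chain_bnd_subset[rotated])
    moreover have "inj_on h R" for R by (auto simp: h_def inj_on_def)
    moreover have "u \<le> v \<Longrightarrow> h u \<le> h v \<or> h v \<le> h u" for u v
      by (auto simp: h_def less_eq_prod_def split: prod.splits)
    ultimately have "chain_bnd (\<lambda>v. y (h v)) ({a..b} \<times> {c..d}) t"
      by (rule chain_bnd_reindex[of h _ y, rotated 2])
    then show ?thesis by (simp add: rot_def h_def case_prod_unfold)
  qed
  show ?thesis
    using aux[of x b a d c] aux[of "rot x" "i1+i2-a" "i1+i2-b" "j1+j2-c" "j1+j2-d"] by auto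
qed

text \<open>Steps on the pair \<open>p\<close>, \<open>p + 1\<close> add one unit at a time to
  column \<open>p\<close> without changing the maximum of \<open>asc\<close>, so every weight up to
  that maximum is reached.\<close>

lemma cto_raise:
  assumes "z \<in> X" "i1 \<le> p" "p < i2" "colsum z p \<le> g" "g \<le> asc p z k"
  shows "\<exists>z'. cto z z' \<and> colsum z' p = g \<and> (\<forall>i. i \<noteq> p \<longrightarrow> i \<noteq> p + 1 \<longrightarrow> colsum z' i = colsum z i)"
  using assms
proof (induction "nat (g - colsum z p)" arbitrary: z k rule: less_induct)
  case less
  show ?case
  proof (cases "colsum z p = g")
    case True
    then show ?thesis using cto_refl by blast
  next
    case False
    then have lt: "colsum z p < g" using less.prems by simp
    then obtain y where y: "cstep p z y"
      using cstep_exists[of z p k] less.prems unfolding colsum_def by fastforce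
    then obtain m where m: "last_max (asc p z) m" "y = col_move p m z" "j1 \<le> m" "m \<le> j2"
      by (rule cstepE)
    have cs: "colsum y i = colsum z i + of_bool (i = p) - of_bool (i = p + 1)" for i
      unfolding m(2) by (rule colsum_col_move[OF m(3,4)])
    \<comment> \<open>The value at \<open>m\<close> was the maximum and is unchanged by the move, so
      \<open>m\<close> replaces \<open>k\<close> as the witness for the next round.\<close>
    have "g \<le> asc p y m"
      using last_max_ge[OF m(1), of k] less.prems(5) asc_col_move[OF m(3,4), of p z m] m(2) by simp
    then obtain z' where "cto y z'" "colsum z' p = g"
      "\<forall>i. i \<noteq> p \<longrightarrow> i \<noteq> p + 1 \<longrightarrow> colsum z' i = colsum y i"
      using less.hyps[of y m] cs[of p] lt less.prems cstep_in_X[OF y] by auto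
    then show ?thesis using cto_step[OF y] cs by (intro exI[of _ z']) auto
  qed
qed

lemma cto_prefix_mono:
  assumes "cto x y"
  shows "(\<Sum>i\<in>{i1..c}. colsum x i) \<le> (\<Sum>i\<in>{i1..c}. colsum y i)"
  using assms
proof (induction rule: cto_induct)
  case (step p x z)
  obtain k where k: "i1 \<le> p" "z = col_move p k x" "j1 \<le> k" "k \<le> j2" using step(1) by (rule cstepE)
  have "colsum z i = colsum x i + of_bool (True \<and> i = p) - of_bool (True \<and> i = p + 1)" for i
    unfolding k(2) using colsum_col_move[OF k(3,4)] by simp
  then have "(\<Sum>i\<in>{i1..c}. colsum z i) = (\<Sum>i\<in>{i1..c}. colsum x i)
     + of_bool (True \<and> i1 \<le> p \<and> p \<le> c) - of_bool (True \<and> i1 \<le> p + 1 \<and> p + 1 \<le> c)"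
    unfolding sum_of_bool_eq_interval[symmetric] by (simp add: sum.distrib sum_subtractf)
  then have "(\<Sum>i\<in>{i1..c}. colsum x i) \<le> (\<Sum>i\<in>{i1..c}. colsum z i)"
    using k(1) by simp
  then show ?case using step(3) by simp
qed simp

lemma initial_segment:
  fixes a :: int
  assumes "finite S" "S \<subseteq> {a..}" "\<And>i. i \<in> S \<Longrightarrow> a < i \<Longrightarrow> i - 1 \<in> S"
  shows "S = {a..a + int (card S) - 1}"
proof (cases "S = {}")
  case False
  have down: "i \<in> S" if "i \<le> Max S" "a \<le> i" for i
    using that
  proof (induction i rule: int_le_induct)
    case base
    then show ?case using False assms(1) by simp
  next
    case (step i)
    then show ?case using assms(3)[of i] by simp
  qed
  then have S: "S = {a..Max S}" using assms(1,2) by auto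
  have "a \<le> Max S" using False assms by (metis Max_in atLeast_iff subsetD)
  then have "int (card S) = Max S - a + 1" by (subst S) simp
  then show ?thesis using S by simp
qed auto

text \<open>While \<open>S\<close> has a gap, a column \<open>p + 1\<close> of \<open>S\<close> is
  traded for \<open>p\<close> outside \<open>S\<close>. If \<open>p\<close> is lighter, it is first
  raised to the weight of \<open>p + 1\<close>; the sum over the new set does not decrease, and the
  indices in \<open>S\<close> get smaller.\<close>

lemma slide_to_prefix:
  assumes "z \<in> X" "S \<subseteq> {i1..i2}"
  shows "\<exists>z'. cto z z' \<and> (\<Sum>i\<in>S. colsum z i) \<le> (\<Sum>i\<in>{i1..i1 + int (card S) - 1}. colsum z' i)"
  using assms
proof (induction "nat (\<Sum>i\<in>S. i - i1)" arbitrary: z S rule: less_induct)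
  case less
  have finS: "finite S" using less.prems(2) finite_subset by blast
  show ?case
  proof (cases "\<forall>i\<in>S. i1 < i \<longrightarrow> i - 1 \<in> S")
    case True
    then have "S = {i1..i1 + int (card S) - 1}"
      using finS less.prems(2) by (intro initial_segment) auto
    then show ?thesis using cto_refl[of z] by (intro exI[of _ z]) auto
  next
    case False
    then obtain i where i: "i \<in> S" "i1 < i" "i - 1 \<notin> S" by blast
    define p where "p = i - 1"
    have p: "p + 1 \<in> S" "p \<notin> S" "i1 \<le> p" "p < i2" using i less.prems(2) by (auto simp: p_def)
    define S' where "S' = insert p (S - {p + 1})"
    have sumS: "(\<Sum>i\<in>S. f i) = f (p + 1) + (\<Sum>i\<in>S - {p + 1}. f i)"
      and sumS': "(\<Sum>i\<in>S'. f i) = f p + (\<Sum>i\<in>S - {p + 1}. f i)" for f :: "int \<Rightarrow> int"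
      using finS p by (simp_all add: sum.remove[of S "p + 1"] S'_def)
    have cardS': "card S' = card S" using finS p card.remove[of S "p + 1"] by (simp add: S'_def)
    have "0 \<le> (\<Sum>i\<in>S'. i - i1)" "(\<Sum>i\<in>S'. i - i1) < (\<Sum>i\<in>S. i - i1)"
      using less.prems(2) p unfolding sumS sumS' by (auto intro!: add_nonneg_nonneg sum_nonneg)
    then have decr: "nat (\<Sum>i\<in>S'. i - i1) < nat (\<Sum>i\<in>S. i - i1)" by simp
    have S'sub: "S' \<subseteq> {i1..i2}" using less.prems(2) p by (auto simp: S'_def)
    have "\<exists>z1. cto z z1 \<and> (\<Sum>i\<in>S. colsum z i) \<le> (\<Sum>i\<in>S'. colsum z1 i)"
    proof (cases "colsum z (p + 1) \<le> colsum z p")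
      case True
      then show ?thesis using cto_refl[of z] sumS sumS' by (intro exI[of _ z]) simp
    next
      case False
      \<comment> \<open>Below the window \<open>asc\<close> equals the weight of column
        \<open>p + 1\<close>, which makes this weight an admissible target for
        \<open>cto_raise\<close>.\<close>
      have "colsum z (p + 1) \<le> asc p z (j1 - 1)"
        using asc_const(1)[OF less.prems(1)] by (simp add: colsum_def)
      then obtain z1 where z1: "cto z z1" "colsum z1 p = colsum z (p + 1)"
        "\<forall>i. i \<noteq> p \<longrightarrow> i \<noteq> p + 1 \<longrightarrow> colsum z1 i = colsum z i"
        using cto_raise[OF less.prems(1) p(3,4)] False by (metis linear)
      have "(\<Sum>i\<in>S - {p + 1}. colsum z1 i) = (\<Sum>i\<in>S - {p + 1}. colsum z i)"
        using z1(3) p(2) by (intro sum.cong) auto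
      then show ?thesis using z1 sumS sumS' by (intro exI[of _ z1]) simp
    qed
    then obtain z1 where z1: "cto z z1" "(\<Sum>i\<in>S. colsum z i) \<le> (\<Sum>i\<in>S'. colsum z1 i)" by blast
    obtain z' where "cto z1 z'"
      "(\<Sum>i\<in>S'. colsum z1 i) \<le> (\<Sum>i\<in>{i1..i1 + int (card S') - 1}. colsum z' i)"
      using less.hyps[OF decr _ S'sub] cto_in_X'[OF z1(1)] less.prems(1) by blast
    then show ?thesis using z1 cto_trans cardS' by (intro exI[of _ z']) auto
  qed
qed

text \<open>Any route of raising ends at the same \<open>r\<close> by \<open>chigh_unique\<close>;
  so one may first slide \<open>S\<close> to a prefix, and raising further never decreases prefix
  sums.\<close>

lemma chigh_dominates:
  assumes "cto z r" "chigh r" "S \<subseteq> {i1..i2}"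
  shows "(\<Sum>i\<in>S. colsum z i) \<le> (\<Sum>i\<in>{i1..i1 + int (card S) - 1}. colsum r i)"
proof -
  have z: "z \<in> X" using cto_in_X assms chigh_in_X by blast
  obtain z' where z': "cto z z'" "(\<Sum>i\<in>S. colsum z i) \<le> (\<Sum>i\<in>{i1..i1 + int (card S) - 1}. colsum z' i)"
    using slide_to_prefix[OF z assms(3)] by blast
  obtain r' where r': "cto z' r'" "chigh r'" using exists_chigh cto_in_X'[OF z'(1) z] by blast
  then have "r' = r" using chigh_unique cto_trans z'(1) assms by blast
  then show ?thesis using z'(2) cto_prefix_mono[OF r'(1), of "i1 + int (card S) - 1"] by simp
qed

text \<open>Rotation reverses raising, so \<open>rot r\<close> can be raised to \<open>q\<close>.
  Its last columns are the first columns of \<open>r\<close>, and \<open>chigh_dominates\<close>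
  bounds the prefix sums of \<open>r\<close> by those of \<open>q\<close>; exchanging the roles
  gives equality.\<close>

lemma shape_rot:
  assumes "cto x r" "chigh r" "cto (rot x) q" "chigh q"
  shows "colsum r = colsum q"
proof -
  have le: "(\<Sum>i\<in>{i1..c}. colsum r i) \<le> (\<Sum>i\<in>{i1..c}. colsum q i)"
    if *: "cto x r" "chigh r" "cto (rot x) q" "chigh q" and c: "i1 \<le> c" "c \<le> i2" for x r q c
  proof -
    define S where "S = {i1 + i2 - c..i2}"
    have "cto (rot r) q" using cto_trans[OF cto_rot[OF *(1)] *(3)] .
    then have "(\<Sum>i\<in>S. colsum (rot r) i) \<le> (\<Sum>i\<in>{i1..i1 + int (card S) - 1}. colsum q i)"
      using chigh_dominates[OF _ *(4), of "rot r" S] c by (auto simp: S_def)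
    moreover have "i1 + int (card S) - 1 = c" using c by (simp add: S_def)
    moreover have "(\<Sum>i\<in>S. colsum (rot r) i) = (\<Sum>i\<in>{i1..c}. colsum r i)"
    proof -
      have "colsum (rot r) i = colsum r (i1 + i2 - i)" for i
        unfolding colsum_def rot_def prod.case
        by (rule sum.reindex_bij_witness[of _ "\<lambda>j. j1 + j2 - j" "\<lambda>j. j1 + j2 - j"]) auto
      then show ?thesis unfolding S_def using c
        by (intro sum.reindex_bij_witness[of _ "\<lambda>i. i1 + i2 - i" "\<lambda>i. i1 + i2 - i"]) auto
    qed
    ultimately show ?thesis by simp
  qed
  have eq: "(\<Sum>i\<in>{i1..c}. colsum r i) = (\<Sum>i\<in>{i1..c}. colsum q i)" if "c \<le> i2" for c
    using le[OF assms, of c] le[of "rot x" q r c] assms that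
    by (cases "i1 \<le> c") auto
  have "colsum r i = colsum q i" for i
  proof (cases "i1 \<le> i \<and> i \<le> i2")
    case True
    then show ?thesis
      using eq[of i] eq[of "i - 1"] sum_atLeastAtMost_add1[of "colsum r" i1 "i - 1"]
        sum_atLeastAtMost_add1[of "colsum q" i1 "i - 1"] by simp
  next
    case False
    then show ?thesis
      using X_outside[OF chigh_in_X[OF assms(2)]] X_outside[OF chigh_in_X[OF assms(4)]]
      unfolding colsum_def by (intro sum.cong) metis+
  qed
  then show ?thesis by auto
qed

end

context window begin

lemma rto_rot: "rto x y \<Longrightarrow> rto (rot y) (rot x)"
  using T.cto_rot[of "transp x" "transp y"] by (simp add: rto_def T_rot_transp)

lemma rto_trans: "rto x y \<Longrightarrow> rto y z \<Longrightarrow> rto x z"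
  unfolding rto_def by (rule T.cto_trans)

lemma rhigh_unique: "rto x p \<Longrightarrow> rhigh p \<Longrightarrow> rto x q \<Longrightarrow> rhigh q \<Longrightarrow> p = q"
  using T.chigh_unique[of "transp x" "transp p" "transp q"]
  unfolding rto_def rhigh_def by (metis transp_transp)

lemma rto_chain_bnd:
  assumes "rto x y" "i1 \<le> a" "b \<le> i2"
  shows "chain_bnd x ({a..b} \<times> {j1..j2}) t \<longleftrightarrow> chain_bnd y ({a..b} \<times> {j1..j2}) t"
  using T.cto_chain_bnd[of "transp x" "transp y" a b t] assms by (simp add: rto_def chain_bnd_transp)

text \<open>From \<open>p\<close> the filling \<open>y\<close> inherits the weights of row intervals
  of \<open>x\<close>, from \<open>q\<close> the weights of column intervals of
  \<open>rot x\<close>, that is, of the mirrored intervals of \<open>x\<close>.\<close>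

definition reversal :: "(box \<Rightarrow> int) \<Rightarrow> (box \<Rightarrow> int) \<Rightarrow> bool" where
  "reversal x y \<longleftrightarrow>
    (\<exists>p q. cto x p \<and> cto y p \<and> chigh p \<and> rto (rot x) q \<and> rto y q \<and> rhigh q)"

text \<open>The data from \<open>x\<close> and from \<open>rot x\<close> are compatible because the
  transposed \<open>shape_rot\<close> gives the two row-highest elements equal row sums.\<close>

lemma reversal_exists:
  assumes "x \<in> X"
  shows "\<exists>y. reversal x y"
proof -
  obtain p where p: "cto x p" "chigh p" using exists_chigh assms by blast
  obtain r where r: "rto x r" "rhigh r" using exists_rhigh assms by blast
  have rx: "rot x \<in> X" using assms rot_in_X by blast
  obtain q where q: "rto (rot x) q" "rhigh q" using exists_rhigh rx by blast
  have "rowsum r = rowsum q"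
    using T.shape_rot[of "transp x" "transp r" "transp q"] r q
    by (simp add: rto_def rhigh_def rowsum_def T_rot_transp)
  then show ?thesis
    using highs_realize[OF assms rx p r q] p q unfolding reversal_def by blast
qed

lemma reversal_inj:
  assumes "reversal x y" "reversal x' y" "x \<in> X"
  shows "x = x'"
proof -
  obtain p q where pq: "cto x p" "cto y p" "chigh p" "rto (rot x) q" "rto y q" "rhigh q"
    using assms(1) by (auto simp: reversal_def)
  obtain p' q' where pq': "cto x' p'" "cto y p'" "chigh p'" "rto (rot x') q'" "rto y q'" "rhigh q'"
    using assms(2) by (auto simp: reversal_def)
  have "p = p'" "q = q'" using chigh_unique rhigh_unique pq pq' by blast+
  have x': "x' \<in> X" using cto_in_X pq' chigh_in_X by blast
  \<comment> \<open>Rotating once more, \<open>x\<close> and \<open>x'\<close> are both raised from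
    \<open>rot q\<close> and so have the same row-highest element; the column-highest one they share
    already.\<close>
  have to: "rto (rot q) x" "rto (rot q) x'"
    using rto_rot[OF pq(4)] rto_rot[OF pq'(4)] \<open>q = q'\<close> by simp_all
  obtain r where r: "rto x r" "rhigh r" using exists_rhigh assms(3) by blast
  obtain r' where r': "rto x' r'" "rhigh r'" using exists_rhigh x' by blast
  have "r = r'" using rhigh_unique rto_trans to r r' by blast
  then show ?thesis using highs_determine pq(1,3) pq'(1) \<open>p = p'\<close> r r' by blast
qed

lemma column_reversal:
  "\<exists>E. inj_on E X \<and> (\<forall>x\<in>X. E x \<in> X \<and>
     (\<forall>a b t. j1 \<le> a \<longrightarrow> b \<le> j2 \<longrightarrow>
        chain_bnd (E x) ({i1..i2} \<times> {a..b}) t = chain_bnd x ({i1..i2} \<times> {a..b}) t) \<and>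
     (\<forall>a b t. i1 \<le> a \<longrightarrow> b \<le> i2 \<longrightarrow>
        chain_bnd (E x) ({a..b} \<times> {j1..j2}) t = chain_bnd x ({i1+i2-b..i1+i2-a} \<times> {j1..j2}) t))"
proof -
  obtain E where E: "\<And>x. x \<in> X \<Longrightarrow> reversal x (E x)" using reversal_exists by metis
  show ?thesis
  proof (intro exI[of _ E] conjI ballI allI impI)
    show "inj_on E X" using E reversal_inj by (metis inj_onI)
  next
    fix x assume "x \<in> X"
    then obtain p q where pq: "cto x p" "cto (E x) p" "chigh p" "rto (rot x) q" "rto (E x) q" "rhigh q"
      using E unfolding reversal_def by blast
    show "E x \<in> X" using cto_in_X pq chigh_in_X by blast
    show "chain_bnd (E x) ({i1..i2} \<times> {a..b}) t = chain_bnd x ({i1..i2} \<times> {a..b}) t"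
      if "j1 \<le> a" "b \<le> j2" for a b t
      using cto_chain_bnd pq that by blast
    show "chain_bnd (E x) ({a..b} \<times> {j1..j2}) t = chain_bnd x ({i1+i2-b..i1+i2-a} \<times> {j1..j2}) t"
      if "i1 \<le> a" "b \<le> i2" for a b t
      using rto_chain_bnd[OF pq(4) that] rto_chain_bnd[OF pq(5) that]
      by (simp add: chain_bnd_rot)
  qed
qed

end

text \<open>Reversing columns \<open>l + 1..r\<close> and then all of \<open>l..r\<close> sends
  column \<open>l\<close> to position \<open>r\<close> and shifts the others by one. Intervals
  ending before \<open>r\<close> are exactly those whose preimage avoids column
  \<open>l\<close>.\<close>

lemma column_cycle:
  fixes l r j1 j2 :: int
  defines "X \<equiv> window.X l r j1 j2"
  shows "\<exists>F. inj_on F X \<and> (\<forall>x\<in>X. F x \<in> X \<and>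
     (\<forall>a b t. j1 \<le> a \<longrightarrow> b \<le> j2 \<longrightarrow>
        chain_bnd (F x) ({l..r} \<times> {a..b}) t = chain_bnd x ({l..r} \<times> {a..b}) t) \<and>
     (\<forall>a b t. l \<le> a \<longrightarrow> b < r \<longrightarrow>
        chain_bnd (F x) ({a..b} \<times> {j1..j2}) t = chain_bnd x ({a+1..b+1} \<times> {j1..j2}) t))"
proof -
  interpret W: window l r j1 j2 .
  interpret V: window "l + 1" r j1 j2 .
  obtain E where injE: "inj_on E W.X" and E_in: "\<And>x. x \<in> W.X \<Longrightarrow> E x \<in> W.X"
    and E_rows: "\<And>x a b t. x \<in> W.X \<Longrightarrow> j1 \<le> a \<Longrightarrow> b \<le> j2 \<Longrightarrow>
        chain_bnd (E x) ({l..r} \<times> {a..b}) t = chain_bnd x ({l..r} \<times> {a..b}) t"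
    and E_cols: "\<And>x a b t. x \<in> W.X \<Longrightarrow> l \<le> a \<Longrightarrow> b \<le> r \<Longrightarrow>
        chain_bnd (E x) ({a..b} \<times> {j1..j2}) t = chain_bnd x ({l+r-b..l+r-a} \<times> {j1..j2}) t"
  proof -
    obtain E where E: "inj_on E W.X" "\<forall>x\<in>W.X. E x \<in> W.X \<and>
     (\<forall>a b t. j1 \<le> a \<longrightarrow> b \<le> j2 \<longrightarrow>
        chain_bnd (E x) ({l..r} \<times> {a..b}) t = chain_bnd x ({l..r} \<times> {a..b}) t) \<and>
     (\<forall>a b t. l \<le> a \<longrightarrow> b \<le> r \<longrightarrow>
        chain_bnd (E x) ({a..b} \<times> {j1..j2}) t = chain_bnd x ({l+r-b..l+r-a} \<times> {j1..j2}) t)"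
      using W.column_reversal by (elim exE conjE)
    show thesis by (rule that[of E]) (use E in simp_all)
  qed
  obtain D where injD: "inj_on D V.X" and D_in: "\<And>x. x \<in> V.X \<Longrightarrow> D x \<in> V.X"
    and D_rows: "\<And>x a b t. x \<in> V.X \<Longrightarrow> j1 \<le> a \<Longrightarrow> b \<le> j2 \<Longrightarrow>
        chain_bnd (D x) ({l+1..r} \<times> {a..b}) t = chain_bnd x ({l+1..r} \<times> {a..b}) t"
    and D_cols: "\<And>x a b t. x \<in> V.X \<Longrightarrow> l + 1 \<le> a \<Longrightarrow> b \<le> r \<Longrightarrow>
        chain_bnd (D x) ({a..b} \<times> {j1..j2}) t = chain_bnd x ({l+1+r-b..l+1+r-a} \<times> {j1..j2}) t"
  proof -
    obtain D where D: "inj_on D V.X" "\<forall>x\<in>V.X. D x \<in> V.X \<and>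
     (\<forall>a b t. j1 \<le> a \<longrightarrow> b \<le> j2 \<longrightarrow>
        chain_bnd (D x) ({l+1..r} \<times> {a..b}) t = chain_bnd x ({l+1..r} \<times> {a..b}) t) \<and>
     (\<forall>a b t. l + 1 \<le> a \<longrightarrow> b \<le> r \<longrightarrow>
        chain_bnd (D x) ({a..b} \<times> {j1..j2}) t = chain_bnd x ({l+1+r-b..l+1+r-a} \<times> {j1..j2}) t)"
      using V.column_reversal by (elim exE conjE)
    show thesis by (rule that[of D]) (use D in simp_all)
  qed
  \<comment> \<open>\<open>res\<close> clears column \<open>l\<close> so that the filling lives in
    the smaller window; \<open>G\<close> reverses there and puts column \<open>l\<close> back
    unchanged.\<close>
  define res :: "(box \<Rightarrow> int) \<Rightarrow> box \<Rightarrow> int" where "res x = (\<lambda>(i, j). if i = l then 0 else x (i, j))" for x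
  define G :: "(box \<Rightarrow> int) \<Rightarrow> box \<Rightarrow> int" where
    "G x = (\<lambda>(i, j). if i = l then x (i, j) else D (res x) (i, j))" for x
  have res: "res x \<in> V.X" if "x \<in> W.X" for x
    using W.X_nonneg[OF that] W.X_outside[OF that] by (auto simp: V.X_def res_def)
  have res_eq: "chain_bnd (res x) ({a..b} \<times> J) t \<longleftrightarrow> chain_bnd x ({a..b} \<times> J) t" if "l < a" for x a b J t
    using that by (intro chain_bnd_cong) (auto simp: res_def)
  have G_eq: "chain_bnd (G x) ({a..b} \<times> J) t \<longleftrightarrow> chain_bnd (D (res x)) ({a..b} \<times> J) t" if "l < a" for x a b J t
    using that by (intro chain_bnd_cong) (auto simp: G_def)
  have G_in: "G x \<in> W.X" if "x \<in> W.X" for x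
    using W.X_nonneg[OF that] W.X_outside[OF that] V.X_nonneg[OF D_in[OF res[OF that]]]
      V.X_outside[OF D_in[OF res[OF that]]] by (auto simp: W.X_def G_def)
  have injG: "inj_on G W.X"
  proof (rule inj_onI)
    fix x y assume xy: "x \<in> W.X" "y \<in> W.X" "G x = G y"
    have "D (res x) (i, j) = D (res y) (i, j)" for i j
    proof (cases "i = l")
      case True
      then show ?thesis using V.X_outside[OF D_in[OF res[OF xy(1)]]] V.X_outside[OF D_in[OF res[OF xy(2)]]] by simp
    next
      case False
      then show ?thesis using fun_cong[OF xy(3), of "(i, j)"] by (simp add: G_def)
    qed
    then have "D (res x) = D (res y)" by auto
    then have "res x = res y" using injD res xy by (meson inj_onD)
    have "x (i, j) = y (i, j)" for i j
      using fun_cong[OF \<open>res x = res y\<close>, of "(i, j)"] fun_cong[OF xy(3), of "(i, j)"]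
      by (cases "i = l") (auto simp: res_def G_def)
    then show "x = y" by auto
  qed
  have G_block: "chain_bnd (G x) ({l+1..r} \<times> {a..b}) t = chain_bnd x ({l+1..r} \<times> {a..b}) t"
    if "x \<in> W.X" "j1 \<le> a" "b \<le> j2" for x a b t
    using G_eq res_eq D_rows[OF res[OF that(1)] that(2,3)] by simp
  have off: "i \<in> {l..r} \<Longrightarrow> i \<notin> {l+1..r} \<Longrightarrow> G x (i, j) = x (i, j)" for x i j
    by (auto simp: G_def)
  \<comment> \<open>\<open>D\<close> controls only the block without column \<open>l\<close>;
    \<open>chain_bnd_exchange\<close> reroutes chains inside that block and so extends the equality
    to the full width.\<close>
  have G_rows: "chain_bnd (G x) ({l..r} \<times> {a..b}) t = chain_bnd x ({l..r} \<times> {a..b}) t"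
    if "x \<in> W.X" "j1 \<le> a" "b \<le> j2" for x a b t
  proof
    show "chain_bnd (G x) ({l..r} \<times> {a..b}) t" if "chain_bnd x ({l..r} \<times> {a..b}) t"
      by (rule chain_bnd_exchange[where x = x and p = "l + 1" and q = r])
        (use off G_block \<open>x \<in> W.X\<close> \<open>j1 \<le> a\<close> \<open>b \<le> j2\<close> that in auto)
    show "chain_bnd x ({l..r} \<times> {a..b}) t" if "chain_bnd (G x) ({l..r} \<times> {a..b}) t"
      by (rule chain_bnd_exchange[where x = "G x" and p = "l + 1" and q = r])
        (use off G_block \<open>x \<in> W.X\<close> \<open>j1 \<le> a\<close> \<open>b \<le> j2\<close> that in auto)
  qed
  show ?thesis unfolding X_def
  proof (intro exI[of _ "\<lambda>x. E (G x)"] conjI ballI allI impI)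
    show "inj_on (\<lambda>x. E (G x)) W.X"
      using injE injG G_in by (auto simp: inj_on_def)
  next
    fix x assume x: "x \<in> W.X"
    show "E (G x) \<in> W.X" using E_in G_in x by blast
    show "chain_bnd (E (G x)) ({l..r} \<times> {a..b}) t = chain_bnd x ({l..r} \<times> {a..b}) t"
      if "j1 \<le> a" "b \<le> j2" for a b t
      using E_rows G_rows G_in x that by simp
    show "chain_bnd (E (G x)) ({a..b} \<times> {j1..j2}) t = chain_bnd x ({a+1..b+1} \<times> {j1..j2}) t"
      if "l \<le> a" "b < r" for a b t
    proof -
      \<comment> \<open>The two reflections \<open>i\<close> to \<open>l + r - i\<close> and
        \<open>i\<close> to \<open>l + 1 + r - i\<close> compose to a translation by one.\<close>
      have "chain_bnd (E (G x)) ({a..b} \<times> {j1..j2}) t =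
          chain_bnd (G x) ({l+r-b..l+r-a} \<times> {j1..j2}) t"
        using E_cols[OF G_in[OF x]] that by simp
      also have "\<dots> = chain_bnd (D (res x)) ({l+r-b..l+r-a} \<times> {j1..j2}) t"
        using G_eq that by simp
      also have "\<dots> = chain_bnd (res x) ({l+1+r-(l+r-a)..l+1+r-(l+r-b)} \<times> {j1..j2}) t"
        using that by (intro D_cols res x) auto
      also have "{l+1+r-(l+r-a)..l+1+r-(l+r-b)} = {a+1..b+1}" by auto
      also have "chain_bnd (res x) ({a+1..b+1} \<times> {j1..j2}) t = chain_bnd x ({a+1..b+1} \<times> {j1..j2}) t"
        using res_eq that by simp
      finally show ?thesis .
    qed
  qed
qed

subsection \<open>Moving a column of a moon polyomino\<close>

lemma chain_bnd_exchange_rows: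
  fixes x y :: "box \<Rightarrow> int"
  assumes off: "\<And>i j. i \<in> {a0..b0} \<Longrightarrow> j \<in> {P..Q} \<Longrightarrow> j \<notin> {p..q} \<Longrightarrow> y (i, j) \<le> x (i, j)"
    and sub: "P \<le> p" "q \<le> Q"
    and block: "\<And>a b t. a0 \<le> a \<Longrightarrow> b \<le> b0 \<Longrightarrow>
      chain_bnd x ({a..b} \<times> {p..q}) t \<Longrightarrow> chain_bnd y ({a..b} \<times> {p..q}) t"
    and bnd: "chain_bnd x ({a0..b0} \<times> {P..Q}) t"
  shows "chain_bnd y ({a0..b0} \<times> {P..Q}) t"
proof -
  have "chain_bnd (transp y) ({P..Q} \<times> {a0..b0}) t"
    by (rule chain_bnd_exchange[of P Q a0 b0 p q "transp y" "transp x"])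
      (use off sub block bnd in \<open>auto simp: chain_bnd_transp\<close>)
  then show ?thesis by (simp add: chain_bnd_transp)
qed

lemma chain_bnd_shift_aux:
  assumes "chain_bnd x ({a+s..b+s} \<times> {c+s'..d+s'}) t"
  shows "chain_bnd (\<lambda>(i, j). x (i + s, j + s')) ({a..b} \<times> {c..d}) t"
proof -
  define h :: "box \<Rightarrow> box" where "h = (\<lambda>(i, j). (i + s, j + s'))"
  have "chain_bnd x (h ` ({a..b} \<times> {c..d})) t"
    by (rule chain_bnd_subset[OF assms]) (auto simp: h_def)
  moreover have "inj_on h ({a..b} \<times> {c..d})" by (auto simp: h_def inj_on_def)
  moreover have "u \<le> v \<Longrightarrow> h u \<le> h v \<or> h v \<le> h u" for u v
    by (auto simp: h_def less_eq_prod_def split: prod.splits)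
  ultimately have "chain_bnd (\<lambda>v. x (h v)) ({a..b} \<times> {c..d}) t"
    by (rule chain_bnd_reindex[of h _ x, rotated 2])
  then show ?thesis by (simp add: h_def case_prod_unfold)
qed

lemma chain_bnd_shift:
  "chain_bnd (\<lambda>(i, j). x (i + s, j + s')) ({a..b} \<times> {c..d}) t \<longleftrightarrow>
   chain_bnd x ({a+s..b+s} \<times> {c+s'..d+s'}) t"
  using chain_bnd_shift_aux[of x a s b c s' d t]
    chain_bnd_shift_aux[of "\<lambda>(i, j). x (i + s, j + s')" "a+s" "-s" "b+s" "c+s'" "-s'" "d+s'" t]
  by auto

section \<open>Counting bounded fillings, and symmetries of the count\<close>

definition bounded_fillings :: "box set \<Rightarrow> nat \<Rightarrow> (box \<Rightarrow> nat) set" where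
  "bounded_fillings M k = {x \<in> fillings M. \<forall>p q c d. {p..q} \<times> {c..d} \<subseteq> M \<longrightarrow>
     chain_bnd (\<lambda>v. int (x v)) ({p..q} \<times> {c..d}) (int k)}"

lemma max_chain_weight_le_iff:
  assumes "finite M"
  shows "max_chain_weight M x \<le> k \<longleftrightarrow> (\<forall>C. weak_ne_chain M C \<longrightarrow> (\<Sum>v\<in>C. x v) \<le> k)"
proof -
  have sub: "C \<subseteq> M" if "weak_ne_chain M C" for C
    using that unfolding weak_ne_chain_def by (meson order_trans)
  have "{\<Sum>v\<in>C. x v | C. weak_ne_chain M C} \<subseteq> sum x ` Pow M" using sub by blast
  then have fin: "finite {\<Sum>v\<in>C. x v | C. weak_ne_chain M C}"
    by (rule finite_subset) (simp add: assms)
  have "weak_ne_chain M {}"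
    unfolding weak_ne_chain_def
    by (rule exI[of _ 1], rule exI[of _ 0], rule exI[of _ 0], rule exI[of _ 0])
      (simp add: Complete_Partial_Order.chain_def)
  then have "{\<Sum>v\<in>C. x v | C. weak_ne_chain M C} \<noteq> {}" by blast
  then show ?thesis unfolding max_chain_weight_def using fin by (auto simp: Max_le_iff)
qed

lemma bounded_fillings_eq:
  assumes "finite M"
  shows "{x \<in> fillings M. max_chain_weight M x \<le> k} = bounded_fillings M k"
proof -
  have "(\<forall>C. weak_ne_chain M C \<longrightarrow> (\<Sum>v\<in>C. x v) \<le> k) \<longleftrightarrow>
     (\<forall>p q c d. {p..q} \<times> {c..d} \<subseteq> M \<longrightarrow> chain_bnd (\<lambda>v. int (x v)) ({p..q} \<times> {c..d}) (int k))" for x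
  proof (intro iffI allI impI)
    fix p q c d :: int
    assume H: "\<forall>C. weak_ne_chain M C \<longrightarrow> (\<Sum>v\<in>C. x v) \<le> k" and sub: "{p..q} \<times> {c..d} \<subseteq> M"
    show "chain_bnd (\<lambda>v. int (x v)) ({p..q} \<times> {c..d}) (int k)"
      unfolding chain_bnd_def of_nat_sum[symmetric] of_nat_le_iff
    proof (intro allI impI)
      fix C assume "C \<subseteq> {p..q} \<times> {c..d} \<and> finite C \<and> Complete_Partial_Order.chain (\<le>) C"
      then have "weak_ne_chain M C" unfolding weak_ne_chain_def using sub by blast
      then show "(\<Sum>v\<in>C. x v) \<le> k" using H by blast
    qed
  next
    fix C
    assume H: "\<forall>p q c d. {p..q} \<times> {c..d} \<subseteq> M \<longrightarrow>
      chain_bnd (\<lambda>v. int (x v)) ({p..q} \<times> {c..d}) (int k)" and "weak_ne_chain M C"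
    then obtain p q c d where R: "{p..q} \<times> {c..d} \<subseteq> M" "C \<subseteq> {p..q} \<times> {c..d}"
      and C: "Complete_Partial_Order.chain (\<le>) C" unfolding weak_ne_chain_def by blast
    have "finite C" using R(2) by (rule finite_subset) simp
    then have "(\<Sum>v\<in>C. int (x v)) \<le> int k" using H R C unfolding chain_bnd_def by blast
    then show "(\<Sum>v\<in>C. x v) \<le> k" unfolding of_nat_sum[symmetric] of_nat_le_iff .
  qed
  then show ?thesis by (simp add: bounded_fillings_def max_chain_weight_le_iff[OF assms])
qed

lemma finite_bounded_fillings:
  assumes "finite M"
  shows "finite (bounded_fillings M k)"
proof -
  have "bounded_fillings M k \<subseteq> M \<rightarrow>\<^sub>E {..k}"
  proof
    fix x assume x: "x \<in> bounded_fillings M k"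
    have "x (i, j) \<le> k" if "(i, j) \<in> M" for i j
    proof -
      have "{i..i} \<times> {j..j} \<subseteq> M" using that by auto
      then have "chain_bnd (\<lambda>v. int (x v)) ({i..i} \<times> {j..j}) (int k)"
        using x unfolding bounded_fillings_def by blast
      from this[unfolded chain_bnd_def, rule_format, of "{(i, j)}"]
      have "(\<Sum>v\<in>{(i, j)}. int (x v)) \<le> int k"
        by (simp add: Complete_Partial_Order.chain_def)
      then show ?thesis by simp
    qed
    then show "x \<in> M \<rightarrow>\<^sub>E {..k}"
      using x by (auto simp: bounded_fillings_def fillings_def PiE_iff)
  qed
  then show ?thesis using assms by (meson finite_PiE finite_atMost finite_subset)
qed

definition num_fillings :: "box set \<Rightarrow> nat \<Rightarrow> nat" where
  "num_fillings M k = card (bounded_fillings M k)"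

text \<open>Pulling back along \<open>h\<close> gives one inequality; \<open>neg\<close>,
  \<open>prod.swap\<close> and \<open>shift\<close> turn it into an equality by applying it to the
  inverse map as well.\<close>

lemma num_fillings_image_le:
  assumes fin: "finite M" and inj: "inj h"
    and comp: "\<And>u v. u \<le> v \<Longrightarrow> h u \<le> h v \<or> h v \<le> (h u :: box)"
    and rect: "\<And>p q c d. \<exists>p' q' c' d'. h ` ({p..q} \<times> {c..d}) = {p'..q'} \<times> {c'..d'}"
  shows "num_fillings (h ` M) k \<le> num_fillings M k"
  unfolding num_fillings_def
proof (rule card_inj_on_le)
  show "finite (bounded_fillings M k)" using fin by (rule finite_bounded_fillings)
  show "inj_on (\<lambda>x. \<lambda>v\<in>M. x (h v)) (bounded_fillings (h ` M) k)"
  proof (rule inj_onI)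
    fix x y assume x: "x \<in> bounded_fillings (h ` M) k" and y: "y \<in> bounded_fillings (h ` M) k"
      and eq: "(\<lambda>v\<in>M. x (h v)) = (\<lambda>v\<in>M. y (h v))"
    have "x (h v) = y (h v)" if "v \<in> M" for v using fun_cong[OF eq, of v] that by simp
    moreover have "x \<in> h ` M \<rightarrow>\<^sub>E UNIV" "y \<in> h ` M \<rightarrow>\<^sub>E UNIV"
      using x y by (auto simp: bounded_fillings_def fillings_def)
    ultimately show "x = y" by (intro PiE_ext) auto
  qed
  show "(\<lambda>x. \<lambda>v\<in>M. x (h v)) ` bounded_fillings (h ` M) k \<subseteq> bounded_fillings M k"
  proof
    fix y assume "y \<in> (\<lambda>x. \<lambda>v\<in>M. x (h v)) ` bounded_fillings (h ` M) k"
    then obtain x where x: "x \<in> bounded_fillings (h ` M) k" and y: "y = (\<lambda>v\<in>M. x (h v))" by blast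
    have "chain_bnd (\<lambda>v. int (y v)) ({p..q} \<times> {c..d}) (int k)" if sub: "{p..q} \<times> {c..d} \<subseteq> M" for p q c d
    proof -
      obtain p' q' c' d' where R: "h ` ({p..q} \<times> {c..d}) = {p'..q'} \<times> {c'..d'}" using rect by blast
      then have "{p'..q'} \<times> {c'..d'} \<subseteq> h ` M" using sub by (metis image_mono)
      then have "chain_bnd (\<lambda>v. int (x v)) (h ` ({p..q} \<times> {c..d})) (int k)"
        using x R unfolding bounded_fillings_def by auto
      then have "chain_bnd (\<lambda>v. int (x (h v))) ({p..q} \<times> {c..d}) (int k)"
        using comp inj by (intro chain_bnd_reindex[of h _ "\<lambda>v. int (x v)"]) (auto intro: inj_on_subset)
      then show ?thesis
        using sub by (subst chain_bnd_cong[where y = "\<lambda>v. int (x (h v))"]) (auto simp: y)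
    qed
    moreover have "y \<in> fillings M" by (simp add: y fillings_def)
    ultimately show "y \<in> bounded_fillings M k" by (simp add: bounded_fillings_def)
  qed
qed

definition neg :: "box \<Rightarrow> box" where
  "neg = (\<lambda>(i, j). (- i, - j))"

lemma mem_neg: "(i, j) \<in> neg ` M \<longleftrightarrow> (- i, - j) \<in> M"
proof
  assume "(- i, - j) \<in> M"
  then show "(i, j) \<in> neg ` M" by (intro image_eqI[of _ _ "(- i, - j)"]) (simp add: neg_def)
qed (auto simp: neg_def)

lemma neg_neg: "neg ` neg ` M = M"
  by (simp add: set_eq_iff mem_neg)

definition shift :: "int \<Rightarrow> int \<Rightarrow> box \<Rightarrow> box" where
  "shift s t = (\<lambda>(i, j). (i + s, j + t))"

lemma num_fillings_neg:
  assumes "finite M"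
  shows "num_fillings (neg ` M) k = num_fillings M k"
proof -
  have le: "num_fillings (neg ` N) k \<le> num_fillings N k" if "finite N" for N
  proof (rule num_fillings_image_le[OF that])
    fix p q c d :: int
    have "neg ` ({p..q} \<times> {c..d}) = {-q..-p} \<times> {-d..-c}"
      by (simp add: set_eq_iff mem_neg) auto
    then show "\<exists>p' q' c' d'. neg ` ({p..q} \<times> {c..d}) = {p'..q'} \<times> {c'..d'}" by blast
  qed (auto simp: neg_def inj_def less_eq_prod_def split: prod.splits)
  show ?thesis using le[OF assms] le[of "neg ` M"] assms by (simp add: neg_neg)
qed

lemma num_fillings_swap:
  assumes "finite M"
  shows "num_fillings (prod.swap ` M) k = num_fillings M k"
proof -
  have le: "num_fillings (prod.swap ` N) k \<le> num_fillings N k" if "finite N" for N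
    by (rule num_fillings_image_le[OF that])
      (auto simp: product_swap less_eq_prod_def intro!: exI)
  have "prod.swap ` prod.swap ` M = M" by (force simp: image_image)
  then show ?thesis using le[OF assms] le[of "prod.swap ` M"] assms by simp
qed

lemma num_fillings_shift:
  assumes "finite M"
  shows "num_fillings (shift s t ` M) k = num_fillings M k"
proof -
  have le: "num_fillings (shift s t ` N) k \<le> num_fillings N k" if "finite N" for N s t
  proof (rule num_fillings_image_le[OF that])
    fix p q c d :: int
    have "shift s t ` ({p..q} \<times> {c..d}) = {p+s..q+s} \<times> {c+t..d+t}"
    proof (intro equalityI subsetI)
      fix v assume "v \<in> {p+s..q+s} \<times> {c+t..d+t}"
      then show "v \<in> shift s t ` ({p..q} \<times> {c..d})"
        by (intro image_eqI[of _ _ "(fst v - s, snd v - t)"]) (auto simp: shift_def mem_Times_iff)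
    qed (auto simp: shift_def)
    then show "\<exists>p' q' c' d'. shift s t ` ({p..q} \<times> {c..d}) = {p'..q'} \<times> {c'..d'}" by blast
  qed (auto simp: shift_def inj_def less_eq_prod_def split: prod.splits)
  have "shift (-s) (-t) ` shift s t ` M = M" by (force simp: shift_def image_image)
  then show ?thesis using le[OF assms, of s t] le[of "shift s t ` M" "-s" "-t"] assms by simp
qed

section \<open>Rows and columns of moon polyominoes\<close>

abbreviation col :: "box set \<Rightarrow> int \<Rightarrow> int set" where
  "col M i \<equiv> {j. (i, j) \<in> M}"

abbreviation row :: "box set \<Rightarrow> int \<Rightarrow> int set" where
  "row M j \<equiv> {i. (i, j) \<in> M}"

lemma moonI:
  assumes "finite M" "\<And>i. int_connected (col M i)" "\<And>j. int_connected (row M j)"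
    "\<And>i i'. col M i \<subseteq> col M i' \<or> col M i' \<subseteq> col M i"
  shows "moon_polyomino M"
  using assms by (simp add: moon_polyomino_def convex_polyomino_def polyomino_def intersection_free_def)

lemma moonD:
  assumes "moon_polyomino M"
  shows "finite M" "int_connected (col M i)" "int_connected (row M j)"
    "col M i \<subseteq> col M i' \<or> col M i' \<subseteq> col M i"
  using assms by (auto simp: moon_polyomino_def convex_polyomino_def polyomino_def intersection_free_def)

lemma moon_row_between:
  "moon_polyomino M \<Longrightarrow> (a, j) \<in> M \<Longrightarrow> (b, j) \<in> M \<Longrightarrow> a \<le> i \<Longrightarrow> i \<le> b \<Longrightarrow> (i, j) \<in> M"
  using moonD(3)[of M j] unfolding int_connected_def by fastforce

lemma moon_col_between:
  "moon_polyomino M \<Longrightarrow> (i, a) \<in> M \<Longrightarrow> (i, b) \<in> M \<Longrightarrow> a \<le> j \<Longrightarrow> j \<le> b \<Longrightarrow> (i, j) \<in> M"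
  using moonD(2)[of M i] unfolding int_connected_def by fastforce

lemma moon_swap:
  assumes "moon_polyomino M"
  shows "moon_polyomino (prod.swap ` M)"
proof (rule moonI)
  have mem: "(i, j) \<in> prod.swap ` M \<longleftrightarrow> (j, i) \<in> M" for i j by (force simp: image_iff)
  show "finite (prod.swap ` M)" using moonD(1)[OF assms] by simp
  show "int_connected (col (prod.swap ` M) i)" for i using moonD(3)[OF assms] by (simp add: mem)
  show "int_connected (row (prod.swap ` M) j)" for j using moonD(2)[OF assms] by (simp add: mem)
  show "col (prod.swap ` M) i \<subseteq> col (prod.swap ` M) i' \<or> col (prod.swap ` M) i' \<subseteq> col (prod.swap ` M) i" for i i'
  proof (rule ccontr)
    assume "\<not> ?thesis"
    \<comment> \<open>Two incomparable rows provide columns \<open>a\<close> and \<open>b\<close>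
      each of which has a box in a row where the other has none.\<close>
    then obtain a b where "(a, i) \<in> M" "(a, i') \<notin> M" "(b, i') \<in> M" "(b, i) \<notin> M" by (auto simp: mem)
    then show False using moonD(4)[OF assms, of a b] by blast
  qed
qed

lemma moon_neg:
  assumes "moon_polyomino M"
  shows "moon_polyomino (neg ` M)"
proof (rule moonI)
  show "finite (neg ` M)" using moonD(1)[OF assms] by simp
  show "int_connected (col (neg ` M) i)" for i
    unfolding int_connected_def
  proof (intro ballI subsetI)
    fix a b j assume "a \<in> col (neg ` M) i" "b \<in> col (neg ` M) i" "j \<in> {a..b}"
    then show "j \<in> col (neg ` M) i"
      using moon_col_between[OF assms, of "-i" "-b" "-a" "-j"] by (simp add: mem_neg)
  qed
  show "int_connected (row (neg ` M) j)" for j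
    unfolding int_connected_def
  proof (intro ballI subsetI)
    fix a b i assume "a \<in> row (neg ` M) j" "b \<in> row (neg ` M) j" "i \<in> {a..b}"
    then show "i \<in> row (neg ` M) j"
      using moon_row_between[OF assms, of "-b" "-j" "-a" "-i"] by (simp add: mem_neg)
  qed
  show "col (neg ` M) i \<subseteq> col (neg ` M) i' \<or> col (neg ` M) i' \<subseteq> col (neg ` M) i" for i i'
    using moonD(4)[OF assms, of "-i" "-i'"] by (auto simp: mem_neg)
qed

section \<open>Cyclic moves of columns\<close>

definition rot_index :: "int \<Rightarrow> int \<Rightarrow> int \<Rightarrow> int" where
  "rot_index l r i = (if i = r then l else if l \<le> i \<and> i < r then i + 1 else i)"

definition cycle :: "int \<Rightarrow> int \<Rightarrow> box set \<Rightarrow> box set" where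
  "cycle l r M = {(i, j). (rot_index l r i, j) \<in> M}"

text \<open>In a moon polyomino this says: a row meeting column \<open>l\<close> contains all of
  \<open>l..r\<close>, and a row missing it lies in columns \<open>l + 1..r\<close>. The move leaves
  rows of the first kind unchanged and translates those of the second kind by one to the left, so
  convexity survives.\<close>

definition movable :: "int \<Rightarrow> int \<Rightarrow> box set \<Rightarrow> bool" where
  "movable l r M \<longleftrightarrow> l \<le> r \<and> col M l \<noteq> {} \<and> (\<forall>i\<in>{l..r}. col M l \<subseteq> col M i) \<and>
     (\<forall>i. col M l \<subset> col M i \<longrightarrow> l < i \<and> i \<le> r)"

lemma mem_cycle [simp]: "(i, j) \<in> cycle l r M \<longleftrightarrow> (rot_index l r i, j) \<in> M"
  by (simp add: cycle_def)

lemma bij_rot_index: "l \<le> r \<Longrightarrow> bij (rot_index l r)"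
  by (rule bij_betw_byWitness[where f' = "\<lambda>i. if i = l then r else if l < i \<and> i \<le> r then i - 1 else i"])
    (auto simp: rot_index_def)

lemma finite_int_connected:
  assumes "finite S" "int_connected S" "S \<noteq> {}"
  shows "S = {Min S..Max S}" "Min S \<le> Max S"
proof -
  have "Min S \<in> S" "Max S \<in> S" using assms by auto
  then have "{Min S..Max S} \<subseteq> S" using assms(2) unfolding int_connected_def by blast
  then show "S = {Min S..Max S}" using assms by auto
  show "Min S \<le> Max S" using assms by simp
qed

lemma finite_col: "finite M \<Longrightarrow> finite (col M i)"
  by (rule finite_subset[of _ "snd ` M"]) (force, simp)

lemma finite_row: "finite M \<Longrightarrow> finite (row M i)"
  by (rule finite_subset[of _ "fst ` M"]) (force, simp)

lemma movable_outside:
  assumes "moon_polyomino M" "movable l r M" "(i, j) \<in> M" "(l, j) \<notin> M"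
  shows "l < i" "i \<le> r"
proof -
  have "col M l \<subset> col M i" using moonD(4)[OF assms(1), of l i] assms(3,4) by auto
  then show "l < i" "i \<le> r" using assms(2) by (auto simp: movable_def)
qed

lemma rot_index_range: "l \<le> r \<Longrightarrow> rot_index l r i \<in> {l..r} \<longleftrightarrow> i \<in> {l..r}"
  by (auto simp: rot_index_def)

lemma rot_index_outside: "l \<le> r \<Longrightarrow> i \<notin> {l..r} \<Longrightarrow> rot_index l r i = i"
  by (auto simp: rot_index_def)

lemma cycle_row_inside:
  assumes "movable l r M" "(l, j) \<in> M"
  shows "row (cycle l r M) j = row M j"
proof -
  have full: "(i, j) \<in> M" if "i \<in> {l..r}" for i
    using assms that by (auto simp: movable_def)
  have lr: "l \<le> r" using assms by (simp add: movable_def)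
  have "(rot_index l r i, j) \<in> M \<longleftrightarrow> (i, j) \<in> M" for i
    using full[of i] full[of "rot_index l r i"] rot_index_range[OF lr, of i] rot_index_outside[OF lr, of i]
    by (cases "i \<in> {l..r}") auto
  then show ?thesis by simp
qed

lemma cycle_row_outside:
  assumes "moon_polyomino M" "movable l r M" "(l, j) \<notin> M" "(i, j) \<in> cycle l r M"
  shows "l \<le> i" "i < r" "(i + 1, j) \<in> M"
proof -
  have "l < rot_index l r i" "rot_index l r i \<le> r" and m: "(rot_index l r i, j) \<in> M"
    using movable_outside[OF assms(1,2) _ assms(3), of "rot_index l r i"] assms(4) by auto
  then show "l \<le> i" "i < r" by (auto simp: rot_index_def split: if_splits)
  then show "(i + 1, j) \<in> M" using m by (auto simp: rot_index_def split: if_splits)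
qed

lemma cycle_eq_image:
  assumes "l \<le> r"
  shows "M = (\<lambda>(i, j). (rot_index l r i, j)) ` cycle l r M"
proof (intro equalityI subsetI)
  fix v assume v: "v \<in> M"
  obtain i where "rot_index l r i = fst v"
    using bij_is_surj[OF bij_rot_index[OF assms]] by (metis surjD)
  then show "v \<in> (\<lambda>(i, j). (rot_index l r i, j)) ` cycle l r M"
    using v by (intro image_eqI[of _ _ "(i, snd v)"]) auto
qed auto

lemma moon_cycle:
  assumes moon: "moon_polyomino M" and mov: "movable l r M"
  shows "moon_polyomino (cycle l r M)"
proof (rule moonI)
  have lr: "l \<le> r" using mov by (simp add: movable_def)
  have "inj (\<lambda>(i, j). (rot_index l r i, j :: int))"
    using bij_is_inj[OF bij_rot_index[OF lr]] by (auto simp: inj_def)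
  then show "finite (cycle l r M)"
    using moonD(1)[OF moon] cycle_eq_image[OF lr, of M] finite_imageD by (metis inj_on_subset subset_UNIV)
  show "int_connected (col (cycle l r M) i)" for i using moonD(2)[OF moon] by simp
  show "col (cycle l r M) i \<subseteq> col (cycle l r M) i' \<or> col (cycle l r M) i' \<subseteq> col (cycle l r M) i" for i i'
    using moonD(4)[OF moon] by simp
  show "int_connected (row (cycle l r M) j)" for j
  proof (cases "(l, j) \<in> M")
    case True
    then show ?thesis using cycle_row_inside[OF mov True] moonD(3)[OF moon] by simp
  next
    case False
    show ?thesis unfolding int_connected_def
    proof (intro ballI subsetI)
      fix a b i assume a: "a \<in> row (cycle l r M) j" and b: "b \<in> row (cycle l r M) j" and i: "i \<in> {a..b}"
      have "(a + 1, j) \<in> M" "(b + 1, j) \<in> M" "l \<le> a" "b < r"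
        using cycle_row_outside[OF moon mov False] a b by auto
      then have "(i + 1, j) \<in> M" "l \<le> i" "i < r"
        using moon_row_between[OF moon, of "a + 1" j "b + 1" "i + 1"] i by auto
      then show "i \<in> row (cycle l r M) j" by (simp add: rot_index_def)
    qed
  qed
qed

lemma cycle_neg:
  "l \<le> r \<Longrightarrow> cycle (-r) (-l) (neg ` cycle l r M) = neg ` M"
proof -
  assume lr: "l \<le> r"
  have "rot_index l r (- rot_index (-r) (-l) i) = - i" for i
    using lr by (auto simp: rot_index_def)
  then show ?thesis by (simp add: set_eq_iff mem_neg)
qed

text \<open>Rotating the plane turns the inverse cycle, which takes column \<open>r\<close> back to
  \<open>l\<close>, into a forward one; so an inequality proved for forward moves yields
  equality.\<close>

lemma movable_neg:
  assumes "moon_polyomino M" and mov: "movable l r M"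
  shows "movable (-r) (-l) (neg ` cycle l r M)"
proof -
  have lr: "l \<le> r" using mov by (simp add: movable_def)
  have colr: "(-r, j) \<in> neg ` cycle l r M \<longleftrightarrow> (l, - j) \<in> M" for j
    by (simp add: mem_neg rot_index_def)
  obtain j0 where "(l, j0) \<in> M" using mov by (auto simp: movable_def)
  then have "(-r, -j0) \<in> neg ` cycle l r M" by (simp add: colr)
  then have ne: "col (neg ` cycle l r M) (-r) \<noteq> {}" by blast
  have full: "(i, j) \<in> neg ` cycle l r M"
    if "i \<in> {-r..-l}" "(-r, j) \<in> neg ` cycle l r M" for i j
  proof -
    have "(l, -j) \<in> M" using that colr by simp
    then have "-i \<in> row (cycle l r M) (-j) \<longleftrightarrow> (-i, -j) \<in> M" using cycle_row_inside[OF mov] by blast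
    moreover have "(-i, -j) \<in> M" using mov that(1) \<open>(l, -j) \<in> M\<close> by (auto simp: movable_def)
    ultimately show ?thesis by (simp add: mem_neg)
  qed
  have out: "-r < i \<and> i \<le> -l"
    if "(i, j) \<in> neg ` cycle l r M" "(-r, j) \<notin> neg ` cycle l r M" for i j
  proof -
    have "(l, - j) \<notin> M" using that(2) colr by blast
    moreover have "(- i, - j) \<in> cycle l r M" using that(1) by (simp only: mem_neg)
    ultimately show ?thesis using cycle_row_outside[OF assms, of "-j" "-i"] by linarith
  qed
  show ?thesis unfolding movable_def
  proof (intro conjI ballI allI impI)
    show "-r \<le> -l" using lr by simp
    show "col (neg ` cycle l r M) (-r) \<noteq> {}" by (rule ne)
    show "col (neg ` cycle l r M) (-r) \<subseteq> col (neg ` cycle l r M) i" if "i \<in> {-r..-l}" for i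
      using full[OF that] by blast
    fix i assume "col (neg ` cycle l r M) (-r) \<subset> col (neg ` cycle l r M) i"
    then obtain j where "(i, j) \<in> neg ` cycle l r M" "(-r, j) \<notin> neg ` cycle l r M" by blast
    then show "-r < i" "i \<le> -l" using out by blast+
  qed
qed

text \<open>Rectangles of the new shape within the rows \<open>j1..j2\<close> are widened to cover
  \<open>l..r\<close>; all others lie in columns \<open>l..r - 1\<close> and are heightened to cover
  \<open>j1..j2\<close>. After that the block inside is a full-width or full-height part of
  \<open>Rect\<close>, where \<open>column_cycle\<close> applies.\<close>

lemma num_fillings_cycle_le:
  assumes moon: "moon_polyomino M" and mov: "movable l r M"
  shows "num_fillings M k \<le> num_fillings (cycle l r M) k"
proof -
  define M' where "M' = cycle l r M"
  have lr: "l \<le> r" using mov by (simp add: movable_def)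
  have moon': "moon_polyomino M'" unfolding M'_def by (rule moon_cycle[OF moon mov])
  have finM': "finite M'" by (rule moonD(1)[OF moon'])
  define I where "I = col M l"
  define j1 where "j1 = Min I"
  define j2 where "j2 = Max I"
  have "finite I" "int_connected I" "I \<noteq> {}"
    using finite_col moonD[OF moon] mov by (auto simp: I_def movable_def)
  then have I: "I = {j1..j2}" and j12: "j1 \<le> j2"
    using finite_int_connected unfolding j1_def j2_def by blast+
  have memI: "(l, j) \<in> M \<longleftrightarrow> j1 \<le> j \<and> j \<le> j2" for j
    using I by (auto simp: I_def)
  have full: "(i, j) \<in> M" if "l \<le> i" "i \<le> r" "j1 \<le> j" "j \<le> j2" for i j
    using mov that memI[of j] by (auto simp: movable_def)
  have row_in: "(i, j) \<in> M' \<longleftrightarrow> (i, j) \<in> M" if "j1 \<le> j" "j \<le> j2" for i j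
    using cycle_row_inside[OF mov, of j] memI that unfolding M'_def by blast
  have row_out: "l \<le> i" "i < r" "(i + 1, j) \<in> M" if "(i, j) \<in> M'" "\<not> (j1 \<le> j \<and> j \<le> j2)" for i j
    using cycle_row_outside[OF moon mov, of j i] memI that unfolding M'_def by blast+
  define Rect where "Rect = {l..r} \<times> {j1..j2}"
  interpret W: window l r j1 j2 .
  obtain F where injF: "inj_on F W.X" and F_in: "\<And>x. x \<in> W.X \<Longrightarrow> F x \<in> W.X"
    and F_rows: "\<And>x a b t. x \<in> W.X \<Longrightarrow> j1 \<le> a \<Longrightarrow> b \<le> j2 \<Longrightarrow>
        chain_bnd (F x) ({l..r} \<times> {a..b}) t = chain_bnd x ({l..r} \<times> {a..b}) t"
    and F_cols: "\<And>x a b t. x \<in> W.X \<Longrightarrow> l \<le> a \<Longrightarrow> b < r \<Longrightarrow>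
        chain_bnd (F x) ({a..b} \<times> {j1..j2}) t = chain_bnd x ({a+1..b+1} \<times> {j1..j2}) t"
  proof -
    obtain F where F: "inj_on F W.X" "\<forall>x\<in>W.X. F x \<in> W.X \<and>
     (\<forall>a b t. j1 \<le> a \<longrightarrow> b \<le> j2 \<longrightarrow>
        chain_bnd (F x) ({l..r} \<times> {a..b}) t = chain_bnd x ({l..r} \<times> {a..b}) t) \<and>
     (\<forall>a b t. l \<le> a \<longrightarrow> b < r \<longrightarrow>
        chain_bnd (F x) ({a..b} \<times> {j1..j2}) t = chain_bnd x ({a+1..b+1} \<times> {j1..j2}) t)"
      using column_cycle[of l r j1 j2] by (elim exE conjE)
    show thesis by (rule that[of F]) (use F in simp_all)
  qed
  define ext :: "(box \<Rightarrow> nat) \<Rightarrow> box \<Rightarrow> int" where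
    "ext x = (\<lambda>v. if v \<in> Rect then int (x v) else 0)" for x
  have ext_in: "ext x \<in> W.X" for x by (simp add: W.X_def ext_def Rect_def)
  \<comment> \<open>Inside the full rectangle the filling is changed by \<open>F\<close>; every
    other box keeps its label and travels with its column.\<close>
  define \<Phi> :: "(box \<Rightarrow> nat) \<Rightarrow> box \<Rightarrow> nat" where
    "\<Phi> x = (\<lambda>(i, j)\<in>M'. if (i, j) \<in> Rect then nat (F (ext x) (i, j)) else x (rot_index l r i, j))" for x
  have RectM': "Rect \<subseteq> M'" using row_in full by (auto simp: Rect_def)
  have \<Phi>_Rect: "int (\<Phi> x v) = F (ext x) v" if "v \<in> Rect" for x v
    using RectM' that W.X_nonneg[OF F_in[OF ext_in[of x]], of v]
    by (auto simp: \<Phi>_def split: prod.splits)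
  have \<Phi>_off: "\<Phi> x (i, j) = x (rot_index l r i, j)" if "(i, j) \<in> M'" "(i, j) \<notin> Rect" for x i j
    using that by (simp add: \<Phi>_def)
  show ?thesis
    unfolding num_fillings_def M'_def[symmetric]
  proof (rule card_inj_on_le)
    show "finite (bounded_fillings M' k)" by (rule finite_bounded_fillings[OF finM'])
    show "inj_on \<Phi> (bounded_fillings M k)"
    proof (rule inj_onI)
      fix x y assume x: "x \<in> bounded_fillings M k" and y: "y \<in> bounded_fillings M k" and eq: "\<Phi> x = \<Phi> y"
      have "F (ext x) v = F (ext y) v" for v
      proof (cases "v \<in> Rect")
        case True
        then show ?thesis using \<Phi>_Rect[of v x] \<Phi>_Rect[of v y] eq by simp
      next
        case False
        then show ?thesis
          using W.X_outside[OF F_in[OF ext_in[of x]], of "fst v" "snd v"]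
            W.X_outside[OF F_in[OF ext_in[of y]], of "fst v" "snd v"]
          by (auto simp: Rect_def mem_Times_iff)
      qed
      then have "ext x = ext y" using injF ext_in by (meson ext inj_onD)
      have "x v = y v" if "v \<in> M" for v
      proof (cases "v \<in> Rect")
        case True
        then show ?thesis using fun_cong[OF \<open>ext x = ext y\<close>, of v] by (simp add: ext_def)
      next
        case False
        obtain i where i: "rot_index l r i = fst v"
          using bij_is_surj[OF bij_rot_index[OF lr]] by (metis surjD)
        have "(i, snd v) \<in> M'" using that i by (simp add: M'_def)
        moreover have "(i, snd v) \<notin> Rect"
          using False rot_index_range[OF lr, of i] i by (auto simp: Rect_def mem_Times_iff)
        ultimately show ?thesis
          using \<Phi>_off[of i "snd v" x] \<Phi>_off[of i "snd v" y] i eq by simp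
      qed
      moreover have "x \<in> M \<rightarrow>\<^sub>E UNIV" "y \<in> M \<rightarrow>\<^sub>E UNIV"
        using x y by (auto simp: bounded_fillings_def fillings_def)
      ultimately show "x = y" by (intro PiE_ext) auto
    qed
    show "\<Phi> ` bounded_fillings M k \<subseteq> bounded_fillings M' k"
    proof
      fix y assume "y \<in> \<Phi> ` bounded_fillings M k"
      then obtain x where x: "x \<in> bounded_fillings M k" and y: "y = \<Phi> x" by blast
      define X where "X = (\<lambda>v. int (x v))"
      define Y where "Y = (\<lambda>v. int (y v))"
      have Xbnd: "chain_bnd X ({p..q} \<times> {c..d}) (int k)" if "{p..q} \<times> {c..d} \<subseteq> M" for p q c d
        using x that unfolding bounded_fillings_def X_def by blast
      have Xext: "chain_bnd X R t \<longleftrightarrow> chain_bnd (ext x) R t" if "R \<subseteq> Rect" for R t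
        using that by (intro chain_bnd_cong) (auto simp: X_def ext_def)
      have YF: "chain_bnd Y R t \<longleftrightarrow> chain_bnd (F (ext x)) R t" if "R \<subseteq> Rect" for R t
        using that \<Phi>_Rect by (intro chain_bnd_cong) (auto simp: Y_def y)
      have "chain_bnd Y ({p..q} \<times> {c..d}) (int k)" if sub: "{p..q} \<times> {c..d} \<subseteq> M'" for p q c d
      proof (cases "p \<le> q \<and> c \<le> d")
        case False
        then have empty: "{p..q} \<times> {c..d} = {}" by auto
        have "chain_bnd Y {} (int k)" by (simp add: chain_bnd_def)
        then show ?thesis by (simp only: empty)
      next
        case pqcd: True
        show ?thesis
        proof (cases "j1 \<le> c \<and> d \<le> j2")
          case cd: True
          \<comment> \<open>Each row of the rectangle meets \<open>p\<close>, \<open>q\<close>,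
            \<open>l\<close> and \<open>r\<close>, so by row convexity the widened rectangle still
            lies in \<open>M\<close>.\<close>
          define P where "P = min p l"
          define Q where "Q = max q r"
          have "{P..Q} \<times> {c..d} \<subseteq> M"
          proof
            fix v assume "v \<in> {P..Q} \<times> {c..d}"
            then obtain i j where v: "v = (i, j)" "P \<le> i" "i \<le> Q" "c \<le> j" "j \<le> d" by auto
            have "(p, j) \<in> M" "(q, j) \<in> M" "(l, j) \<in> M" "(r, j) \<in> M"
              using sub pqcd v cd row_in full lr by (auto simp: subset_iff)
            then have "(P, j) \<in> M" "(Q, j) \<in> M" by (auto simp: P_def Q_def min_def max_def)
            then show "v \<in> M" using moon_row_between[OF moon] v by blast
          qed
          then have bX: "chain_bnd X ({P..Q} \<times> {c..d}) (int k)" by (rule Xbnd)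
          have "chain_bnd Y ({P..Q} \<times> {c..d}) (int k)"
          proof (rule chain_bnd_exchange[OF _ _ _ _ bX, where p = l and q = r])
            fix i j assume ij: "i \<in> {P..Q}" "j \<in> {c..d}" "i \<notin> {l..r}"
            have "(i, j) \<in> M" using \<open>{P..Q} \<times> {c..d} \<subseteq> M\<close> ij by blast
            then have "(i, j) \<in> M'" using row_in ij cd by auto
            then have "y (i, j) = x (rot_index l r i, j)"
              using \<Phi>_off[of i j x] ij unfolding y Rect_def by blast
            then show "Y (i, j) \<le> X (i, j)"
              using rot_index_outside[OF lr ij(3)] by (simp add: X_def Y_def)
          next
            fix a b t assume ab: "c \<le> a" "b \<le> d" and t: "chain_bnd X ({l..r} \<times> {a..b}) t"
            have "{l..r} \<times> {a..b} \<subseteq> Rect" using ab cd by (auto simp: Rect_def)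
            then show "chain_bnd Y ({l..r} \<times> {a..b}) t"
              using t Xext YF F_rows[OF ext_in, of a b x t] ab cd by auto
          qed (auto simp: P_def Q_def)
          then show ?thesis by (rule chain_bnd_subset) (auto simp: P_def Q_def)
        next
          case False
          then obtain j0 where j0: "j0 \<in> {c..d}" "\<not> (j1 \<le> j0 \<and> j0 \<le> j2)" using pqcd by auto
          \<comment> \<open>A single row missing column \<open>l\<close> confines the whole
            rectangle to columns before \<open>r\<close>, away from the new place of the moved
            column.\<close>
          have pq: "l \<le> p" "q < r" using row_out[OF _ j0(2)] sub pqcd j0(1) by (auto simp: subset_iff)
          define C where "C = min c j1"
          define D where "D = max d j2"
          have subM: "{p+1..q+1} \<times> {C..D} \<subseteq> M"
          proof
            fix v assume "v \<in> {p+1..q+1} \<times> {C..D}"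
            then obtain i j where v: "v = (i + 1, j)" "p \<le> i" "i \<le> q" "C \<le> j" "j \<le> D"
              by (metis (no_types, lifting) add.commute add_le_cancel_left atLeastAtMost_iff diff_add_cancel mem_Sigma_iff prod.exhaust_sel)
            have i: "rot_index l r i = i + 1" using v pq by (simp add: rot_index_def)
            have "(i, c) \<in> M'" "(i, d) \<in> M'" using sub v pqcd by auto
            then have "(i + 1, c) \<in> M" "(i + 1, d) \<in> M" using i by (simp_all add: M'_def)
            moreover have "(i + 1, j1) \<in> M" "(i + 1, j2) \<in> M" using full v pq j12 by auto
            ultimately have "(i + 1, C) \<in> M" "(i + 1, D) \<in> M" by (auto simp: C_def D_def min_def max_def)
            then show "v \<in> M" using moon_col_between[OF moon] v by blast
          qed
          \<comment> \<open>The old filling is translated one column to the left, so that it can be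
            compared with the new one on the same rectangle.\<close>
          define Xs where "Xs = (\<lambda>(i, j). X (i + 1, j + 0))"
          have Xs: "chain_bnd Xs ({a..b} \<times> {e..f}) t \<longleftrightarrow> chain_bnd X ({a+1..b+1} \<times> {e..f}) t" for a b e f t
            unfolding Xs_def using chain_bnd_shift[of X 1 0 a b e f t] by simp
          have bX: "chain_bnd Xs ({p..q} \<times> {C..D}) (int k)" using Xbnd[OF subM] Xs by simp
          have "chain_bnd Y ({p..q} \<times> {C..D}) (int k)"
          proof (rule chain_bnd_exchange_rows[OF _ _ _ _ bX, where p = j1 and q = j2])
            fix i j assume ij: "i \<in> {p..q}" "j \<in> {C..D}" "j \<notin> {j1..j2}"
            have i: "rot_index l r i = i + 1" using ij pq by (simp add: rot_index_def)
            have "(i + 1, j) \<in> M" using subM ij by auto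
            then have "(i, j) \<in> M'" using i by (simp add: M'_def)
            then have "y (i, j) = x (i + 1, j)"
              using \<Phi>_off[of i j x] ij i unfolding y Rect_def by auto
            then show "Y (i, j) \<le> Xs (i, j)" by (simp add: X_def Y_def Xs_def)
          next
            fix a b t assume ab: "p \<le> a" "b \<le> q" and t: "chain_bnd Xs ({a..b} \<times> {j1..j2}) t"
            have "{a..b} \<times> {j1..j2} \<subseteq> Rect" "{a+1..b+1} \<times> {j1..j2} \<subseteq> Rect"
              using ab pq by (auto simp: Rect_def)
            then show "chain_bnd Y ({a..b} \<times> {j1..j2}) t"
              using t Xext YF F_cols[OF ext_in, of a b x t] ab pq Xs by auto
          qed (auto simp: C_def D_def)
          then show ?thesis by (rule chain_bnd_subset) (auto simp: C_def D_def)
        qed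
      qed
      moreover have "y \<in> fillings M'" by (simp add: y \<Phi>_def fillings_def)
      ultimately show "y \<in> bounded_fillings M' k" by (simp add: bounded_fillings_def Y_def)
    qed
  qed
qed

lemma num_fillings_cycle:
  assumes moon: "moon_polyomino M" and mov: "movable l r M"
  shows "num_fillings (cycle l r M) k = num_fillings M k"
proof (rule antisym)
  have lr: "l \<le> r" using mov by (simp add: movable_def)
  have moon': "moon_polyomino (cycle l r M)" by (rule moon_cycle[OF assms])
  show "num_fillings M k \<le> num_fillings (cycle l r M) k" by (rule num_fillings_cycle_le[OF assms])
  have "num_fillings (neg ` cycle l r M) k \<le> num_fillings (cycle (-r) (-l) (neg ` cycle l r M)) k"
    by (rule num_fillings_cycle_le[OF moon_neg[OF moon'] movable_neg[OF assms]])
  then show "num_fillings (cycle l r M) k \<le> num_fillings M k"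
    using moonD(1)[OF moon] moonD(1)[OF moon'] by (simp add: cycle_neg[OF lr] num_fillings_neg)
qed

subsection \<open>Reduction to Ferrers shapes\<close>

lemma moon_equiv_refl: "moon_equiv M M"
  unfolding moon_equiv_def by (intro exI[of _ id] conjI) auto

lemma moon_equiv_trans:
  assumes "moon_equiv M N" "moon_equiv N K"
  shows "moon_equiv M K"
proof -
  obtain s t where st: "bij s" "bij t" "N = {(s i, t j) | i j. (i, j) \<in> M}"
    using assms(1) unfolding moon_equiv_def by blast
  obtain s' t' where st': "bij s'" "bij t'" "K = {(s' i, t' j) | i j. (i, j) \<in> N}"
    using assms(2) unfolding moon_equiv_def by blast
  have "K = {((s' \<circ> s) i, (t' \<circ> t) j) | i j. (i, j) \<in> M}" unfolding st' st by auto
  then show ?thesis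
    unfolding moon_equiv_def using bij_comp[OF st(1) st'(1)] bij_comp[OF st(2) st'(2)] by blast
qed

lemma mem_swap: "(i, j) \<in> prod.swap ` M \<longleftrightarrow> (j, i) \<in> M"
  by (force simp: image_iff)

lemma moon_equiv_swap:
  assumes "moon_equiv M N"
  shows "moon_equiv (prod.swap ` M) (prod.swap ` N)"
proof -
  obtain s t where st: "bij s" "bij t" "N = {(s i, t j) | i j. (i, j) \<in> M}"
    using assms(1) unfolding moon_equiv_def by blast
  have eq: "(a, b) \<in> prod.swap ` N \<longleftrightarrow> (a, b) \<in> {(t i, s j) | i j. (i, j) \<in> prod.swap ` M}" for a b
    unfolding st(3) mem_swap mem_Collect_eq by auto
  have "prod.swap ` N = {(t i, s j) | i j. (i, j) \<in> prod.swap ` M}"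
  proof (rule set_eqI)
    fix v show "v \<in> prod.swap ` N \<longleftrightarrow> v \<in> {(t i, s j) | i j. (i, j) \<in> prod.swap ` M}"
      using eq[of "fst v" "snd v"] unfolding prod.collapse .
  qed
  then show ?thesis unfolding moon_equiv_def using st by blast
qed

lemma moon_equiv_cycle:
  assumes "l \<le> r"
  shows "moon_equiv M (cycle l r M)"
proof -
  define s where "s = inv (rot_index l r)"
  have b: "bij (rot_index l r)" by (rule bij_rot_index[OF assms])
  have 1: "rot_index l r (s i) = i" for i
    unfolding s_def using bij_is_surj[OF b] by (rule surj_f_inv_f)
  have 2: "s (rot_index l r i) = i" for i
    unfolding s_def using bij_is_inj[OF b] by (rule inv_f_f)
  have "cycle l r M = {(s i, id j) | i j. (i, j) \<in> M}"
  proof (intro equalityI subsetI)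
    fix v assume "v \<in> cycle l r M"
    moreover obtain i j where "v = (i, j)" by fastforce
    ultimately show "v \<in> {(s i, id j) | i j. (i, j) \<in> M}"
      using 2[of i] by (intro CollectI exI[of _ "rot_index l r i"] exI[of _ j]) auto
  qed (auto simp: 1)
  moreover have "bij s" unfolding s_def using b by (rule bij_imp_bij_inv)
  ultimately show ?thesis unfolding moon_equiv_def using bij_id by blast
qed

text \<open>These are the parts of the partition conjugate to the column lengths: an invariant of
  equivalence, and the row lengths of the Ferrers shape.\<close>

definition col_count :: "box set \<Rightarrow> nat \<Rightarrow> nat" where
  "col_count M b = card {i. b < card (col M i)}"

lemma moon_equiv_col_count:
  assumes "moon_equiv M N"
  shows "col_count N = col_count M"
proof
  fix b
  obtain s t where st: "bij s" "bij t" "N = {(s i, t j) | i j. (i, j) \<in> M}"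
    using assms(1) unfolding moon_equiv_def by blast
  have "col N (s i) = t ` col M i" for i
    using bij_is_inj[OF st(1)] unfolding st(3) by (auto dest: injD)
  then have c: "card (col N (s i)) = card (col M i)" for i
    using card_image[OF inj_on_subset[OF bij_is_inj[OF st(2)] subset_UNIV]] by simp
  have "{i. b < card (col N i)} = s ` {i. b < card (col M i)}"
  proof (intro equalityI subsetI)
    fix i assume i: "i \<in> {i. b < card (col N i)}"
    obtain i' where "i = s i'" using bij_is_surj[OF st(1)] by (rule surjE)
    then show "i \<in> s ` {i. b < card (col M i)}" using i c by auto
  qed (auto simp: c)
  then show "col_count N b = col_count M b"
    unfolding col_count_def
    using card_image[OF inj_on_subset[OF bij_is_inj[OF st(1)] subset_UNIV]] by simp
qed

text \<open>Here \<open>r\<close> is the last column strictly containing column \<open>l\<close>.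
  The columns from \<open>l\<close> to \<open>r\<close> then contain column \<open>l\<close> by row
  convexity.\<close>

lemma movable_exists:
  assumes moon: "moon_polyomino M" and l: "col M l \<noteq> {}" "\<not> col M (l + 1) \<subseteq> col M l"
  shows "\<exists>r>l. movable l r M"
proof -
  have strict: "col M l \<subset> col M (l + 1)" using moonD(4)[OF moon, of l "l + 1"] l by blast
  define S where "S = {i. col M l \<subset> col M i}"
  have "S \<subseteq> fst ` M" by (force simp: S_def)
  then have finS: "finite S" using moonD(1)[OF moon] finite_subset by blast
  have lS: "l + 1 \<in> S" using strict by (simp add: S_def)
  define r where "r = Max S"
  have rS: "r \<in> S" and le: "\<And>i. i \<in> S \<Longrightarrow> i \<le> r" using Max_in[OF finS] Max_ge[OF finS] lS unfolding r_def by blast+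
  have gt: "l < i" if i: "i \<in> S" for i
  proof (rule ccontr)
    assume "\<not> l < i"
    moreover have "i \<noteq> l" using i by (auto simp: S_def)
    ultimately have "i < l" by simp
    \<comment> \<open>Columns \<open>i\<close> and \<open>l + 1\<close> are comparable and both
      strictly contain column \<open>l\<close>, so they share a row missing there; since
      \<open>l\<close> lies between them, row convexity is violated.\<close>
    obtain j where "(i, j) \<in> M" "(l + 1, j) \<in> M" "(l, j) \<notin> M"
      using moonD(4)[OF moon, of i "l + 1"] i strict unfolding S_def by blast
    then show False using moon_row_between[OF moon, of i j "l + 1" l] \<open>i < l\<close> by simp
  qed
  have full: "(i, j) \<in> M" if "i \<in> {l..r}" "(l, j) \<in> M" for i j
    using moon_row_between[OF moon, of l j r i] that rS by (auto simp: S_def)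
  have "movable l r M"
    unfolding movable_def
  proof (intro conjI ballI allI impI)
    show "l \<le> r" using gt[OF rS] by simp
    show "col M l \<noteq> {}" by (rule l(1))
    show "col M l \<subseteq> col M i" if "i \<in> {l..r}" for i using full[OF that] by blast
    fix i assume "col M l \<subset> col M i"
    then have "i \<in> S" unfolding S_def by blast
    then show "l < i" "i \<le> r" using gt le by blast+
  qed
  then show ?thesis using gt[OF rS] by blast
qed

text \<open>The boxes of column \<open>l\<close> travel \<open>r - l\<close> to the right, while
  each of the \<open>r - l\<close> other columns has at least as many boxes and travels one to the
  left. Column \<open>l + 1\<close> has strictly more, so the move strictly decreases the sum of
  column indices.\<close>

lemma cycle_moment_less:
  assumes moon: "moon_polyomino M" and mov: "movable l r M" and lr: "l < r"
    and ascent: "\<not> col M (l + 1) \<subseteq> col M l"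
  shows "(\<Sum>v\<in>cycle l r M. fst v) < (\<Sum>v\<in>M. fst v)"
proof -
  define N where "N = cycle l r M"
  define I where "I = col M l"
  have fin: "finite N" unfolding N_def by (rule moonD(1)[OF moon_cycle[OF moon mov]])
  have finI: "finite I" unfolding I_def by (rule finite_col[OF moonD(1)[OF moon]])
  have inj: "inj_on (\<lambda>(i, j). (rot_index l r i, j)) N"
    using bij_is_inj[OF bij_rot_index, of l r] lr by (auto simp: inj_on_def inj_def)
  have "(\<Sum>v\<in>M. fst v) = (\<Sum>v\<in>N. rot_index l r (fst v))"
    using sum.reindex[OF inj, of fst] cycle_eq_image[of l r M] lr
    by (simp add: N_def case_prod_unfold comp_def)
  moreover have "(\<Sum>v\<in>N. rot_index l r (fst v)) = (\<Sum>v\<in>N. fst v)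
     + (\<Sum>v\<in>N. of_bool (l \<le> fst v \<and> fst v < r)) - (\<Sum>v\<in>N. (r - l) * of_bool (fst v = r))"
    unfolding sum.distrib[symmetric] sum_subtractf[symmetric]
    by (intro sum.cong) (auto simp: rot_index_def)
  moreover have "(\<Sum>v\<in>N. (r - l) * of_bool (fst v = r)) = (r - l) * int (card I)"
  proof -
    have "N \<inter> {v. fst v = r} = {r} \<times> I"
      by (auto simp: N_def I_def rot_index_def)
    then have "(\<Sum>v\<in>N. of_bool (fst v = r)) = int (card ({r} \<times> I))"
      using fin by (simp add: of_bool_def sum.If_cases)
    then show ?thesis by (simp add: sum_distrib_left[symmetric] card_cartesian_product)
  qed
  moreover have "(\<Sum>v\<in>N. of_bool (l \<le> fst v \<and> fst v < r)) > (r - l) * int (card I)"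
  proof -
    obtain j where j: "(l + 1, j) \<in> M" "j \<notin> I" using ascent by (auto simp: I_def)
    have full: "(a, b) \<in> M" if "l \<le> a" "a \<le> r" "(l, b) \<in> M" for a b
      using mov that unfolding movable_def by auto
    have "(a, b) \<in> N" if "l \<le> a" "a < r" "b \<in> I" for a b
      using full[of "a + 1" b] that by (simp add: N_def I_def rot_index_def)
    moreover have "(l, j) \<in> N" using j lr by (simp add: N_def rot_index_def)
    ultimately have sub: "insert (l, j) ({l..r-1} \<times> I) \<subseteq> N \<inter> {v. l \<le> fst v \<and> fst v < r}"
      using lr by auto
    have "(l, j) \<notin> {l..r-1} \<times> I" "finite ({l..r-1} \<times> I)" using j finI by simp_all
    then have "int (card (insert (l, j) ({l..r-1} \<times> I))) = (r - l) * int (card I) + 1"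
      using lr by (simp add: card_cartesian_product)
    then have "(r - l) * int (card I) < int (card (N \<inter> {v. l \<le> fst v \<and> fst v < r}))"
      using card_mono[OF _ sub] fin by simp
    then show ?thesis using fin by (simp add: of_bool_def sum.If_cases)
  qed
  ultimately show ?thesis by (simp add: N_def)
qed

text \<open>The moment relative to the lower bound \<open>L\<close> is nonnegative and drops with
  each move. That the columns of \<open>N\<close> are columns of \<open>M\<close> as sets is
  recorded so that sorting the rows later does not destroy the sorting of the columns.\<close>

lemma sort_columns:
  assumes "moon_polyomino M" "fst ` M \<subseteq> {L..}"
  shows "\<exists>N. moon_polyomino N \<and> moon_equiv M N \<and> (\<forall>k. num_fillings N k = num_fillings M k) \<and>
    (\<forall>i. \<exists>i'. col N i = col M i') \<and> (\<forall>i. col N i \<noteq> {} \<longrightarrow> col N (i + 1) \<subseteq> col N i)"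
  using assms
proof (induction "nat (\<Sum>v\<in>M. fst v - L)" arbitrary: M rule: less_induct)
  case less
  note moon = less.prems(1)
  show ?case
  proof (cases "\<forall>i. col M i \<noteq> {} \<longrightarrow> col M (i + 1) \<subseteq> col M i")
    case True
    then show ?thesis using moon moon_equiv_refl by (intro exI[of _ M]) auto
  next
    case False
    then obtain l where l: "col M l \<noteq> {}" "\<not> col M (l + 1) \<subseteq> col M l" by blast
    obtain r where r: "l < r" "movable l r M" using movable_exists[OF moon l] by blast
    define M1 where "M1 = cycle l r M"
    have moon1: "moon_polyomino M1" unfolding M1_def by (rule moon_cycle[OF moon r(2)])
    have L: "fst ` M1 \<subseteq> {L..}"
    proof
      fix i assume "i \<in> fst ` M1"
      then obtain j where "(rot_index l r i, j) \<in> M" by (auto simp: M1_def)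
      then have 1: "L \<le> rot_index l r i" using less.prems(2) by force
      have 2: "L \<le> l" using l less.prems(2) by force
      show "i \<in> {L..}" using 1 2 r(1) by (auto simp: rot_index_def split: if_splits)
    qed
    have "card M1 = card M"
    proof -
      have "inj_on (\<lambda>(i, j). (rot_index l r i, j)) M1"
        using bij_is_inj[OF bij_rot_index, of l r] r by (auto simp: inj_on_def inj_def)
      moreover have "M = (\<lambda>(i, j). (rot_index l r i, j)) ` M1"
        unfolding M1_def by (rule cycle_eq_image) (use r in simp)
      then have "card M = card ((\<lambda>(i, j). (rot_index l r i, j)) ` M1)" by (rule arg_cong)
      ultimately show ?thesis by (simp add: card_image)
    qed
    then have "(\<Sum>v\<in>M1. fst v - L) < (\<Sum>v\<in>M. fst v - L)"
      using cycle_moment_less[OF moon r(2,1) l(2)] by (simp add: sum_subtractf M1_def)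
    moreover have "0 \<le> (\<Sum>v\<in>M1. fst v - L)" using L by (intro sum_nonneg) auto
    ultimately have "nat (\<Sum>v\<in>M1. fst v - L) < nat (\<Sum>v\<in>M. fst v - L)" by simp
    then obtain N where N: "moon_polyomino N" "moon_equiv M1 N" "\<forall>k. num_fillings N k = num_fillings M1 k"
      "\<forall>i. \<exists>i'. col N i = col M1 i'" "\<forall>i. col N i \<noteq> {} \<longrightarrow> col N (i + 1) \<subseteq> col N i"
      using less.hyps[OF _ moon1 L] by blast
    have "moon_equiv M N"
      using moon_equiv_trans[OF moon_equiv_cycle N(2)[unfolded M1_def]] r by simp
    moreover have "\<forall>k. num_fillings N k = num_fillings M k"
      using N(3) num_fillings_cycle[OF moon r(2)] by (simp add: M1_def)
    moreover have "\<forall>i. \<exists>i'. col N i = col M i'"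
      using N(4) by (auto simp: M1_def)
    ultimately show ?thesis using N(1,5) by blast
  qed
qed

lemma sorted_rows:
  assumes moon: "moon_polyomino M" and sorted: "\<And>i. col M i \<noteq> {} \<Longrightarrow> col M (i + 1) \<subseteq> col M i"
  shows "\<exists>i0. \<forall>j. \<exists>n. row M j = {i0..<n}"
proof (cases "M = {}")
  case True
  then show ?thesis by (intro exI[of _ 0] allI exI[of _ 0]) auto
next
  case False
  define i0 where "i0 = Min (fst ` M)"
  have fin: "finite M" by (rule moonD(1)[OF moon])
  have "i0 \<in> fst ` M" using fin False by (simp add: i0_def)
  then have ne: "col M i0 \<noteq> {}" by force
  have ge: "i0 \<le> i" if "(i, j) \<in> M" for i j
    using that fin by (auto simp: i0_def intro!: Min_le) (metis fst_conv image_eqI)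
  have start: "(i0, j) \<in> M" if ij: "(i, j) \<in> M" for i j
  proof (cases "col M i \<subseteq> col M i0")
    case True
    then show ?thesis using ij by auto
  next
    case F: False
    then have sub: "col M i0 \<subseteq> col M i" using moonD(4)[OF moon] by blast
    obtain j' where j': "(i0, j') \<in> M" using ne by auto
    \<comment> \<open>A row containing both \<open>i0\<close> and \<open>i\<close> makes every
      column in between nonempty, so the sorting hypothesis, which says nothing after an empty
      column, can be chained.\<close>
    have "col M a \<subseteq> col M i0" if "i0 \<le> a" "a \<le> i" for a
      using that
    proof (induction a rule: int_ge_induct)
      case (step a)
      have "(a, j') \<in> M" using moon_row_between[OF moon j', of i a] sub j' step by auto
      then show ?case using sorted[of a] step by auto
    qed simp
    then show ?thesis using F ge[OF ij] by blast
  qed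
  have "\<exists>n. row M j = {i0..<n}" for j
  proof (cases "row M j = {}")
    case True
    then show ?thesis by (intro exI[of _ i0]) auto
  next
    case False
    have *: "finite (row M j)" "int_connected (row M j)" using finite_row[OF fin] moonD(3)[OF moon] by auto
    have "Min (row M j) = i0"
      using False * start ge by (intro Min_eqI) auto
    then have "row M j = {i0..<Max (row M j) + 1}"
      using finite_int_connected(1)[OF * False] by auto
    then show ?thesis by blast
  qed
  then show ?thesis by blast
qed

definition ferrers :: "(nat \<Rightarrow> nat) \<Rightarrow> box set" where
  "ferrers n = {(int a, int b) | a b. a < n b}"

text \<open>Columns are sorted, the shape is transposed and sorted again. The resulting rows and
  columns are intervals with fixed starting points \<open>i0\<close> and \<open>j0\<close>, so only
  a translation separates it from the Ferrers shape.\<close>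

lemma moon_normal_form:
  assumes moon: "moon_polyomino M"
  shows "finite (ferrers (col_count M))"
    and "num_fillings M k = num_fillings (ferrers (col_count M)) k"
proof -
  have lower: "\<exists>L. fst ` N \<subseteq> {L..}" if "moon_polyomino N" for N
    using moonD(1)[OF that] by (intro exI[of _ "Min (fst ` N)"] subsetI) simp
  obtain L where L: "fst ` M \<subseteq> {L..}" using lower[OF moon] by blast
  obtain M1 where M1: "moon_polyomino M1" "moon_equiv M M1" "\<forall>k. num_fillings M1 k = num_fillings M k"
    "\<forall>i. col M1 i \<noteq> {} \<longrightarrow> col M1 (i + 1) \<subseteq> col M1 i"
    using sort_columns[OF moon L] by blast
  obtain i0 where i0: "\<And>j. \<exists>n. row M1 j = {i0..<n}" using sorted_rows[OF M1(1)] M1(4) by blast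
  have moonS: "moon_polyomino (prod.swap ` M1)" by (rule moon_swap[OF M1(1)])
  obtain L' where L': "fst ` prod.swap ` M1 \<subseteq> {L'..}" using lower[OF moonS] by blast
  obtain M2 where M2: "moon_polyomino M2" "moon_equiv (prod.swap ` M1) M2"
    "\<forall>k. num_fillings M2 k = num_fillings (prod.swap ` M1) k"
    "\<forall>i. \<exists>i'. col M2 i = col (prod.swap ` M1) i'"
    "\<forall>i. col M2 i \<noteq> {} \<longrightarrow> col M2 (i + 1) \<subseteq> col M2 i"
    using sort_columns[OF moonS L'] by blast
  obtain j0 where j0: "\<And>i. \<exists>n. row M2 i = {j0..<n}" using sorted_rows[OF M2(1)] M2(5) by blast
  \<comment> \<open>The second sorting only rearranges the rows of \<open>M1\<close>, which keep
    their common starting point.\<close>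
  have cols2: "\<exists>n. col M2 j = {i0..<n}" for j
  proof -
    obtain j' where "col M2 j = row M1 j'" using M2(4) unfolding mem_swap by blast
    then show ?thesis using i0[of j'] by simp
  qed
  define N where "N = prod.swap ` M2"
  have rowN: "\<exists>n. row N j = {i0..<n}" for j using cols2[of j] by (simp add: N_def mem_swap)
  have colN: "\<exists>n. col N i = {j0..<n}" for i using j0[of i] by (simp add: N_def mem_swap)
  have finN: "finite N" using moonD(1)[OF M2(1)] by (simp add: N_def)
  have "moon_equiv (prod.swap ` prod.swap ` M1) N"
    unfolding N_def by (rule moon_equiv_swap[OF M2(2)])
  moreover have "prod.swap ` prod.swap ` M1 = M1" by (simp add: set_eq_iff mem_swap)
  ultimately have "moon_equiv M N" using moon_equiv_trans[OF M1(2)] by simp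
  then have cc: "col_count N = col_count M" by (rule moon_equiv_col_count)
  have numN: "num_fillings N k = num_fillings M k" for k
    using num_fillings_swap[OF moonD(1)[OF M2(1)]] M2(3) num_fillings_swap[OF moonD(1)[OF M1(1)]] M1(3)
    by (simp add: N_def)
  have mem: "(i0 + int a, j0 + int b) \<in> N \<longleftrightarrow> a < col_count N b" for a b
  proof -
    \<comment> \<open>Columns of \<open>N\<close> fill up from \<open>j0\<close>, so having more
      than \<open>b\<close> boxes means containing row \<open>j0 + b\<close>.\<close>
    have "b < card (col N i) \<longleftrightarrow> i \<in> row N (j0 + int b)" for i
    proof -
      obtain n where n: "col N i = {j0..<n}" using colN by blast
      have "i \<in> row N (j0 + int b) \<longleftrightarrow> j0 + int b \<in> col N i" by simp
      then show ?thesis unfolding n by auto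
    qed
    then have "col_count N b = card (row N (j0 + int b))" by (simp add: col_count_def)
    moreover obtain n where n: "row N (j0 + int b) = {i0..<n}" using rowN by blast
    moreover have "(i0 + int a, j0 + int b) \<in> N \<longleftrightarrow> i0 + int a \<in> row N (j0 + int b)" by simp
    ultimately show ?thesis by auto
  qed
  have N: "N = shift i0 j0 ` ferrers (col_count N)"
  proof (intro equalityI subsetI)
    fix v assume v: "v \<in> N"
    have "fst v \<in> row N (snd v)" "snd v \<in> col N (fst v)" using v by auto
    then have "i0 \<le> fst v" "j0 \<le> snd v" using rowN[of "snd v"] colN[of "fst v"] by auto
    then obtain a b where ab: "v = (i0 + int a, j0 + int b)"
      by (metis prod.collapse zle_iff_zadd)
    then have "(int a, int b) \<in> ferrers (col_count N)" using mem v by (auto simp: ferrers_def)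
    then show "v \<in> shift i0 j0 ` ferrers (col_count N)"
      by (rule image_eqI[rotated]) (simp add: ab shift_def add.commute)
  qed (auto simp: ferrers_def shift_def mem add.commute)
  have "inj (shift i0 j0)" by (auto simp: shift_def inj_def)
  then show fin: "finite (ferrers (col_count M))"
    using N finN cc by (metis finite_imageD inj_on_subset subset_UNIV)
  show "num_fillings M k = num_fillings (ferrers (col_count M)) k"
    using num_fillings_shift[OF fin, of i0 j0 k] N numN[of k] cc by simp
qed

subsection \<open>Order polynomials\<close>

text \<open>Binomial functions are used as basis instead of powers of \<open>k\<close> because the
  hockey-stick identity makes closure under partial sums immediate.\<close>

inductive newton :: "(nat \<Rightarrow> real) \<Rightarrow> bool" where
  zero: "newton (\<lambda>_. 0)"
| add_binomial: "newton f \<Longrightarrow> newton (\<lambda>k. f k + c * real (k choose s))"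

lemma newton_add: "newton g \<Longrightarrow> newton f \<Longrightarrow> newton (\<lambda>k. f k + g k)"
proof (induction rule: newton.induct)
  case (add_binomial g c s)
  have "newton (\<lambda>k. (f k + g k) + c * real (k choose s))"
    by (rule newton.add_binomial) (rule add_binomial.IH[OF add_binomial.prems])
  then show ?case by (simp add: add.assoc)
qed simp

lemma newton_sum: "finite A \<Longrightarrow> (\<And>a. a \<in> A \<Longrightarrow> newton (f a)) \<Longrightarrow> newton (\<lambda>k. \<Sum>a\<in>A. f a k)"
proof (induction rule: finite_induct)
  case empty
  then show ?case using newton.zero by simp
next
  case (insert a A)
  have "newton (\<lambda>k. f a k + (\<Sum>a\<in>A. f a k))"
    by (rule newton_add) (use insert in auto)
  then show ?case using insert(1,2) by simp
qed

lemma newton_one: "newton (\<lambda>_. 1)"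
  using newton.add_binomial[OF newton.zero, of 1 0] by simp

lemma sum_lessThan_choose: "(\<Sum>i<k. i choose s) = k choose Suc s"
  by (induction k) simp_all

lemma newton_partial_sums: "newton f \<Longrightarrow> newton (\<lambda>k. \<Sum>i<k. f i)"
proof (induction rule: newton.induct)
  case zero
  then show ?case using newton.zero by simp
next
  case (add_binomial f c s)
  have "(\<Sum>i<k. f i + c * real (i choose s)) = (\<Sum>i<k. f i) + c * real (k choose Suc s)" for k
    by (simp add: sum.distrib sum_distrib_left[symmetric] of_nat_sum[symmetric]
      sum_lessThan_choose del: of_nat_sum)
  then show ?case using newton.add_binomial[OF add_binomial.IH, of c "Suc s"] by simp
qed

lemma binomial_poly: "\<exists>p. \<forall>k. real (k choose s) = poly p (real k)"
proof (intro exI allI)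
  fix k
  show "real (k choose s) = poly (smult (1 / fact s) (\<Prod>i\<in>{0..<s}. [:- real i, 1:])) (real k)"
    by (simp add: binomial_gbinomial gbinomial_prod_rev poly_prod)
qed

lemma newton_poly: "newton f \<Longrightarrow> \<exists>p. \<forall>k. f k = poly p (real k)"
proof (induction rule: newton.induct)
  case zero
  show ?case by (intro exI[of _ 0]) simp
next
  case (add_binomial f c s)
  then obtain p where p: "\<forall>k. f k = poly p (real k)" by blast
  obtain q where "\<forall>k. real (k choose s) = poly q (real k)" using binomial_poly by blast
  then show ?case using p by (intro exI[of _ "p + smult c q"]) simp
qed

section \<open>Monotone maps on a finite poset\<close>

definition mono_maps :: "'a::order set \<Rightarrow> nat \<Rightarrow> ('a \<Rightarrow> nat) set" where
  "mono_maps P k = {y \<in> P \<rightarrow>\<^sub>E {..k}. \<forall>u\<in>P. \<forall>v\<in>P. u \<le> v \<longrightarrow> y u \<le> y v}"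

definition filters :: "'a::order set \<Rightarrow> 'a set set" where
  "filters P = {U. U \<subseteq> P \<and> (\<forall>u\<in>U. \<forall>v\<in>P. u \<le> v \<longrightarrow> v \<in> U)}"

lemma finite_mono_maps: "finite P \<Longrightarrow> finite (mono_maps P k)"
  unfolding mono_maps_def by (rule finite_subset[of _ "P \<rightarrow>\<^sub>E {..k}"]) (auto intro: finite_PiE)

lemma card_mono_maps_0: "card (mono_maps P 0) = 1"
proof -
  have "mono_maps P 0 = {\<lambda>v\<in>P. 0}"
    unfolding mono_maps_def by (auto simp: PiE_iff extensional_def fun_eq_iff)
  then show ?thesis by simp
qed

text \<open>Split by the set of elements on which the top value is attained.\<close>

lemma card_mono_maps_Suc:
  assumes fin: "finite P"
  shows "card (mono_maps P (Suc k)) = (\<Sum>U\<in>filters P. card (mono_maps (P - U) k))"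
proof -
  define top where "top y = {v\<in>P. y v = Suc k}" for y :: "'a \<Rightarrow> nat"
  have finF: "finite (filters P)"
    by (rule finite_subset[of _ "Pow P"]) (use fin in \<open>auto simp: filters_def\<close>)
  have "top ` mono_maps P (Suc k) \<subseteq> filters P"
  proof
    fix U assume "U \<in> top ` mono_maps P (Suc k)"
    then obtain y where y: "y \<in> mono_maps P (Suc k)" "U = top y" by blast
    show "U \<in> filters P" unfolding filters_def
    proof (intro CollectI conjI ballI impI)
      show "U \<subseteq> P" by (auto simp: y top_def)
      fix u v assume uv: "u \<in> U" "v \<in> P" "u \<le> v"
      then have "y u \<le> y v" "y u = Suc k" using y by (auto simp: mono_maps_def top_def)
      moreover have "y v \<le> Suc k" using y uv by (auto simp: mono_maps_def)
      ultimately show "v \<in> U" using uv by (simp add: y top_def)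
    qed
  qed
  then have "card (mono_maps P (Suc k)) =
      (\<Sum>U\<in>filters P. card {y \<in> mono_maps P (Suc k). top y = U})"
    using sum.group[of "mono_maps P (Suc k)" "filters P" top "\<lambda>_. 1 :: nat"]
      finite_mono_maps[OF fin] finF by simp
  also have "\<dots> = (\<Sum>U\<in>filters P. card (mono_maps (P - U) k))"
  proof (rule sum.cong)
    fix U assume U: "U \<in> filters P"
    have "bij_betw (\<lambda>y. restrict y (P - U)) {y \<in> mono_maps P (Suc k). top y = U} (mono_maps (P - U) k)"
    proof (rule bij_betw_byWitness[where f' = "\<lambda>z. \<lambda>v\<in>P. if v \<in> U then Suc k else z v"])
      show "\<forall>y\<in>{y \<in> mono_maps P (Suc k). top y = U}.
        (\<lambda>v\<in>P. if v \<in> U then Suc k else restrict y (P - U) v) = y"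
        by (auto simp: mono_maps_def top_def PiE_iff extensional_def fun_eq_iff)
      show "\<forall>z\<in>mono_maps (P - U) k. restrict (\<lambda>v\<in>P. if v \<in> U then Suc k else z v) (P - U) = z"
        by (auto simp: mono_maps_def PiE_iff extensional_def fun_eq_iff)
      show "(\<lambda>y. restrict y (P - U)) ` {y \<in> mono_maps P (Suc k). top y = U} \<subseteq> mono_maps (P - U) k"
      proof
        fix z assume "z \<in> (\<lambda>y. restrict y (P - U)) ` {y \<in> mono_maps P (Suc k). top y = U}"
        then obtain y where y: "y \<in> mono_maps P (Suc k)" "top y = U" "z = restrict y (P - U)" by blast
        have "y v \<le> k" if "v \<in> P - U" for v
        proof -
          have "y v \<le> Suc k" "y v \<noteq> Suc k" using that y by (auto simp: mono_maps_def top_def)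
          then show ?thesis by simp
        qed
        then show "z \<in> mono_maps (P - U) k"
          using y by (auto simp: mono_maps_def)
      qed
      show "(\<lambda>z. \<lambda>v\<in>P. if v \<in> U then Suc k else z v) ` mono_maps (P - U) k
        \<subseteq> {y \<in> mono_maps P (Suc k). top y = U}"
      proof
        fix y assume "y \<in> (\<lambda>z. \<lambda>v\<in>P. if v \<in> U then Suc k else z v) ` mono_maps (P - U) k"
        then obtain z where z: "z \<in> mono_maps (P - U) k" "y = (\<lambda>v\<in>P. if v \<in> U then Suc k else z v)"
          by blast
        have zk: "z v \<le> k" if "v \<in> P" "v \<notin> U" for v using z that by (auto simp: mono_maps_def)
        have "y u \<le> y v" if "u \<in> P" "v \<in> P" "u \<le> v" for u v
        proof (cases "v \<in> U")
          case True
          then show ?thesis using that zk[of u] by (auto simp: z(2) le_SucI)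
        next
          case False
          then have "u \<notin> U" using U that by (auto simp: filters_def)
          then show ?thesis using that False z(1) by (simp add: z(2) mono_maps_def)
        qed
        moreover have "y \<in> P \<rightarrow>\<^sub>E {..Suc k}" using zk by (auto simp: z(2) le_SucI)
        moreover have "top y = U"
        proof -
          have "y v = Suc k \<longleftrightarrow> v \<in> U" if "v \<in> P" for v
            using zk[of v] that by (auto simp: z(2))
          then show ?thesis using U by (auto simp: top_def filters_def)
        qed
        ultimately show "y \<in> {y \<in> mono_maps P (Suc k). top y = U}" by (simp add: mono_maps_def)
      qed
    qed
    then show "card {y \<in> mono_maps P (Suc k). top y = U} = card (mono_maps (P - U) k)"
      by (rule bij_betw_same_card)
  qed simp
  finally show ?thesis .
qed

text \<open>The empty filter contributes the count for \<open>P\<close> and \<open>k\<close> itself,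
  so the first difference in \<open>k\<close> is a sum of counts for proper subsets of
  \<open>P\<close>; summing it up preserves \<open>newton\<close>.\<close>

lemma newton_mono_maps:
  assumes "finite P"
  shows "newton (\<lambda>k. real (card (mono_maps P k)))"
  using assms
proof (induction P rule: finite_psubset_induct)
  case (psubset P)
  define F where "F = filters P - {{}}"
  have finF: "finite F" unfolding F_def filters_def
    by (rule finite_subset[of _ "Pow P"]) (use psubset(1) in auto)
  define d where "d k = (\<Sum>U\<in>F. real (card (mono_maps (P - U) k)))" for k
  have "newton d" unfolding d_def
  proof (rule newton_sum[OF finF])
    fix U assume "U \<in> F"
    then have "P - U \<subset> P" by (auto simp: F_def filters_def)
    then show "newton (\<lambda>k. real (card (mono_maps (P - U) k)))" by (rule psubset.IH)
  qed
  then have n: "newton (\<lambda>k. 1 + (\<Sum>i<k. d i))"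
    by (intro newton_add newton_partial_sums newton_one)
  have "{} \<in> filters P" by (simp add: filters_def)
  then have split: "filters P = insert {} F" and notin: "{} \<notin> F" by (auto simp: F_def)
  have Suc: "real (card (mono_maps P (Suc k))) = real (card (mono_maps P k)) + d k" for k
    unfolding card_mono_maps_Suc[OF psubset(1)] split d_def
    using finF notin by simp
  have "real (card (mono_maps P k)) = 1 + (\<Sum>i<k. d i)" for k
    by (induction k) (simp_all add: card_mono_maps_0 Suc)
  then show ?case using n by simp
qed

section \<open>The transfer map\<close>

definition chain_fillings :: "'a::order set \<Rightarrow> nat \<Rightarrow> ('a \<Rightarrow> nat) set" where
  "chain_fillings P k = {x \<in> P \<rightarrow>\<^sub>E UNIV.
     \<forall>C. C \<subseteq> P \<and> Complete_Partial_Order.chain (\<le>) C \<longrightarrow> (\<Sum>v\<in>C. x v) \<le> k}"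

lemma finite_chain_top:
  fixes C :: "'a::order set"
  assumes "finite C" "C \<noteq> {}" "Complete_Partial_Order.chain (\<le>) C"
  obtains t where "t \<in> C" "\<And>v. v \<in> C \<Longrightarrow> v \<le> t"
proof -
  obtain t where t: "t \<in> C" "\<forall>v\<in>C. t \<le> v \<longrightarrow> t = v"
    using finite_has_maximal[OF assms(1,2)] by blast
  have "v \<le> t" if "v \<in> C" for v
    using assms(3) t that unfolding Complete_Partial_Order.chain_def by blast
  then show thesis using that t(1) by blast
qed

text \<open>The inserted 0 is the value at minimal elements and does not affect maxima of natural
  numbers.\<close>

definition max_below :: "'a::order set \<Rightarrow> ('a \<Rightarrow> nat) \<Rightarrow> 'a \<Rightarrow> nat" where
  "max_below P y v = Max (insert 0 (y ` {u\<in>P. u < v}))"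

lemma max_below_ge: "finite P \<Longrightarrow> u \<in> P \<Longrightarrow> u < v \<Longrightarrow> y u \<le> max_below P y v"
  unfolding max_below_def by (rule Max_ge) auto

lemma max_below_le:
  "finite P \<Longrightarrow> (\<And>u. u \<in> P \<Longrightarrow> u < v \<Longrightarrow> y u \<le> b) \<Longrightarrow> max_below P y v \<le> b"
  unfolding max_below_def by (subst Max_le_iff) auto

text \<open>Stanley's transfer map between the chain polytope and the order polytope.\<close>

lemma card_chain_fillings:
  assumes fin: "finite P"
  shows "card (chain_fillings P k) = card (mono_maps P k)"
proof -
  define T where "T y = (\<lambda>v\<in>P. y v - max_below P y v)" for y :: "'a \<Rightarrow> nat"
  have below: "max_below P y v \<le> y v" if "y \<in> mono_maps P k" "v \<in> P" for y v
    using that fin by (intro max_below_le) (auto simp: mono_maps_def)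
  have "inj_on T (mono_maps P k)"
  proof (rule inj_onI)
    fix y y' assume y: "y \<in> mono_maps P k" "y' \<in> mono_maps P k" "T y = T y'"
    have "y v = y' v" if "v \<in> P" for v
      using that
    proof (induction "card {u\<in>P. u < v}" arbitrary: v rule: less_induct)
      case less
      have "y u = y' u" if u: "u \<in> P" "u < v" for u
      proof (rule less.hyps[OF _ u(1)])
        have "{w\<in>P. w < u} \<subset> {w\<in>P. w < v}" using u by auto
        then show "card {w\<in>P. w < u} < card {w\<in>P. w < v}"
          using fin by (intro psubset_card_mono) auto
      qed
      then have "max_below P y v = max_below P y' v"
        unfolding max_below_def by (intro arg_cong[where f = Max] arg_cong2[where f = insert] image_cong) auto
      moreover have "y v - max_below P y v = y' v - max_below P y' v"
        using fun_cong[OF y(3), of v] less.prems by (simp add: T_def)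
      ultimately show ?case using below[OF y(1) less.prems] below[OF y(2) less.prems] by linarith
    qed
    then show "y = y'" using y(1,2) by (intro PiE_ext[of y P "\<lambda>_. {..k}"]) (auto simp: mono_maps_def)
  qed
  moreover have "T ` mono_maps P k = chain_fillings P k"
  proof (intro equalityI subsetI)
    fix x assume "x \<in> T ` mono_maps P k"
    then obtain y where y: "y \<in> mono_maps P k" "x = T y" by blast
    \<comment> \<open>Along a chain the differences telescope: the part below \<open>t\<close>
      weighs at most the value of \<open>y\<close> at its own top, which is at most
      \<open>max_below P y t\<close>.\<close>
    have top: "(\<Sum>v\<in>C. x v) \<le> y t"
      if "C \<subseteq> P" "Complete_Partial_Order.chain (\<le>) C" "t \<in> C" "\<And>v. v \<in> C \<Longrightarrow> v \<le> t" for C t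
      using that
    proof (induction "card C" arbitrary: C t rule: less_induct)
      case less
      have finC: "finite C" using less.prems(1) fin finite_subset by blast
      define D where "D = C - {t}"
      have D: "D \<subseteq> P" "Complete_Partial_Order.chain (\<le>) D" "finite D" "card D < card C"
        using less.prems finC card_Diff1_less[OF finC less.prems(3)]
        by (auto simp: D_def Complete_Partial_Order.chain_def)
      have "(\<Sum>v\<in>D. x v) \<le> max_below P y t"
      proof (cases "D = {}")
        case False
        obtain s where s: "s \<in> D" "\<And>v. v \<in> D \<Longrightarrow> v \<le> s"
          using finite_chain_top[OF D(3) False D(2)] by blast
        have "s < t" using s(1) less.prems(4) unfolding D_def by force
        have "(\<Sum>v\<in>D. x v) \<le> y s" using less.hyps[OF D(4,1,2) s] by blast
        also have "\<dots> \<le> max_below P y t"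
          using max_below_ge[OF fin _ \<open>s < t\<close>] s(1) D(1) by blast
        finally show ?thesis .
      qed simp
      moreover have "(\<Sum>v\<in>C. x v) = x t + (\<Sum>v\<in>D. x v)"
        unfolding D_def by (rule sum.remove[OF finC less.prems(3)])
      moreover have "t \<in> P" using less.prems by blast
      moreover have "x t = y t - max_below P y t" using \<open>t \<in> P\<close> by (simp add: y T_def)
      ultimately show ?case using below[OF y(1) \<open>t \<in> P\<close>] by linarith
    qed
    have "(\<Sum>v\<in>C. x v) \<le> k" if C: "C \<subseteq> P" "Complete_Partial_Order.chain (\<le>) C" for C
    proof (cases "C = {}")
      case False
      have "finite C" using C fin finite_subset by blast
      then obtain t where t: "t \<in> C" "\<And>v. v \<in> C \<Longrightarrow> v \<le> t"
        using finite_chain_top[OF _ False C(2)] by blast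
      have "(\<Sum>v\<in>C. x v) \<le> y t" using top[OF C t] by blast
      also have "\<dots> \<le> k" using y(1) t(1) C(1) by (auto simp: mono_maps_def)
      finally show ?thesis .
    qed simp
    moreover have "x \<in> P \<rightarrow>\<^sub>E UNIV" by (simp add: y T_def)
    ultimately show "x \<in> chain_fillings P k" by (simp add: chain_fillings_def)
  next
    fix x assume x: "x \<in> chain_fillings P k"
    \<comment> \<open>The preimage assigns to \<open>v\<close> the largest weight of a chain of
      elements at most \<open>v\<close>. Chains need not contain \<open>v\<close>, which makes
      monotonicity immediate.\<close>
    define Ch where "Ch v = {C. C \<subseteq> {u\<in>P. u \<le> v} \<and> Complete_Partial_Order.chain (\<le>) C}" for v
    have finCh: "finite (Ch v)" for v
      by (rule finite_subset[of _ "Pow P"]) (use fin in \<open>auto simp: Ch_def\<close>)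
    have empty: "{} \<in> Ch v" for v by (simp add: Ch_def Complete_Partial_Order.chain_def)
    define y where "y = (\<lambda>v\<in>P. Max (sum x ` Ch v))"
    have y_ge: "sum x C \<le> y v" if "C \<in> Ch v" "v \<in> P" for C v
      using that finCh by (simp add: y_def)
    have y_le: "y v \<le> b" if "v \<in> P" "\<And>C. C \<in> Ch v \<Longrightarrow> sum x C \<le> b" for v b
    proof -
      have "Max (sum x ` Ch v) \<le> b"
        using that finCh[of v] empty[of v] by (subst Max_le_iff) auto
      then show ?thesis using that(1) by (simp add: y_def)
    qed
    have yk: "y v \<le> k" if "v \<in> P" for v
      using that x by (intro y_le) (auto simp: Ch_def chain_fillings_def)
    have mono: "y u \<le> y v" if uv: "u \<in> P" "v \<in> P" "u \<le> v" for u v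
    proof (rule y_le[OF uv(1)])
      fix C assume "C \<in> Ch u"
      then have "C \<in> Ch v" using uv(3) by (auto simp: Ch_def intro: order_trans)
      then show "sum x C \<le> y v" using y_ge uv by blast
    qed
    have ym: "y \<in> mono_maps P k" using yk mono by (auto simp: mono_maps_def y_def)
    have "y v = x v + max_below P y v" if v: "v \<in> P" for v
    proof (rule antisym)
      show "y v \<le> x v + max_below P y v"
      proof (rule y_le[OF v])
        fix C assume C: "C \<in> Ch v"
        define D where "D = C - {v}"
        have D: "D \<subseteq> P" "finite D" "Complete_Partial_Order.chain (\<le>) D"
          using C fin finite_subset[of C P]
          by (auto simp: D_def Ch_def Complete_Partial_Order.chain_def)
        have "sum x D \<le> max_below P y v"
        proof (cases "D = {}")
          case False
          obtain s where s: "s \<in> D" "\<And>u. u \<in> D \<Longrightarrow> u \<le> s"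
            using finite_chain_top[OF D(2) False D(3)] by blast
          have "s < v" "s \<in> P" using s(1) C by (auto simp: D_def Ch_def)
          have "D \<in> Ch s" using D s(2) by (auto simp: Ch_def)
          then have "sum x D \<le> y s" using y_ge \<open>s \<in> P\<close> by blast
          also have "\<dots> \<le> max_below P y v" by (rule max_below_ge[OF fin \<open>s \<in> P\<close> \<open>s < v\<close>])
          finally show ?thesis .
        qed simp
        moreover have "finite C" using C fin finite_subset[of C P] by (auto simp: Ch_def)
        then have "sum x C \<le> x v + sum x D"
          unfolding D_def by (cases "v \<in> C") (simp_all add: sum.remove)
        ultimately show "sum x C \<le> x v + max_below P y v" by linarith
      qed
      \<comment> \<open>A chain below some \<open>u < v\<close> can be extended by \<open>v\<close>;
        maximizing over such chains bounds \<open>max_below P y v + x v\<close> by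
        \<open>y v\<close>.\<close>
      have ext: "sum x C + x v \<le> y v" if C: "C \<in> Ch u" "u < v" for C u
      proof -
        have "insert v C \<in> Ch v"
          using C v by (auto simp: Ch_def Complete_Partial_Order.chain_def intro: order_trans less_imp_le)
        then have "sum x (insert v C) \<le> y v" using y_ge v by blast
        moreover have "v \<notin> C" "finite C" using C fin finite_subset[of C P] by (auto simp: Ch_def)
        ultimately show ?thesis by simp
      qed
      have xv: "x v \<le> y v"
      proof -
        have "{v} \<in> Ch v" using v by (simp add: Ch_def Complete_Partial_Order.chain_def)
        then show ?thesis using y_ge[of "{v}" v] v by simp
      qed
      have "max_below P y v \<le> y v - x v"
      proof (rule max_below_le[OF fin])
        fix u assume u: "u \<in> P" "u < v"
        show "y u \<le> y v - x v"
          using ext[OF _ u(2)] by (intro y_le[OF u(1)]) fastforce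
      qed
      then show "x v + max_below P y v \<le> y v" using xv by simp
    qed
    then have "T y v = x v" if "v \<in> P" for v using that by (simp add: T_def)
    moreover have "x \<in> P \<rightarrow>\<^sub>E UNIV" using x by (simp add: chain_fillings_def)
    ultimately have "x = T y" by (intro PiE_ext[of x P "\<lambda>_. UNIV"]) (auto simp: T_def)
    then show "x \<in> T ` mono_maps P k" using ym by blast
  qed
  ultimately have "bij_betw T (mono_maps P k) (chain_fillings P k)" by (simp add: bij_betw_def)
  then show ?thesis by (metis bij_betw_same_card)
qed

subsection \<open>Ehrhart functions\<close>

lemma ferrers_col_count_downward:
  assumes "finite M" "(i, j) \<in> ferrers (col_count M)" "0 \<le> i'" "i' \<le> i" "0 \<le> j'" "j' \<le> j"
  shows "(i', j') \<in> ferrers (col_count M)"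
proof -
  obtain a b where ab: "i = int a" "j = int b" "a < col_count M b"
    using assms(2) by (auto simp: ferrers_def)
  obtain a' b' where ab': "i' = int a'" "j' = int b'"
    using assms(3,5) by (metis zero_le_imp_eq_int)
  have "a' \<le> a" "b' \<le> b" using ab ab' assms by simp_all
  have "{i. b' < card (col M i)} \<subseteq> fst ` M"
  proof
    fix i assume "i \<in> {i. b' < card (col M i)}"
    then have "col M i \<noteq> {}" by (metis card.empty mem_Collect_eq not_less0)
    then show "i \<in> fst ` M" by force
  qed
  then have "finite {i. b' < card (col M i)}" using assms(1) finite_subset by blast
  then have "col_count M b \<le> col_count M b'"
    unfolding col_count_def using \<open>b' \<le> b\<close> by (intro card_mono) auto
  then show ?thesis using ab ab' \<open>a' \<le> a\<close> by (auto simp: ferrers_def)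
qed

text \<open>The rectangle spanned by the origin and the top box of a chain contains the chain and
  lies in \<open>P\<close>, so bounding all rectangles bounds all chains.\<close>

lemma bounded_fillings_order_ideal:
  assumes fin: "finite P" and nonneg: "\<And>i j. (i, j) \<in> P \<Longrightarrow> 0 \<le> i \<and> 0 \<le> j"
    and down: "\<And>i j i' j'. (i, j) \<in> P \<Longrightarrow> 0 \<le> i' \<Longrightarrow> i' \<le> i \<Longrightarrow> 0 \<le> j' \<Longrightarrow> j' \<le> j \<Longrightarrow> (i', j') \<in> P"
  shows "bounded_fillings P k = chain_fillings P k"
proof (intro equalityI subsetI)
  fix x assume x: "x \<in> bounded_fillings P k"
  have "(\<Sum>v\<in>C. x v) \<le> k" if C: "C \<subseteq> P" "Complete_Partial_Order.chain (\<le>) C" for C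
  proof (cases "C = {}")
    case False
    have finC: "finite C" using C fin finite_subset by blast
    then obtain t where t: "t \<in> C" "\<And>v. v \<in> C \<Longrightarrow> v \<le> t"
      using finite_chain_top[OF _ False C(2)] by blast
    have tP: "(fst t, snd t) \<in> P" using t(1) C(1) by auto
    have "{0..fst t} \<times> {0..snd t} \<subseteq> P" using down[OF tP] by auto
    then have bnd: "chain_bnd (\<lambda>v. int (x v)) ({0..fst t} \<times> {0..snd t}) (int k)"
      using x unfolding bounded_fillings_def by blast
    have "C \<subseteq> {0..fst t} \<times> {0..snd t}"
    proof
      fix v assume "v \<in> C"
      then show "v \<in> {0..fst t} \<times> {0..snd t}"
        using t(2)[of v] C(1) nonneg[of "fst v" "snd v"] by (auto simp: mem_Times_iff less_eq_prod_def)
    qed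
    then have "(\<Sum>v\<in>C. int (x v)) \<le> int k" using bnd C(2) finC unfolding chain_bnd_def by blast
    then show ?thesis unfolding of_nat_sum[symmetric] of_nat_le_iff .
  qed simp
  then show "x \<in> chain_fillings P k"
    using x by (simp add: chain_fillings_def bounded_fillings_def fillings_def)
next
  fix x assume x: "x \<in> chain_fillings P k"
  have "chain_bnd (\<lambda>v. int (x v)) R (int k)" if "R \<subseteq> P" for R
    unfolding chain_bnd_def of_nat_sum[symmetric] of_nat_le_iff
  proof (intro allI impI)
    fix C assume "C \<subseteq> R \<and> finite C \<and> Complete_Partial_Order.chain (\<le>) C"
    then show "(\<Sum>v\<in>C. x v) \<le> k" using x that unfolding chain_fillings_def by blast
  qed
  then show "x \<in> bounded_fillings P k"
    using x by (simp add: chain_fillings_def bounded_fillings_def fillings_def)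
qed

lemma num_fillings_ferrers:
  assumes "finite M" and fin: "finite (ferrers (col_count M))"
  shows "newton (\<lambda>k. real (num_fillings (ferrers (col_count M)) k))"
proof -
  have "bounded_fillings (ferrers (col_count M)) k = chain_fillings (ferrers (col_count M)) k" for k
  proof (rule bounded_fillings_order_ideal[OF fin])
    show "0 \<le> i \<and> 0 \<le> j" if "(i, j) \<in> ferrers (col_count M)" for i j
      using that by (auto simp: ferrers_def)
  qed (rule ferrers_col_count_downward[OF assms(1)])
  then show ?thesis
    using newton_mono_maps[OF fin] by (simp add: num_fillings_def card_chain_fillings[OF fin])
qed

section \<open>Cliques, weak chains and dilations\<close>

lemma box_graph_edge_iff:
  assumes "u \<noteq> v" "u \<le> v"
  shows "{u, v} \<in> box_graph M \<longleftrightarrow>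
    u \<in> M \<and> v \<in> M \<and> {fst u..fst v} \<times> {snd u..snd v} \<subseteq> M"
proof
  assume "{u, v} \<in> box_graph M"
  then obtain a b c d where e: "{u, v} = {(a, b), (c, d)}" "(a, b) \<in> M" "(c, d) \<in> M" "a \<le> c" "b \<le> d"
    "{a..c} \<times> {b..d} \<subseteq> M"
    unfolding box_graph_def by blast
  have "u = (a, b) \<and> v = (c, d)"
    using e(1) assms e(4,5) by (auto simp: doubleton_eq_iff less_eq_prod_def)
  then show "u \<in> M \<and> v \<in> M \<and> {fst u..fst v} \<times> {snd u..snd v} \<subseteq> M" using e by simp
next
  assume "u \<in> M \<and> v \<in> M \<and> {fst u..fst v} \<times> {snd u..snd v} \<subseteq> M"
  then have "{(fst u, snd u), (fst v, snd v)} \<in> box_graph M"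
    unfolding box_graph_def using assms
    by (intro CollectI exI[of _ "fst u"] exI[of _ "snd u"] exI[of _ "fst v"] exI[of _ "snd v"])
      (auto simp: less_eq_prod_def)
  then show "{u, v} \<in> box_graph M" by simp
qed

text \<open>A nonempty clique is a chain and has a bottom and a top box; the edge between them (or
  their equality) supplies one rectangle containing the whole clique.\<close>

lemma clique_iff_weak_ne_chain:
  assumes "finite M"
  shows "C \<subseteq> M \<and> clique C (box_graph M) \<longleftrightarrow> weak_ne_chain M C"
proof
  assume C: "C \<subseteq> M \<and> clique C (box_graph M)"
  have comp: "u \<le> v \<or> v \<le> u" if "u \<in> C" "v \<in> C" for u v
  proof (cases "u = v")
    case False
    then have "{u, v} \<in> box_graph M" using C that by (auto simp: clique_def)
    then obtain a b c d where "{u, v} = {(a, b), (c, d)}" "a \<le> c" "b \<le> d"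
      unfolding box_graph_def by blast
    then show ?thesis by (auto simp: doubleton_eq_iff less_eq_prod_def)
  qed simp
  then have chain: "Complete_Partial_Order.chain (\<le>) C"
    by (simp add: Complete_Partial_Order.chain_def)
  show "weak_ne_chain M C"
  proof (cases "C = {}")
    case True
    then show ?thesis unfolding weak_ne_chain_def
      by (intro exI[of _ "1 :: int"] exI[of _ "0 :: int"]) (simp add: Complete_Partial_Order.chain_def)
  next
    case False
    have finC: "finite C" using C assms finite_subset by blast
    obtain t where t: "t \<in> C" "\<And>v. v \<in> C \<Longrightarrow> v \<le> t"
      using finite_chain_top[OF finC False chain] by blast
    obtain b where b: "b \<in> C" "\<forall>v\<in>C. v \<le> b \<longrightarrow> b = v"
      using finite_has_minimal[OF finC False] by blast
    have bot: "b \<le> v" if "v \<in> C" for v using comp[OF b(1) that] b(2) that by auto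
    have "{fst b..fst t} \<times> {snd b..snd t} \<subseteq> M"
    proof (cases "b = t")
      case True
      then have "{fst b..fst t} \<times> {snd b..snd t} = {t}" by (cases t) simp
      then show ?thesis using C t(1) by auto
    next
      case False
      then have "{b, t} \<in> box_graph M" using C b(1) t(1) by (auto simp: clique_def)
      then show ?thesis using box_graph_edge_iff[OF False bot[OF t(1)]] by simp
    qed
    moreover have "C \<subseteq> {fst b..fst t} \<times> {snd b..snd t}"
      using bot t(2) by (fastforce simp: less_eq_prod_def mem_Times_iff)
    ultimately show ?thesis unfolding weak_ne_chain_def using chain by blast
  qed
next
  assume "weak_ne_chain M C"
  then obtain p q c d where R: "{p..q} \<times> {c..d} \<subseteq> M" "C \<subseteq> {p..q} \<times> {c..d}"
    and chain: "Complete_Partial_Order.chain (\<le>) C" unfolding weak_ne_chain_def by blast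
  have edge: "{u, v} \<in> box_graph M" if "u \<in> C" "v \<in> C" "u \<noteq> v" "u \<le> v" for u v
  proof -
    have "{fst u..fst v} \<times> {snd u..snd v} \<subseteq> {p..q} \<times> {c..d}"
    proof -
      have "u \<in> {p..q} \<times> {c..d}" "v \<in> {p..q} \<times> {c..d}" using R(2) that by blast+
      then show ?thesis by (auto simp: mem_Times_iff)
    qed
    then show ?thesis using box_graph_edge_iff[OF that(3,4)] R that by blast
  qed
  have "{u, v} \<in> box_graph M" if "u \<in> C" "v \<in> C" "u \<noteq> v" for u v
    using edge[of u v] edge[of v u] chain that
    unfolding Complete_Partial_Order.chain_def by (auto simp: insert_commute)
  then show "C \<subseteq> M \<and> clique C (box_graph M)" using R by (auto simp: clique_def)
qed

text \<open>For positive \<open>k\<close> one divides by \<open>k\<close>. The dilate by 0 consists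
  of the zero vector only, and the inequalities must be checked to force this too.\<close>

lemma mem_dilate_QSTAB:
  assumes "finite M"
  shows "y \<in> dilate M (real k) (QSTAB M) \<longleftrightarrow>
    y \<in> M \<rightarrow>\<^sub>E UNIV \<and> (\<forall>v\<in>M. 0 \<le> y v) \<and> (\<forall>C. weak_ne_chain M C \<longrightarrow> (\<Sum>v\<in>C. y v) \<le> real k)"
    (is "_ \<longleftrightarrow> ?R")
proof -
  have Q: "QSTAB M = {x \<in> M \<rightarrow>\<^sub>E UNIV. (\<forall>v\<in>M. 0 \<le> x v) \<and>
     (\<forall>C. weak_ne_chain M C \<longrightarrow> (\<Sum>v\<in>C. x v) \<le> 1)}"
    unfolding QSTAB_def clique_iff_weak_ne_chain[OF assms] by simp
  have sub: "C \<subseteq> M" if "weak_ne_chain M C" for C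
    using that clique_iff_weak_ne_chain[OF assms] by blast
  have scale: "(\<Sum>v\<in>C. (\<lambda>v\<in>M. c * x v) v) = c * (\<Sum>v\<in>C. x v)" if "weak_ne_chain M C"
    for C and c :: real and x
    unfolding sum_distrib_left using sub[OF that] by (intro sum.cong) auto
  show ?thesis
  proof
    assume "y \<in> dilate M (real k) (QSTAB M)"
    then obtain x where x: "x \<in> QSTAB M" "y = (\<lambda>v\<in>M. real k * x v)" unfolding dilate_def by blast
    have "(\<Sum>v\<in>C. y v) \<le> real k" if C: "weak_ne_chain M C" for C
    proof -
      have "(\<Sum>v\<in>C. x v) \<le> 1" using x(1) C unfolding Q by blast
      then have "real k * (\<Sum>v\<in>C. x v) \<le> real k * 1" by (intro mult_left_mono) auto
      then show ?thesis using scale[OF C] x(2) by simp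
    qed
    then show ?R using x unfolding Q by auto
  next
    assume R: ?R
    show "y \<in> dilate M (real k) (QSTAB M)"
    proof (cases "k = 0")
      case True
      \<comment> \<open>Each single box is a weak chain, so its label is at most \<open>k\<close>,
        which is 0 here.\<close>
      have "y v = 0" if "v \<in> M" for v
      proof -
        have "weak_ne_chain M {v}"
          using clique_iff_weak_ne_chain[OF assms, of "{v}"] that by (simp add: clique_def)
        then have "(\<Sum>v\<in>{v}. y v) \<le> real k" using R by blast
        then show ?thesis using R that True by force
      qed
      then have "y = (\<lambda>v\<in>M. real k * (\<lambda>v\<in>M. 0) v)"
        using R True by (intro PiE_ext[of y M "\<lambda>_. UNIV"]) auto
      moreover have "(\<lambda>v\<in>M. 0) \<in> QSTAB M"
        unfolding Q using scale[of _ 0] by (auto simp: sum.neutral subset_iff dest!: sub)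
      ultimately show ?thesis unfolding dilate_def by blast
    next
      case False
      define x where "x = (\<lambda>v\<in>M. (1 / real k) * y v)"
      have "x \<in> QSTAB M"
        unfolding Q
      proof (intro CollectI conjI allI impI)
        show "\<forall>v\<in>M. 0 \<le> x v" using R by (simp add: x_def)
        fix C assume C: "weak_ne_chain M C"
        have "(1 / real k) * (\<Sum>v\<in>C. y v) \<le> (1 / real k) * real k"
          using R C by (intro mult_left_mono) auto
        then show "(\<Sum>v\<in>C. x v) \<le> 1" using scale[OF C, of "1 / real k" y] False by (simp add: x_def)
      qed (simp add: x_def)
      moreover have "y = (\<lambda>v\<in>M. real k * x v)"
        using R False by (intro PiE_ext[of y M "\<lambda>_. UNIV"]) (auto simp: x_def)
      ultimately show ?thesis unfolding dilate_def by blast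
    qed
  qed
qed

lemma ehrhart_QSTAB:
  assumes fin: "finite M"
  shows "ehrhart_fun M (QSTAB M) k = num_fillings M k"
proof -
  define S where "S = {x \<in> fillings M. \<forall>C. weak_ne_chain M C \<longrightarrow> (\<Sum>v\<in>C. x v) \<le> k}"
  have sub: "C \<subseteq> M" if "weak_ne_chain M C" for C
    using that clique_iff_weak_ne_chain[OF fin] by blast
  have S: "S = bounded_fillings M k"
    unfolding bounded_fillings_eq[OF fin, symmetric] S_def max_chain_weight_le_iff[OF fin] by simp
  define h where "h x = (\<lambda>v\<in>M. real (x v))" for x :: "box \<Rightarrow> nat"
  have sum_h: "(\<Sum>v\<in>C. h x v) \<le> real k \<longleftrightarrow> (\<Sum>v\<in>C. x v) \<le> k" if "weak_ne_chain M C" for C x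
  proof -
    have "(\<Sum>v\<in>C. h x v) = real (\<Sum>v\<in>C. x v)"
      unfolding of_nat_sum using sub[OF that] by (intro sum.cong) (auto simp: h_def)
    then show ?thesis by (simp only: of_nat_le_iff)
  qed
  have "inj_on h S"
  proof (rule inj_onI)
    fix x y assume xy: "x \<in> S" "y \<in> S" "h x = h y"
    have "x v = y v" if "v \<in> M" for v using fun_cong[OF xy(3), of v] that by (simp add: h_def)
    then show "x = y" using xy by (intro PiE_ext[of x M "\<lambda>_. UNIV"]) (auto simp: S_def fillings_def)
  qed
  moreover have "h ` S = (M \<rightarrow>\<^sub>E \<int>) \<inter> dilate M (real k) (QSTAB M)"
  proof (intro equalityI subsetI)
    fix y assume "y \<in> h ` S"
    then obtain x where x: "x \<in> S" "y = h x" by blast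
    then show "y \<in> (M \<rightarrow>\<^sub>E \<int>) \<inter> dilate M (real k) (QSTAB M)"
      using sum_h by (auto simp: mem_dilate_QSTAB[OF fin] S_def h_def)
  next
    fix y assume "y \<in> (M \<rightarrow>\<^sub>E \<int>) \<inter> dilate M (real k) (QSTAB M)"
    then have y: "y \<in> M \<rightarrow>\<^sub>E \<int>" "\<forall>v\<in>M. 0 \<le> y v" "\<forall>C. weak_ne_chain M C \<longrightarrow> (\<Sum>v\<in>C. y v) \<le> real k"
      by (auto simp: mem_dilate_QSTAB[OF fin])
    define x where "x = (\<lambda>v\<in>M. nat \<lfloor>y v\<rfloor>)"
    have "h x v = y v" if "v \<in> M" for v
    proof -
      have "y v \<in> \<int>" "0 \<le> y v" using y that by auto
      then show ?thesis using that by (auto simp: h_def x_def elim!: Ints_cases)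
    qed
    then have hx: "h x = y" using y(1) by (intro PiE_ext[of "h x" M "\<lambda>_. UNIV"]) (auto simp: h_def)
    have "x \<in> S" using y(3) sum_h unfolding S_def hx[symmetric] by (auto simp: fillings_def x_def)
    then show "y \<in> h ` S" using hx by blast
  qed
  ultimately show ?thesis
    unfolding ehrhart_fun_def num_fillings_def S[symmetric] using card_image by metis
qed

theorem corollary4p7:
  fixes M :: "(int \<times> int) set"
  assumes "moon_polyomino M"
  shows "\<exists>p :: real poly.
    (\<forall>k::nat. real (ehrhart_fun M (QSTAB M) k) = poly p (real k)) \<and>
    (\<forall>k::nat. real (card {x \<in> fillings M. max_chain_weight M x \<le> k}) = poly p (real k)) \<and>
    (\<forall>N. moon_polyomino N \<and> moon_equiv M N \<longrightarrow>
      (\<forall>k::nat. real (ehrhart_fun N (QSTAB N) k) = poly p (real k)) \<and>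
      (\<forall>k::nat. real (card {x \<in> fillings N. max_chain_weight N x \<le> k}) = poly p (real k)))"
proof -
  have counts: "ehrhart_fun N (QSTAB N) k = num_fillings N k"
    "card {x \<in> fillings N. max_chain_weight N x \<le> k} = num_fillings N k"
    if "moon_polyomino N" for N k
    using ehrhart_QSTAB bounded_fillings_eq moonD(1)[OF that] by (simp_all add: num_fillings_def)
  have "newton (\<lambda>k. real (num_fillings M k))"
    using num_fillings_ferrers[OF moonD(1)[OF assms] moon_normal_form(1)[OF assms]]
    by (simp add: moon_normal_form(2)[OF assms])
  then obtain p where p: "\<forall>k. real (num_fillings M k) = poly p (real k)" using newton_poly by blast
  \<comment> \<open>Both counts equal that of one Ferrers shape, because \<open>col_count\<close>
    agrees on equivalent polyominoes; so the same polynomial serves \<open>N\<close>.\<close>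
  have "num_fillings N k = num_fillings M k" if "moon_polyomino N" "moon_equiv M N" for N k
    using moon_normal_form(2)[OF that(1)] moon_normal_form(2)[OF assms]
      moon_equiv_col_count[OF that(2)] by simp
  then show ?thesis using p counts assms by (intro exI[of _ p]) auto
qed

end
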